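(* Let $n\ge 3$. Let $U\subset \mathcal S^{n\times n}$ be an open set such that $O^{-1}UO=U$ for all $O\in O(n)$, and such that $U\cap\{M+tN \mid 0<t<\infty\}$ is convex for all $M\in\mathcal S^{n\times n}$ and all $N\in\mathcal S^{n\times n}_+$. Let $F\in C^1(U)$ satisfy $F(O^{-1}MO)=F(M)$ for all $M\in U$, $O\in O(n)$, and assume the matrix $\left(\frac{\partial F}{\partial M_{ij}}(M)\right)$ is positive definite for all $M\in U$. Assume that $u\in C^2(\mathbb R^n\setminus\{0\})$ satisfies $$u>0,\quad \Delta u\le 0,\quad A^u\in U,\quad F(A^u)=1\qquad\text{in } \mathbb R^n\setminus\{0\},$$ and that $u$ cannot be extended as a $C^2$ positive function satisfying $A^u\in U$ near the origin. Then $u$ is radially symmetric about the origin.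
   Context: $\mathcal S^{n\times n}$ is the set of real symmetric $n\times n$ matrices, $\mathcal S^{n\times n}_+$ the subset of positive definite ones, $O(n)$ the real orthogonal $n\times n$ matrices. For a positive $C^2$ function $u$, $$A^u=-\frac{2}{n-2}u^{-\frac{n+2}{n-2}}\nabla^2u+\frac{2n}{(n-2)^2}u^{-\frac{2n}{n-2}}\nabla u\otimes\nabla u-\frac{2}{(n-2)^2}u^{-\frac{2n}{n-2}}|\nabla u|^2 I,$$ where $\nabla u$ is the gradient, $\nabla^2u$ the Hessian of $u$ and $I$ the identity matrix. *)

theory Defs
  imports "HOL-Analysis.Analysis"
begin

definition sym_mats :: "(real ^ 'n ^ 'n) set" where
  "sym_mats = {M. transpose M = M}"

definition pos_def_mats :: "(real ^ 'n ^ 'n) set" where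
  "pos_def_mats = {M \<in> sym_mats. \<forall>v. v \<noteq> 0 \<longrightarrow> v \<bullet> (M *v v) > 0}"

text \<open>
  \<open>F\<close> is only a function on symmetric matrices, so \<open>\<partial>F/\<partial>M\<^sub>i\<^sub>j\<close> is read in the usual way: it is the
  symmetric matrix with \<open>dF(M)(H) = \<Sum>\<^sub>i\<^sub>j (\<partial>F/\<partial>M\<^sub>i\<^sub>j) H\<^sub>i\<^sub>j\<close> for all symmetric \<open>H\<close>. The inner product of
  \<^typ>\<open>real ^ 'n ^ 'n\<close> is this entrywise sum, and the derivative is taken within \<^const>\<open>sym_mats\<close>.
\<close>

definition mat_gradient :: "(real ^ 'n ^ 'n \<Rightarrow> real) \<Rightarrow> real ^ 'n ^ 'n \<Rightarrow> real ^ 'n ^ 'n" where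
  "mat_gradient F M = (THE G. G \<in> sym_mats \<and> (F has_derivative (\<lambda>H. G \<bullet> H)) (at M within sym_mats))"

text \<open>To be used for relatively open subsets \<open>U\<close> of \<^const>\<open>sym_mats\<close>.\<close>

definition C1_on_sym :: "(real ^ 'n ^ 'n) set \<Rightarrow> (real ^ 'n ^ 'n \<Rightarrow> real) \<Rightarrow> bool" where
  "C1_on_sym U F \<longleftrightarrow>
     (\<forall>M\<in>U. F differentiable (at M within sym_mats)) \<and> continuous_on U (mat_gradient F)"

lemma transpose_inner: "transpose A \<bullet> B = A \<bullet> transpose (B :: real ^ 'n ^ 'n)"
  unfolding inner_vec_def transpose_def by simp (rule sum.swap)

lemma subspace_sym_mats: "subspace sym_mats"
  unfolding subspace_def sym_mats_def transpose_def by (simp add: vec_eq_iff)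

lemma mat_gradient_unique:
  fixes G :: "real ^ 'n ^ 'n"
  assumes M: "M \<in> sym_mats"
    and G: "G \<in> sym_mats" "(F has_derivative (\<lambda>H. G \<bullet> H)) (at M within sym_mats)"
    and G': "G' \<in> sym_mats" "(F has_derivative (\<lambda>H. G' \<bullet> H)) (at M within sym_mats)"
  shows "G = G'"
proof -
  define D where "D = G - G'"
  have D: "D \<in> sym_mats"
    unfolding D_def by (rule subspace_diff[OF subspace_sym_mats G(1) G'(1)])
  define p where "p = (\<lambda>t::real. M + t *\<^sub>R D)"
  have p_sym: "p t \<in> sym_mats" for t
    unfolding p_def
    by (rule subspace_add[OF subspace_sym_mats M subspace_scale[OF subspace_sym_mats D]])
  have p_der: "(p has_derivative (\<lambda>t. t *\<^sub>R D)) (at 0)"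
    unfolding p_def
    by (rule has_derivative_eq_rhs[OF has_derivative_add[OF has_derivative_const
          has_derivative_scaleR_left[OF has_derivative_ident]]]) simp
  have along: "((F \<circ> p) has_derivative (\<lambda>t. K \<bullet> (t *\<^sub>R D))) (at 0)"
    if "(F has_derivative (\<lambda>H. K \<bullet> H)) (at M within sym_mats)" for K
  proof -
    have "(F has_derivative (\<lambda>H. K \<bullet> H)) (at (p 0) within range p)"
      by (rule has_derivative_subset[of F _ "p 0" sym_mats]) (use that p_sym in \<open>auto simp: p_def\<close>)
    from diff_chain_within[OF p_der this] show ?thesis unfolding o_def .
  qed
  have "(\<lambda>t. G \<bullet> (t *\<^sub>R D)) = (\<lambda>t. G' \<bullet> (t *\<^sub>R D))"
    using has_derivative_unique[OF along[OF G(2)] along[OF G'(2)]] .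
  from fun_cong[OF this, of 1] have "D \<bullet> D = 0"
    by (simp add: D_def inner_diff_left)
  then show ?thesis by (simp add: D_def)
qed

lemma mat_gradient_exists:
  fixes F :: "real ^ 'n ^ 'n \<Rightarrow> real"
  assumes M: "M \<in> sym_mats" and F: "F differentiable (at M within sym_mats)"
  shows "mat_gradient F M \<in> sym_mats"
    and "(F has_derivative (\<lambda>H. mat_gradient F M \<bullet> H)) (at M within sym_mats)"
proof -
  obtain L where L: "(F has_derivative L) (at M within sym_mats)"
    using F by (auto simp: differentiable_def)
  then have lin: "linear L" by (rule has_derivative_linear)
  define B where "B = adjoint L 1"
  have B: "L H = B \<bullet> H" for H
    using adjoint_works[OF lin, of H 1] by (simp add: B_def inner_commute)
  define G where "G = (1/2) *\<^sub>R (B + transpose B)"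
  have Gs: "G \<in> sym_mats"
    by (simp add: G_def sym_mats_def transpose_def vec_eq_iff add.commute)
  have LG: "L H = G \<bullet> H" if "H \<in> sym_mats" for H
    using that by (simp add: B G_def sym_mats_def inner_add_left transpose_inner)
  have "(F has_derivative (\<lambda>H. G \<bullet> H)) (at M within sym_mats)"
  proof -
    have *: "L (y - M) = G \<bullet> (y - M)" if "y \<in> sym_mats" for y
      by (rule LG[OF subspace_diff[OF subspace_sym_mats that M]])
    show ?thesis
      using L * unfolding has_derivative_within_alt2
      by (auto simp: bounded_linear_inner_right eventually_at_filter elim!: eventually_mono)
  qed
  with Gs have "mat_gradient F M \<in> sym_mats \<and>
      (F has_derivative (\<lambda>H. mat_gradient F M \<bullet> H)) (at M within sym_mats)"
    unfolding mat_gradient_def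
    by (intro theI[of "\<lambda>G. G \<in> sym_mats \<and> (F has_derivative (\<lambda>H. G \<bullet> H)) (at M within sym_mats)"])
       (auto intro: mat_gradient_unique[OF M])
  then show "mat_gradient F M \<in> sym_mats"
    and "(F has_derivative (\<lambda>H. mat_gradient F M \<bullet> H)) (at M within sym_mats)" by auto
qed

definition grad :: "(real ^ 'n \<Rightarrow> real) \<Rightarrow> real ^ 'n \<Rightarrow> real ^ 'n" where
  "grad u x = (\<chi> i. frechet_derivative u (at x) (axis i 1))"

definition hessian :: "(real ^ 'n \<Rightarrow> real) \<Rightarrow> real ^ 'n \<Rightarrow> real ^ 'n ^ 'n" where
  "hessian u x = jacobian (grad u) (at x)"

definition laplacian :: "(real ^ 'n \<Rightarrow> real) \<Rightarrow> real ^ 'n \<Rightarrow> real" where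
  "laplacian u x = trace (hessian u x)"

text \<open>To be used for open sets \<open>S\<close>.\<close>

definition C2_on :: "(real ^ 'n) set \<Rightarrow> (real ^ 'n \<Rightarrow> real) \<Rightarrow> bool" where
  "C2_on S u \<longleftrightarrow>
     (\<forall>x\<in>S. u differentiable (at x)) \<and>
     (\<forall>x\<in>S. grad u differentiable (at x)) \<and>
     continuous_on S (hessian u)"

definition outer :: "real ^ 'n \<Rightarrow> real ^ 'n \<Rightarrow> real ^ 'n ^ 'n" where
  "outer v w = (\<chi> i j. v $ i * w $ j)"

definition conf_mat :: "(real ^ 'n \<Rightarrow> real) \<Rightarrow> real ^ 'n \<Rightarrow> real ^ 'n ^ 'n" where
  "conf_mat u x = (let n = real CARD('n) in
     - (2 / (n - 2) * u x powr (- ((n + 2) / (n - 2)))) *\<^sub>R hessian u x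
     + (2 * n / (n - 2)\<^sup>2 * u x powr (- (2 * n / (n - 2)))) *\<^sub>R outer (grad u x) (grad u x)
     - (2 / (n - 2)\<^sup>2 * u x powr (- (2 * n / (n - 2))) * (norm (grad u x))\<^sup>2) *\<^sub>R mat 1)"

end

theory Submission
  imports Defs
begin

text \<open>
  Put \<open>f = u powr (- 2 / (n - 2))\<close>. Then \<open>A\<^sup>u\<close> becomes \<open>f \<nabla>\<^sup>2f - |\<nabla>f|\<^sup>2/2 I\<close>, an expression without
  fractional powers, and the conformal invariance of the equation says that the solutions are mapped
  to solutions by \<open>f(y) \<mapsto> f(z + c y)/c\<close> and by the Kelvin transform \<open>f(y) \<mapsto> |y|\<^sup>2 f(y/|y|\<^sup>2)\<close>. Under
  the latter the matrix is conjugated by the reflection along \<open>y\<close>. Since \<open>u\<close> is a negative power of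
  \<open>f\<close>, the roles of super- and subsolutions are exchanged: the inequality to prove is \<open>f \<le> f\<^sub>x\<^sub>,\<^sub>l\<close>
  outside the sphere of radius \<open>l\<close> about \<open>x\<close>, for every \<open>x \<noteq> 0\<close> and every \<open>l < |x|\<close>, where \<open>f\<^sub>x\<^sub>,\<^sub>l\<close> is
  the Kelvin transform of \<open>f\<close> in that sphere. Letting \<open>x\<close> tend to infinity together with \<open>l\<close>, the
  spheres become hyperplanes, and \<open>f\<close> turns out to be symmetric with respect to all hyperplanes
  through the origin.

  Consider the \<open>l\<close> up to which this inequality holds. There are some because
  \<open>t \<mapsto> f(x + t e)/t\<close> decreases for small \<open>t\<close> and because positivity of the superharmonic \<open>u\<close> bounds the
  growth of \<open>f\<close>; the supremum is attained by continuity; and if it is some \<open>l < |x|\<close>, the inequality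
  can only fail beyond \<open>l\<close> because of a contact, for which there are four places.

  At a finite point other than the origin, contact is excluded by the strong maximum principle: it
  would give \<open>f = f\<^sub>x\<^sub>,\<^sub>l\<close> everywhere outside the sphere, and \<open>f\<^sub>x\<^sub>,\<^sub>l\<close>, being regular at the origin, would
  extend \<open>f\<close>. On the sphere it is excluded by Hopf's lemma. Both rest on the remark that when two
  solutions touch with equal gradients, their matrices are ordered, whence, by ellipticity and the
  convexity of \<open>U\<close> in positive directions, they coincide. Near such a point the
  difference of the two solutions therefore satisfies a linear uniformly elliptic equation.

  At the origin, and likewise at infinity, the solution \<open>f\<close> is compared with a regular solution \<open>g\<close>,
  \<open>f < g\<close> off the puncture, and it has to be shown that \<open>f \<le> g(0) - \<delta>\<close> nearby
  (lemma \<open>no_touching_at_puncture\<close>). There is a second regular solution \<open>G\<close> with \<open>G(0) = g(0)\<close>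
  but a different gradient at the puncture, namely the image of \<open>g\<close> under a special conformal
  transformation close to the identity. Sliding the dilates \<open>G(t y)/t\<close> from \<open>t = 1/2\<close> to \<open>t = 1\<close>
  one sees that \<open>f \<le> G\<close> as well: a first contact at a regular point contradicts the strong maximum
  principle, and at the puncture there is none because \<open>G(0)/t > g(0)\<close> for \<open>t < 1\<close>. Now \<open>f\<close>
  is a subharmonic function below two functions with a common value and different gradients at the
  puncture, so its upper limit there is strictly below this value.
\<close>

section \<open>Functions with a gradient and a Hessian\<close>

text \<open>
  The gradient and the Hessian are carried along as explicit functions, so that sums, powers and
  Kelvin transforms can be differentiated by rules instead of by unfolding \<^const>\<open>grad\<close> and
  \<^const>\<open>hessian\<close>.
\<close>

definition has_jet :: "(real ^ 'n \<Rightarrow> real) \<Rightarrow> (real ^ 'n \<Rightarrow> real ^ 'n) \<Rightarrow> (real ^ 'n \<Rightarrow> real ^ 'n ^ 'n)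
    \<Rightarrow> (real ^ 'n) set \<Rightarrow> bool" where
  "has_jet f p H S \<longleftrightarrow>
     (\<forall>x\<in>S. (f has_derivative (\<lambda>h. p x \<bullet> h)) (at x) \<and> (p has_derivative (\<lambda>h. H x *v h)) (at x)) \<and>
     continuous_on S H"

lemma has_jet_subset: "has_jet f p H S \<Longrightarrow> T \<subseteq> S \<Longrightarrow> has_jet f p H T"
  unfolding has_jet_def by (blast intro: continuous_on_subset)

lemma outer_mult_vec: "outer v w *v h = (w \<bullet> h) *\<^sub>R v"
  by (simp add: vec_eq_iff outer_def matrix_vector_mult_def inner_vec_def sum_distrib_left
      sum_distrib_right mult_ac)

lemma has_jet_grad_hessian:
  fixes f :: "real ^ 'n \<Rightarrow> real"
  assumes "C2_on S f"
  shows "has_jet f (grad f) (hessian f) S"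
proof -
  have "(f has_derivative (\<lambda>h. grad f x \<bullet> h)) (at x)" if "f differentiable (at x)" for x
  proof -
    let ?D = "frechet_derivative f (at x)"
    have D: "(f has_derivative ?D) (at x)" using that by (simp add: frechet_derivative_works)
    then have lin: "linear ?D" by (rule has_derivative_linear)
    have "?D h = grad f x \<bullet> h" for h
    proof -
      have "?D h = ?D (\<Sum>i\<in>UNIV. h $ i *\<^sub>R axis i 1)"
        using basis_expansion[of h] by (simp add: scalar_mult_eq_scaleR)
      also have "\<dots> = (\<Sum>i\<in>UNIV. h $ i * ?D (axis i 1))"
        by (simp add: linear_sum[OF lin] linear_cmul[OF lin])
      also have "\<dots> = grad f x \<bullet> h" by (simp add: grad_def inner_vec_def mult.commute)
      finally show ?thesis .
    qed
    then show ?thesis using D by (metis ext)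
  qed
  moreover have "(grad f has_derivative (\<lambda>h. hessian f x *v h)) (at x)"
    if "grad f differentiable (at x)" for x
    using that unfolding hessian_def by (simp add: jacobian_works)
  ultimately show ?thesis using assms unfolding C2_on_def has_jet_def by blast
qed

lemma has_jet_unique:
  fixes f :: "real ^ 'n \<Rightarrow> real"
  assumes S: "open S" and jet: "has_jet f p H S"
  shows has_jet_grad: "\<And>x. x \<in> S \<Longrightarrow> grad f x = p x"
    and has_jet_hessian: "\<And>x. x \<in> S \<Longrightarrow> hessian f x = H x"
    and has_jet_C2_on: "C2_on S f"
proof -
  show g: "grad f x = p x" if "x \<in> S" for x
  proof -
    have "(f has_derivative (\<lambda>h. p x \<bullet> h)) (at x)" using jet that by (simp add: has_jet_def)
    from frechet_derivative_at[OF this] have "frechet_derivative f (at x) = (\<lambda>h. p x \<bullet> h)" by simp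
    then show ?thesis by (simp add: grad_def vec_eq_iff inner_axis)
  qed
  have D: "(grad f has_derivative (\<lambda>h. H x *v h)) (at x)" if "x \<in> S" for x
  proof -
    have "(p has_derivative (\<lambda>h. H x *v h)) (at x)" using jet that by (simp add: has_jet_def)
    then show ?thesis
      by (rule has_derivative_transform_within_open[OF _ S that]) (simp add: g)
  qed
  show h: "hessian f x = H x" if "x \<in> S" for x
    using frechet_derivative_at[OF D[OF that]]
    by (simp add: hessian_def jacobian_def flip: \<open>_ = frechet_derivative _ _\<close>)
  have "continuous_on S (hessian f)"
    using jet h unfolding has_jet_def by (metis (no_types, lifting) continuous_on_eq)
  then show "C2_on S f"
    using jet D unfolding C2_on_def has_jet_def differentiable_def by blast
qed

lemma has_jet_lincomb:
  fixes f g :: "real ^ 'n \<Rightarrow> real"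
  assumes "has_jet f p H S" and "has_jet g q K S"
  shows "has_jet (\<lambda>x. a * f x + b * g x) (\<lambda>x. a *\<^sub>R p x + b *\<^sub>R q x) (\<lambda>x. a *\<^sub>R H x + b *\<^sub>R K x) S"
proof -
  have "((\<lambda>x. a * f x + b * g x) has_derivative (\<lambda>h. (a *\<^sub>R p x + b *\<^sub>R q x) \<bullet> h)) (at x)"
    if "(f has_derivative (\<lambda>h. p x \<bullet> h)) (at x)" "(g has_derivative (\<lambda>h. q x \<bullet> h)) (at x)" for x
    using that by (auto intro!: derivative_eq_intros simp: inner_add_left)
  moreover have "((\<lambda>x. a *\<^sub>R p x + b *\<^sub>R q x) has_derivative (\<lambda>h. (a *\<^sub>R H x + b *\<^sub>R K x) *v h)) (at x)"
    if "(p has_derivative (\<lambda>h. H x *v h)) (at x)" "(q has_derivative (\<lambda>h. K x *v h)) (at x)" for x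
    using that by (auto intro!: derivative_eq_intros
        simp: matrix_vector_mult_add_rdistrib scaleR_matrix_vector_assoc)
  moreover have "continuous_on S (\<lambda>x. a *\<^sub>R H x + b *\<^sub>R K x)"
    using assms unfolding has_jet_def by (intro continuous_intros) auto
  ultimately show ?thesis using assms unfolding has_jet_def by blast
qed

lemma continuous_on_outer [continuous_intros]:
  fixes p q :: "'a::topological_space \<Rightarrow> real ^ 'n"
  shows "continuous_on S p \<Longrightarrow> continuous_on S q \<Longrightarrow> continuous_on S (\<lambda>x. outer (p x) (q x))"
  unfolding outer_def by (intro continuous_intros)

lemma has_jet_continuous_on:
  fixes f :: "real ^ 'n \<Rightarrow> real"
  assumes "has_jet f p H S"
  shows "continuous_on S f" "continuous_on S p" "continuous_on S H"
  using assms unfolding has_jet_def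
  by (auto intro!: continuous_at_imp_continuous_on has_derivative_continuous)

text \<open>
  All nonlinear functions of the development (powers of solutions, the barriers of Hopf's lemma and of the
  punctured ball, squares of linear forms) are obtained from this chain rule.
\<close>

lemma has_jet_compose:
  fixes f :: "real ^ 'n \<Rightarrow> real"
  assumes jet: "has_jet f p H S"
    and \<phi>: "\<And>x. x \<in> S \<Longrightarrow> (\<phi> has_real_derivative \<phi>' (f x)) (at (f x))"
    and \<phi>': "\<And>x. x \<in> S \<Longrightarrow> (\<phi>' has_real_derivative \<phi>'' (f x)) (at (f x))"
    and cont: "continuous_on (f ` S) \<phi>''"
  shows "has_jet (\<lambda>x. \<phi> (f x)) (\<lambda>x. \<phi>' (f x) *\<^sub>R p x)
           (\<lambda>x. \<phi>' (f x) *\<^sub>R H x + \<phi>'' (f x) *\<^sub>R outer (p x) (p x)) S"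
proof -
  have "((\<lambda>x. \<phi> (f x)) has_derivative (\<lambda>h. (\<phi>' (f x) *\<^sub>R p x) \<bullet> h)) (at x) \<and>
     ((\<lambda>x. \<phi>' (f x) *\<^sub>R p x) has_derivative
        (\<lambda>h. (\<phi>' (f x) *\<^sub>R H x + \<phi>'' (f x) *\<^sub>R outer (p x) (p x)) *v h)) (at x)" if x: "x \<in> S" for x
  proof
    have f: "(f has_derivative (\<lambda>h. p x \<bullet> h)) (at x)" and p: "(p has_derivative (\<lambda>h. H x *v h)) (at x)"
      using jet x by (auto simp: has_jet_def)
    have chain: "((\<lambda>x. \<psi> (f x)) has_derivative (\<lambda>h. c * (p x \<bullet> h))) (at x)"
      if "(\<psi> has_real_derivative c) (at (f x))" for \<psi> c
      using has_derivative_compose[OF f that[unfolded has_field_derivative_def]] by simp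
    show "((\<lambda>x. \<phi> (f x)) has_derivative (\<lambda>h. (\<phi>' (f x) *\<^sub>R p x) \<bullet> h)) (at x)"
      using chain[OF \<phi>[OF x]] by simp
    show "((\<lambda>x. \<phi>' (f x) *\<^sub>R p x) has_derivative
        (\<lambda>h. (\<phi>' (f x) *\<^sub>R H x + \<phi>'' (f x) *\<^sub>R outer (p x) (p x)) *v h)) (at x)"
      by (rule has_derivative_eq_rhs[OF has_derivative_scaleR[OF chain[OF \<phi>'[OF x]] p]])
         (simp add: matrix_vector_mult_add_rdistrib outer_mult_vec flip: scaleR_matrix_vector_assoc)
  qed
  moreover have "continuous_on S (\<lambda>x. \<phi>' (f x) *\<^sub>R H x + \<phi>'' (f x) *\<^sub>R outer (p x) (p x))"
  proof -
    have "continuous_on S (\<lambda>x. \<phi>' (f x))"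
    proof (rule continuous_at_imp_continuous_on, rule ballI)
      fix x assume "x \<in> S"
      then show "isCont (\<lambda>x. \<phi>' (f x)) x"
        using jet by (intro isCont_o2[of x f \<phi>'] DERIV_isCont[OF \<phi>'])
          (auto simp: has_jet_def intro: has_derivative_continuous)
    qed
    moreover have "continuous_on S (\<lambda>x. \<phi>'' (f x))"
      by (rule continuous_on_compose2[OF cont has_jet_continuous_on(1)[OF jet]]) simp
    ultimately show ?thesis
      by (intro continuous_intros has_jet_continuous_on[OF jet])
  qed
  ultimately show ?thesis unfolding has_jet_def by blast
qed

lemma has_jet_powr:
  fixes f :: "real ^ 'n \<Rightarrow> real"
  assumes "has_jet f p H S" and "\<And>x. x \<in> S \<Longrightarrow> f x > 0"
  shows "has_jet (\<lambda>x. f x powr k) (\<lambda>x. (k * f x powr (k - 1)) *\<^sub>R p x)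
     (\<lambda>x. (k * f x powr (k - 1)) *\<^sub>R H x + (k * ((k - 1) * f x powr (k - 2))) *\<^sub>R outer (p x) (p x)) S"
proof (rule has_jet_compose[OF assms(1), of "\<lambda>t. t powr k" "\<lambda>t. k * t powr (k - 1)"
      "\<lambda>t. k * ((k - 1) * t powr (k - 2))"])
  fix x assume "x \<in> S"
  with assms(2) have "f x > 0" .
  then show "((\<lambda>t. t powr k) has_real_derivative k * f x powr (k - 1)) (at (f x))"
    and "((\<lambda>t. k * t powr (k - 1)) has_real_derivative k * ((k - 1) * f x powr (k - 2))) (at (f x))"
    by (auto intro!: derivative_eq_intros)
next
  show "continuous_on (f ` S) (\<lambda>t. k * ((k - 1) * t powr (k - 2)))"
    using assms(2) by (force intro!: continuous_intros)
qed

lemma has_jet_affine: "has_jet (\<lambda>x. c + m \<bullet> x) (\<lambda>x. m) (\<lambda>x. 0) S"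
  unfolding has_jet_def by (auto intro!: derivative_eq_intros continuous_intros)

lemma has_jet_dist_sq:
  "has_jet (\<lambda>x :: real ^ 'n. (x - z) \<bullet> (x - z)) (\<lambda>x. 2 *\<^sub>R (x - z)) (\<lambda>x. 2 *\<^sub>R mat 1) S"
  unfolding has_jet_def
  by (auto intro!: derivative_eq_intros continuous_intros
      simp: inner_commute algebra_simps simp flip: scaleR_matrix_vector_assoc)

lemma has_jet_square:
  "has_jet (\<lambda>x :: real ^ 'n. (d \<bullet> x)\<^sup>2) (\<lambda>x. (2 * (d \<bullet> x)) *\<^sub>R d) (\<lambda>x. 2 *\<^sub>R outer d d) S"
proof -
  have 1: "((\<lambda>t. t\<^sup>2) has_real_derivative 2 * t) (at t)" for t :: real
    by (auto intro!: derivative_eq_intros)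
  have 2: "((\<lambda>t. 2 * t) has_real_derivative 2) (at t)" for t :: real
    by (auto intro!: derivative_eq_intros)
  show ?thesis
    using has_jet_compose[OF has_jet_affine[of 0 d S] 1 2 continuous_on_const] by simp
qed

text \<open>
  Contact from one side is only known along rays that enter a ball, so the first and second derivative tests
  are stated for a single ray; the tests at an interior minimum follow.
\<close>

lemma has_jet_ray:
  fixes f :: "real ^ 'n \<Rightarrow> real"
  assumes "has_jet f p H S" and "x + t *\<^sub>R e \<in> S"
  shows "((\<lambda>t. f (x + t *\<^sub>R e)) has_real_derivative p (x + t *\<^sub>R e) \<bullet> e) (at t)"
    and "((\<lambda>t. p (x + t *\<^sub>R e) \<bullet> e) has_real_derivative e \<bullet> (H (x + t *\<^sub>R e) *v e)) (at t)"
proof -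
  have r: "((\<lambda>t. x + t *\<^sub>R e) has_derivative (\<lambda>s. s *\<^sub>R e)) (at t)"
    by (auto intro!: derivative_eq_intros)
  have f: "(f has_derivative (\<lambda>h. p (x + t *\<^sub>R e) \<bullet> h)) (at (x + t *\<^sub>R e))"
    and p: "(p has_derivative (\<lambda>h. H (x + t *\<^sub>R e) *v h)) (at (x + t *\<^sub>R e))"
    using assms by (auto simp: has_jet_def)
  show "((\<lambda>t. f (x + t *\<^sub>R e)) has_real_derivative p (x + t *\<^sub>R e) \<bullet> e) (at t)"
    using has_derivative_compose[OF r f] unfolding has_field_derivative_def
    by (simp add: mult.commute[of _ "p _ \<bullet> e"])
  show "((\<lambda>t. p (x + t *\<^sub>R e) \<bullet> e) has_real_derivative e \<bullet> (H (x + t *\<^sub>R e) *v e)) (at t)"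
    using has_derivative_inner_left[OF has_derivative_compose[OF r p], of e]
    unfolding has_field_derivative_def
    by (simp add: mult.commute[of _ "e \<bullet> _"] inner_commute matrix_vector_mult_scaleR)
qed

lemma ray_first_order:
  fixes f :: "real ^ 'n \<Rightarrow> real"
  assumes jet: "has_jet f p H S" and x: "x \<in> S"
    and t0: "t0 > 0" and min: "\<And>t. 0 < t \<Longrightarrow> t < t0 \<Longrightarrow> f x \<le> f (x + t *\<^sub>R e)"
  shows "p x \<bullet> e \<ge> 0"
proof (rule ccontr)
  assume "\<not> ?thesis"
  then have "p x \<bullet> e < 0" by simp
  with has_jet_ray(1)[OF jet, of x 0 e] x
  obtain d where d: "d > 0" "\<And>h. 0 < h \<Longrightarrow> h < d \<Longrightarrow> f (x + h *\<^sub>R e) < f x"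
    using has_real_derivative_neg_dec_right[of "\<lambda>t. f (x + t *\<^sub>R e)" "p x \<bullet> e" 0 UNIV] by auto
  define t where "t = min d t0 / 2"
  have "0 < t" "t < d" "t < t0" using d(1) t0 by (auto simp: t_def)
  then show False using d(2)[of t] min[of t] by simp
qed

lemma ray_second_order:
  fixes f :: "real ^ 'n \<Rightarrow> real"
  assumes S: "open S" and jet: "has_jet f p H S" and x: "x \<in> S" and e: "p x \<bullet> e = 0"
    and t0: "t0 > 0" and min: "\<And>t. 0 < t \<Longrightarrow> t < t0 \<Longrightarrow> f x \<le> f (x + t *\<^sub>R e)"
  shows "e \<bullet> (H x *v e) \<ge> 0"
proof (rule ccontr)
  assume "\<not> ?thesis"
  then have "e \<bullet> (H x *v e) < 0" by simp
  with has_jet_ray(2)[OF jet, of x 0 e] x e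
  obtain d where d: "d > 0" "\<And>h. 0 < h \<Longrightarrow> h < d \<Longrightarrow> p (x + h *\<^sub>R e) \<bullet> e < 0"
    using has_real_derivative_neg_dec_right[of "\<lambda>t. p (x + t *\<^sub>R e) \<bullet> e" "e \<bullet> (H x *v e)" 0 UNIV]
    by auto
  have "continuous (at 0) (\<lambda>t::real. x + t *\<^sub>R e)" by (intro continuous_intros)
  then have "\<forall>\<^sub>F t in at (0::real). x + t *\<^sub>R e \<in> S"
    using topological_tendstoD[OF _ S, of "\<lambda>t. x + t *\<^sub>R e" x "at 0"] x by (simp add: isCont_def)
  then obtain d' where d': "d' > 0" "\<And>t::real. t \<noteq> 0 \<Longrightarrow> dist t 0 < d' \<Longrightarrow> x + t *\<^sub>R e \<in> S"
    unfolding eventually_at by auto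
  define t where "t = min (min d d') t0 / 2"
  have t: "0 < t" "t < d" "t < d'" "t < t0" using d d' t0 by (auto simp: t_def)
  have "f (x + t *\<^sub>R e) < f (x + 0 *\<^sub>R e)"
  proof (rule DERIV_neg_imp_decreasing_open[OF t(1)])
    fix s assume s: "0 < s" "s < t"
    have "x + s *\<^sub>R e \<in> S" using s t d'(2)[of s] by simp
    from has_jet_ray(1)[OF jet this] d(2)[of s] s t
    show "\<exists>y. ((\<lambda>t. f (x + t *\<^sub>R e)) has_real_derivative y) (at s) \<and> y < 0" by auto
  next
    have "x + s *\<^sub>R e \<in> S" if "s \<in> {0..t}" for s
      using that x t d'(2)[of s] by (cases "s = 0") auto
    then show "continuous_on {0..t} (\<lambda>t. f (x + t *\<^sub>R e))"
      by (intro continuous_on_compose2[OF has_jet_continuous_on(1)[OF jet]] continuous_intros) auto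
  qed
  with min[of t] t show False by simp
qed

lemma local_min_jet:
  fixes f :: "real ^ 'n \<Rightarrow> real"
  assumes S: "open S" and jet: "has_jet f p H S" and x: "x \<in> S" and min: "\<And>y. y \<in> S \<Longrightarrow> f x \<le> f y"
  shows "p x = 0" and "e \<bullet> (H x *v e) \<ge> 0"
proof -
  have "\<exists>t0>0. \<forall>t. 0 < t \<longrightarrow> t < t0 \<longrightarrow> f x \<le> f (x + t *\<^sub>R e)" for e
  proof -
    have "continuous (at 0) (\<lambda>t::real. x + t *\<^sub>R e)" by (intro continuous_intros)
    then have "\<forall>\<^sub>F t in at (0::real). x + t *\<^sub>R e \<in> S"
      using topological_tendstoD[OF _ S, of "\<lambda>t. x + t *\<^sub>R e" x "at 0"] x by (simp add: isCont_def)
    then obtain d' where "d' > 0" "\<And>t::real. t \<noteq> 0 \<Longrightarrow> dist t 0 < d' \<Longrightarrow> x + t *\<^sub>R e \<in> S"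
      unfolding eventually_at by auto
    then show ?thesis using min by (intro exI[of _ d']) auto
  qed
  note ray = this
  have "p x \<bullet> e \<ge> 0" for e using ray[of e] ray_first_order[OF jet x] by blast
  from this[of "- p x"] have "p x \<bullet> p x \<le> 0" by simp
  then show p: "p x = 0" using inner_gt_zero_iff[of "p x"] by (auto simp: not_less[symmetric])
  show "e \<bullet> (H x *v e) \<ge> 0" using ray[of e] ray_second_order[OF S jet x] p by auto
qed

section \<open>The conformal Hessian and its invariance\<close>

text \<open>The Schouten tensor of the metric \<open>f\<^sup>-\<^sup>2 |dx|\<^sup>2\<close>, as a field of endomorphisms.\<close>

definition schouten :: "(real ^ 'n \<Rightarrow> real) \<Rightarrow> real ^ 'n \<Rightarrow> real ^ 'n ^ 'n" where
  "schouten f x = f x *\<^sub>R hessian f x - ((grad f x \<bullet> grad f x) / 2) *\<^sub>R mat 1"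

lemma schouten_jet:
  assumes "open S" "has_jet f p H S" "x \<in> S"
  shows "schouten f x = f x *\<^sub>R H x - ((p x \<bullet> p x) / 2) *\<^sub>R mat 1"
  using has_jet_grad[OF assms(1,2,3)] has_jet_hessian[OF assms(1,2,3)] by (simp add: schouten_def)

lemma conf_mat_eq_schouten:
  fixes v :: "real ^ 'n \<Rightarrow> real"
  assumes n: "CARD('n) \<ge> 3" and S: "open S" and v: "C2_on S v" and pos: "\<And>x. x \<in> S \<Longrightarrow> v x > 0"
    and x: "x \<in> S"
  shows "conf_mat v x = schouten (\<lambda>x. v x powr (- (2 / (real CARD('n) - 2)))) x"
proof -
  let ?n = "real CARD('n)"
  define m where "m = ?n - 2"
  define k where "k = - (2 / m)"
  have m: "m > 0" and nm: "?n = m + 2" using n by (simp_all add: m_def)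
  let ?g = "grad v x" and ?H = "hessian v x"
  have e1: "v x powr k * v x powr (k - 1) = v x powr (- ((?n + 2) / (?n - 2)))"
  proof -
    have "k + (k - 1) = - ((?n + 2) / (?n - 2))" using m by (simp add: k_def nm field_simps)
    then show ?thesis by (simp flip: powr_add)
  qed
  have exp2: "k + (k - 2) = - (2 * ?n / (?n - 2))" using m by (simp add: k_def nm field_simps)
  have e2: "v x powr k * v x powr (k - 2) = v x powr (- (2 * ?n / (?n - 2)))"
    using exp2 by (simp flip: powr_add)
  have e3: "(v x powr (k - 1))\<^sup>2 = v x powr (- (2 * ?n / (?n - 2)))"
  proof -
    have "(k - 1) + (k - 1) = - (2 * ?n / (?n - 2))" using exp2 by simp
    then show ?thesis by (simp only: power2_eq_square flip: powr_add)
  qed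
  have k1: "k * (k - 1) = 2 * ?n / (?n - 2)\<^sup>2"
    using m by (simp add: k_def nm field_simps power2_eq_square)
  have k2: "k\<^sup>2 / 2 = 2 / (?n - 2)\<^sup>2"
    using m by (simp add: k_def nm field_simps power2_eq_square)
  have "schouten (\<lambda>x. v x powr k) x =
     v x powr k *\<^sub>R ((k * v x powr (k - 1)) *\<^sub>R ?H + (k * ((k - 1) * v x powr (k - 2))) *\<^sub>R outer ?g ?g)
     - (((k * v x powr (k - 1)) *\<^sub>R ?g \<bullet> (k * v x powr (k - 1)) *\<^sub>R ?g) / 2) *\<^sub>R mat 1"
    by (rule schouten_jet[OF S has_jet_powr[OF has_jet_grad_hessian[OF v] pos] x])
  also have "\<dots> = (k * (v x powr k * v x powr (k - 1))) *\<^sub>R ?H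
     + (k * (k - 1) * (v x powr k * v x powr (k - 2))) *\<^sub>R outer ?g ?g
     - ((k\<^sup>2 / 2) * (v x powr (k - 1))\<^sup>2 * (?g \<bullet> ?g)) *\<^sub>R mat 1"
    by (simp add: scaleR_add_right mult_ac power2_eq_square)
  also have "\<dots> = conf_mat v x"
    unfolding e1 e2 e3 k1 k2 conf_mat_def Let_def
    by (simp add: k_def m_def power2_norm_eq_inner)
  finally show ?thesis by (simp add: k_def m_def)
qed

lemma has_jet_similarity:
  fixes f :: "real ^ 'n \<Rightarrow> real"
  assumes jet: "has_jet f p H S" and c: "c \<noteq> 0"
  shows "has_jet (\<lambda>y. f (z + c *\<^sub>R y) / c) (\<lambda>y. p (z + c *\<^sub>R y)) (\<lambda>y. c *\<^sub>R H (z + c *\<^sub>R y))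
           {y. z + c *\<^sub>R y \<in> S}"
proof -
  have "((\<lambda>y. f (z + c *\<^sub>R y) / c) has_derivative (\<lambda>h. p (z + c *\<^sub>R y) \<bullet> h)) (at y) \<and>
     ((\<lambda>y. p (z + c *\<^sub>R y)) has_derivative (\<lambda>h. (c *\<^sub>R H (z + c *\<^sub>R y)) *v h)) (at y)"
    if y: "z + c *\<^sub>R y \<in> S" for y
  proof
    have a: "((\<lambda>y. z + c *\<^sub>R y) has_derivative (\<lambda>h. c *\<^sub>R h)) (at y)"
      by (auto intro!: derivative_eq_intros)
    have f: "(f has_derivative (\<lambda>h. p (z + c *\<^sub>R y) \<bullet> h)) (at (z + c *\<^sub>R y))"
      and p: "(p has_derivative (\<lambda>h. H (z + c *\<^sub>R y) *v h)) (at (z + c *\<^sub>R y))"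
      using jet y by (auto simp: has_jet_def)
    show "((\<lambda>y. f (z + c *\<^sub>R y) / c) has_derivative (\<lambda>h. p (z + c *\<^sub>R y) \<bullet> h)) (at y)"
      using has_derivative_divide'[OF has_derivative_compose[OF a f] has_derivative_const c] c
      by simp
    show "((\<lambda>y. p (z + c *\<^sub>R y)) has_derivative (\<lambda>h. (c *\<^sub>R H (z + c *\<^sub>R y)) *v h)) (at y)"
      using has_derivative_compose[OF a p]
      by (simp add: matrix_vector_mult_scaleR scaleR_matrix_vector_assoc)
  qed
  moreover have "continuous_on {y. z + c *\<^sub>R y \<in> S} (\<lambda>y. c *\<^sub>R H (z + c *\<^sub>R y))"
    by (intro continuous_intros continuous_on_compose2[OF has_jet_continuous_on(3)[OF jet]]) auto
  ultimately show ?thesis unfolding has_jet_def by blast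
qed

lemma open_similarity: "open S \<Longrightarrow> open {y :: 'a::real_normed_vector. z + c *\<^sub>R y \<in> S}"
  using continuous_open_vimage[of S "\<lambda>y. z + c *\<^sub>R y"] by (simp add: vimage_def)

lemma schouten_similarity:
  fixes f :: "real ^ 'n \<Rightarrow> real"
  assumes S: "open S" and f: "C2_on S f" and c: "c \<noteq> 0" and y: "z + c *\<^sub>R y \<in> S"
  shows "schouten (\<lambda>y. f (z + c *\<^sub>R y) / c) y = schouten f (z + c *\<^sub>R y)"
  using schouten_jet[OF open_similarity[OF S] has_jet_similarity[OF has_jet_grad_hessian[OF f] c]] y c
  by (simp add: schouten_def)

definition inversion :: "real ^ 'n \<Rightarrow> real ^ 'n" where
  "inversion y = (1 / (y \<bullet> y)) *\<^sub>R y"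

definition kelvin :: "(real ^ 'n \<Rightarrow> real) \<Rightarrow> real ^ 'n \<Rightarrow> real" where
  "kelvin f y = (y \<bullet> y) * f (inversion y)"

lemma matrix_inv_orthogonal:
  fixes Q :: "real ^ 'n ^ 'n"
  assumes "orthogonal_matrix Q"
  shows "matrix_inv Q = transpose Q"
proof -
  have "Q ** transpose Q = mat 1 \<and> transpose Q ** Q = mat 1"
    using assms by (simp add: orthogonal_matrix_def)
  moreover from this have "Q ** matrix_inv Q = mat 1 \<and> matrix_inv Q ** Q = mat 1"
    unfolding matrix_inv_def by (rule someI)
  ultimately show ?thesis by (metis matrix_mul_assoc matrix_mul_lid matrix_mul_rid)
qed

text \<open>
  The reflection along \<open>y\<close>. It is \<open>|y|\<^sup>2\<close> times the derivative of the inversion, and therefore the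
  orthogonal matrix by which the Kelvin transform acts on the matrix of a function.
\<close>

definition householder :: "real ^ 'n \<Rightarrow> real ^ 'n ^ 'n" where
  "householder y = mat 1 - (2 / (y \<bullet> y)) *\<^sub>R outer y y"

lemma householder_mult_vec: "householder y *v h = h - (2 * (y \<bullet> h) / (y \<bullet> y)) *\<^sub>R y"
  by (simp add: householder_def matrix_vector_mult_diff_rdistrib outer_mult_vec
      flip: scaleR_matrix_vector_assoc)

lemma transpose_householder: "transpose (householder y) = householder y"
  by (simp add: householder_def transpose_def outer_def mat_def vec_eq_iff mult.commute)

lemma householder_involution:
  assumes "y \<noteq> 0" shows "householder y ** householder y = mat 1"
proof (subst matrix_eq, rule allI)
  fix h
  have "y \<bullet> y \<noteq> 0" using assms by simp
  then show "householder y ** householder y *v h = mat 1 *v h"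
    unfolding matrix_vector_mul_assoc[symmetric] householder_mult_vec
    by (simp add: inner_diff_right field_simps)
qed

lemma orthogonal_householder: "y \<noteq> 0 \<Longrightarrow> orthogonal_matrix (householder y)"
  by (simp add: orthogonal_matrix_def transpose_householder householder_involution)

lemma matrix_inv_householder: "y \<noteq> 0 \<Longrightarrow> matrix_inv (householder y) = householder y"
  by (simp add: matrix_inv_orthogonal orthogonal_householder transpose_householder)

lemma continuous_on_matrix_mult [continuous_intros]:
  fixes A B :: "'a::topological_space \<Rightarrow> real ^ 'n ^ 'n"
  assumes "continuous_on S A" "continuous_on S B"
  shows "continuous_on S (\<lambda>x. A x ** B x)"
  unfolding matrix_matrix_mult_def using assms by (intro continuous_intros)

lemma has_derivative_inversion:
  fixes y :: "real ^ 'n"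
  assumes "y \<noteq> 0"
  shows "(inversion has_derivative (\<lambda>h. (1 / (y \<bullet> y)) *\<^sub>R (householder y *v h))) (at y)"
proof -
  have y: "y \<bullet> y \<noteq> 0" using assms by simp
  have q: "((\<lambda>y. 1 / (y \<bullet> y)) has_derivative (\<lambda>h. - (2 * (y \<bullet> h) / (y \<bullet> y)\<^sup>2))) (at y)"
    using y by (auto intro!: derivative_eq_intros simp: inner_commute power2_eq_square field_simps)
  show ?thesis
    unfolding inversion_def[abs_def]
    by (rule has_derivative_eq_rhs[OF has_derivative_scaleR[OF q has_derivative_ident]])
       (simp add: householder_mult_vec fun_eq_iff scaleR_diff_right power2_eq_square)
qed

text \<open>
  In the Hessian the terms that contain \<open>y \<otimes> y\<close> or \<open>y \<otimes> \<nabla>f\<close> cancel; what remains is a multiple of the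
  identity besides the reflected Hessian. This cancellation is the reason for the conformal invariance.
\<close>

lemma has_jet_kelvin:
  fixes f :: "real ^ 'n \<Rightarrow> real"
  assumes jet: "has_jet f p H S"
  shows "has_jet (kelvin f) (\<lambda>y. (2 * f (inversion y)) *\<^sub>R y + householder y *v p (inversion y))
     (\<lambda>y. (1 / (y \<bullet> y)) *\<^sub>R (householder y ** H (inversion y) ** householder y)
        + (2 * f (inversion y) - 2 * (y \<bullet> p (inversion y)) / (y \<bullet> y)) *\<^sub>R mat 1)
     {y. y \<noteq> 0 \<and> inversion y \<in> S}" (is "has_jet _ ?p ?H ?S")
proof -
  have "(kelvin f has_derivative (\<lambda>h. ?p y \<bullet> h)) (at y) \<and> (?p has_derivative (\<lambda>h. ?H y *v h)) (at y)"
    if y0: "y \<noteq> 0" and yS: "inversion y \<in> S" for y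
  proof
    have y: "y \<bullet> y \<noteq> 0" using y0 by simp
    let ?D = "\<lambda>h. (1 / (y \<bullet> y)) *\<^sub>R (householder y *v h)"
    let ?P = "p (inversion y)"
    note i = has_derivative_inversion[OF y0]
    have f: "((\<lambda>y. f (inversion y)) has_derivative (\<lambda>h. ?P \<bullet> ?D h)) (at y)"
      by (rule has_derivative_compose[OF i]) (use jet yS in \<open>auto simp: has_jet_def\<close>)
    have p: "((\<lambda>y. p (inversion y)) has_derivative (\<lambda>h. H (inversion y) *v ?D h)) (at y)"
      by (rule has_derivative_compose[OF i]) (use jet yS in \<open>auto simp: has_jet_def\<close>)
    have q: "((\<lambda>y. y \<bullet> y) has_derivative (\<lambda>h. 2 * (y \<bullet> h))) (at y)"
      by (auto intro!: derivative_eq_intros simp: inner_commute)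
    have PD: "?P \<bullet> ?D h = (?P \<bullet> h) / (y \<bullet> y) - 2 * (y \<bullet> h) * (y \<bullet> ?P) / (y \<bullet> y)\<^sup>2" for h
      using y by (simp add: householder_mult_vec inner_diff_right power2_eq_square field_simps
          inner_commute)
    show "(kelvin f has_derivative (\<lambda>h. ?p y \<bullet> h)) (at y)"
      unfolding kelvin_def[abs_def]
    proof (rule has_derivative_eq_rhs[OF has_derivative_mult[OF q f]], rule ext)
      fix h
      show "y \<bullet> y * (?P \<bullet> ?D h) + 2 * (y \<bullet> h) * f (inversion y) = ?p y \<bullet> h"
        unfolding PD using y
        by (simp add: householder_mult_vec inner_diff_left inner_add_left power2_eq_square field_simps)
    qed
    have yp: "((\<lambda>y. y \<bullet> p (inversion y)) has_derivative
        (\<lambda>h. y \<bullet> (H (inversion y) *v ?D h) + h \<bullet> ?P)) (at y)"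
      by (rule has_derivative_inner[OF has_derivative_ident p])
    have c: "((\<lambda>y. 2 * (y \<bullet> p (inversion y)) / (y \<bullet> y)) has_derivative
        (\<lambda>h. 2 * (y \<bullet> (H (inversion y) *v ?D h) + h \<bullet> ?P) / (y \<bullet> y)
            - 4 * (y \<bullet> ?P) * (y \<bullet> h) / (y \<bullet> y)\<^sup>2)) (at y)"
      by (rule has_derivative_eq_rhs[OF has_derivative_divide'[OF
              has_derivative_mult_right[OF yp, of 2] q y]])
         (use y in \<open>simp add: fun_eq_iff field_simps power2_eq_square\<close>)
    have P: "?p = (\<lambda>y. (2 * f (inversion y)) *\<^sub>R y
        + (p (inversion y) - (2 * (y \<bullet> p (inversion y)) / (y \<bullet> y)) *\<^sub>R y))"
      by (simp add: householder_mult_vec)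
    show "(?p has_derivative (\<lambda>h. ?H y *v h)) (at y)"
      unfolding P
    proof (rule has_derivative_eq_rhs[OF has_derivative_add[OF
          has_derivative_scaleR[OF has_derivative_mult_right[OF f, of 2] has_derivative_ident]
          has_derivative_diff[OF p has_derivative_scaleR[OF c has_derivative_ident]]]], rule ext)
      fix h
      define w where "w = H (inversion y) *v ?D h"
      have "?H y *v h = householder y *v w + (2 * f (inversion y) - 2 * (y \<bullet> ?P) / (y \<bullet> y)) *\<^sub>R h"
        by (simp add: matrix_vector_mult_add_rdistrib w_def matrix_vector_mult_scaleR
            flip: scaleR_matrix_vector_assoc matrix_vector_mul_assoc)
      also have "\<dots> = w - (2 * (y \<bullet> w) / (y \<bullet> y)) *\<^sub>R y
           + (2 * f (inversion y) - 2 * (y \<bullet> ?P) / (y \<bullet> y)) *\<^sub>R h"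
        by (simp add: householder_mult_vec)
      finally have H: "?H y *v h = \<dots>" .
      have coeff: "2 * ((?P \<bullet> h) / (y \<bullet> y) - 2 * (y \<bullet> h) * (y \<bullet> ?P) / (y \<bullet> y)\<^sup>2)
           - (2 * (y \<bullet> w + h \<bullet> ?P) / (y \<bullet> y) - 4 * (y \<bullet> ?P) * (y \<bullet> h) / (y \<bullet> y)\<^sup>2)
           = - (2 * (y \<bullet> w) / (y \<bullet> y))"
        using y by (simp add: field_simps power2_eq_square inner_commute)
      have split: "A *\<^sub>R h + a *\<^sub>R y + (w - (B *\<^sub>R h + b *\<^sub>R y))
          = w + (a - b) *\<^sub>R y + (A - B) *\<^sub>R h" for A a B b :: real
        by (simp add: algebra_simps)
      show "(2 * f (inversion y)) *\<^sub>R h + (2 * (?P \<bullet> ?D h)) *\<^sub>R y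
         + (H (inversion y) *v ?D h
          - ((2 * (y \<bullet> ?P) / (y \<bullet> y)) *\<^sub>R h
             + (2 * (y \<bullet> (H (inversion y) *v ?D h) + h \<bullet> ?P) / (y \<bullet> y)
              - 4 * (y \<bullet> ?P) * (y \<bullet> h) / (y \<bullet> y)\<^sup>2) *\<^sub>R y)) = ?H y *v h"
        unfolding H PD w_def[symmetric] split coeff by simp
    qed
  qed
  moreover have "continuous_on ?S ?H"
  proof -
    have i: "continuous_on ?S inversion"
      unfolding inversion_def[abs_def] by (auto intro!: continuous_intros)
    have R: "continuous_on ?S householder"
      unfolding householder_def[abs_def] by (auto intro!: continuous_intros)
    note c = continuous_on_compose2[OF _ i, of S]
    show ?thesis
      by (intro continuous_intros R c has_jet_continuous_on[OF jet]) auto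
  qed
  ultimately show ?thesis unfolding has_jet_def by blast
qed

lemma open_inversion_vimage:
  assumes "open S" shows "open {y :: real ^ 'n. y \<noteq> 0 \<and> inversion y \<in> S}"
proof -
  have "continuous_on (- {0}) (inversion :: real ^ 'n \<Rightarrow> _)"
    unfolding inversion_def[abs_def] by (auto intro!: continuous_intros)
  then have "open (inversion -` S \<inter> - {0 :: real ^ 'n})"
    using assms by (subst (asm) continuous_on_open_vimage) auto
  also have "inversion -` S \<inter> - {0} = {y :: real ^ 'n. y \<noteq> 0 \<and> inversion y \<in> S}" by auto
  finally show ?thesis .
qed

text \<open>
  The multiple of the identity in the Hessian of the Kelvin transform is exactly compensated by the change
  of the squared gradient.
\<close>

lemma schouten_kelvin:
  fixes f :: "real ^ 'n \<Rightarrow> real"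
  assumes S: "open S" and f: "C2_on S f" and y0: "y \<noteq> 0" and y: "inversion y \<in> S"
  shows "schouten (kelvin f) y =
     matrix_inv (householder y) ** schouten f (inversion y) ** householder y"
proof -
  let ?R = "householder y" and ?x = "inversion y"
  let ?p = "grad f ?x" and ?H = "hessian f ?x"
  have q: "y \<bullet> y \<noteq> 0" using y0 by simp
  have nrm: "((2 * f ?x) *\<^sub>R y + ?R *v ?p) \<bullet> ((2 * f ?x) *\<^sub>R y + ?R *v ?p)
     = 4 * (f ?x)\<^sup>2 * (y \<bullet> y) - 4 * f ?x * (y \<bullet> ?p) + ?p \<bullet> ?p"
    using q unfolding householder_mult_vec
    by (simp add: inner_add_left inner_add_right inner_diff_left inner_diff_right
        inner_commute[of ?p y] power2_eq_square) (simp add: field_simps)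
  have "schouten (kelvin f) y = kelvin f y *\<^sub>R ((1 / (y \<bullet> y)) *\<^sub>R (?R ** ?H ** ?R)
        + (2 * f ?x - 2 * (y \<bullet> ?p) / (y \<bullet> y)) *\<^sub>R mat 1)
       - ((((2 * f ?x) *\<^sub>R y + ?R *v ?p) \<bullet> ((2 * f ?x) *\<^sub>R y + ?R *v ?p)) / 2) *\<^sub>R mat 1"
    by (rule schouten_jet[OF open_inversion_vimage[OF S] has_jet_kelvin[OF has_jet_grad_hessian[OF f]]])
       (use y0 y in simp)
  also have "\<dots> = f ?x *\<^sub>R (?R ** ?H ** ?R)
      + ((y \<bullet> y) * f ?x * (2 * f ?x - 2 * (y \<bullet> ?p) / (y \<bullet> y))
        - (4 * (f ?x)\<^sup>2 * (y \<bullet> y) - 4 * f ?x * (y \<bullet> ?p) + ?p \<bullet> ?p) / 2) *\<^sub>R mat 1"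
  proof -
    have "((y \<bullet> y) * a) *\<^sub>R ((1 / (y \<bullet> y)) *\<^sub>R X + b *\<^sub>R Y) - c *\<^sub>R Y
        = a *\<^sub>R X + ((y \<bullet> y) * a * b - c) *\<^sub>R Y" for a b c and X Y :: "real ^ 'n ^ 'n"
      using q by (simp add: scaleR_add_right scaleR_diff_left)
    then show ?thesis unfolding nrm kelvin_def .
  qed
  also have "(y \<bullet> y) * f ?x * (2 * f ?x - 2 * (y \<bullet> ?p) / (y \<bullet> y))
        - (4 * (f ?x)\<^sup>2 * (y \<bullet> y) - 4 * f ?x * (y \<bullet> ?p) + ?p \<bullet> ?p) / 2 = - ((?p \<bullet> ?p) / 2)"
    using q by (simp add: field_simps power2_eq_square)
  also have "f ?x *\<^sub>R (?R ** ?H ** ?R) + (- ((?p \<bullet> ?p) / 2)) *\<^sub>R mat 1 = ?R ** schouten f ?x ** ?R"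
  proof (subst matrix_eq, rule allI)
    fix h
    have "?R *v (?R *v h) = h"
      using householder_involution[OF y0] by (simp add: matrix_vector_mul_assoc)
    then show "(f ?x *\<^sub>R (?R ** ?H ** ?R) + (- ((?p \<bullet> ?p) / 2)) *\<^sub>R mat 1) *v h
        = (?R ** schouten f ?x ** ?R) *v h"
      by (simp add: schouten_def matrix_vector_mult_add_rdistrib matrix_vector_mult_diff_rdistrib
          matrix_vector_mult_diff_distrib matrix_vector_mult_scaleR
          flip: scaleR_matrix_vector_assoc matrix_vector_mul_assoc)
  qed
  finally show ?thesis by (simp add: matrix_inv_householder[OF y0])
qed

section \<open>Positive semidefinite matrices and the level set of an elliptic operator\<close>

text \<open>
  The inner product of matrices is the entrywise one. Writing a quadratic form as an inner product with a
  rank one matrix makes Cauchy-Schwarz available as a bound for it.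
\<close>

lemma quadratic_form_inner: "v \<bullet> (M *v v) = M \<bullet> outer v v"
  by (simp add: inner_vec_def outer_def matrix_vector_mult_def sum_distrib_left mult_ac)

lemma norm_outer: "norm (outer v w) = norm v * norm w"
proof -
  have "outer v w \<bullet> outer v w = (v \<bullet> v) * (w \<bullet> w)"
    by (simp add: inner_vec_def outer_def sum_distrib_left sum_distrib_right mult_ac) (rule sum.swap)
  then show ?thesis by (simp add: norm_eq_sqrt_inner real_sqrt_mult)
qed

lemma mat_1_inner: "mat 1 \<bullet> N = trace (N :: real ^ 'n ^ 'n)"
proof -
  have "(\<Sum>j\<in>UNIV. (if i = j then 1 else 0) * N $ i $ j) = N $ i $ i" for i
    by (simp add: if_distrib[of "\<lambda>x. x * _"] cong: if_cong)
  then show ?thesis by (simp add: inner_vec_def mat_def trace_def)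
qed

lemma axis_inner_mult_axis: "axis i 1 \<bullet> (N *v axis j 1) = (N :: real ^ 'n ^ 'n) $ i $ j"
  by (simp add: inner_axis' matrix_vector_mult_basis column_def)

lemma sym_mats_inner_commute:
  "N \<in> sym_mats \<Longrightarrow> x \<bullet> (N *v y) = (N *v x) \<bullet> y"
  by (simp add: sym_mats_def) (metis dot_lmul_matrix transpose_matrix_vector)

lemma sym_mats_entry: "N \<in> sym_mats \<Longrightarrow> N $ i $ j = N $ j $ i"
  unfolding sym_mats_def transpose_def by (auto simp: vec_eq_iff)

lemma outer_in_sym_mats: "outer v v \<in> sym_mats"
  by (simp add: sym_mats_def transpose_def outer_def vec_eq_iff mult.commute)

lemma mat_1_in_sym_mats: "mat 1 \<in> sym_mats"
  by (simp add: sym_mats_def)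

lemma psd_diag_zero_row:
  fixes N :: "real ^ 'n ^ 'n"
  assumes N: "N \<in> sym_mats" and psd: "\<And>v. v \<bullet> (N *v v) \<ge> 0" and z: "N $ i $ i = 0"
  shows "N $ i $ j = 0"
proof (rule ccontr)
  assume nz: "N $ i $ j \<noteq> 0"
  define t where "t = - (N $ j $ j + 1) / (2 * N $ i $ j)"
  let ?v = "t *\<^sub>R axis i 1 + axis j 1 :: real ^ 'n"
  have "?v \<bullet> (N *v ?v) = t * t * N $ i $ i + t * N $ i $ j + t * N $ j $ i + N $ j $ j"
    by (simp add: matrix_vector_right_distrib matrix_vector_mult_scaleR inner_add_left inner_add_right
        axis_inner_mult_axis algebra_simps)
  also have "\<dots> = - 1"
    using nz z sym_mats_entry[OF N, of j i] by (simp add: t_def field_simps)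
  finally show False using psd[of ?v] by simp
qed

text \<open>
  The inner product of two positive semidefinite matrices is nonnegative:
  completing the square at a positive diagonal entry \<open>N\<^sub>i\<^sub>i\<close> splits \<open>N\<close> into a rank one
  matrix, on which \<open>G\<close> is nonnegative, and a positive semidefinite matrix whose \<open>i\<close>-th row vanishes; the
  induction is on the set \<open>I\<close> of the rows that may be nonzero.
\<close>

lemma psd_inner_psd_aux:
  fixes N G :: "real ^ 'n ^ 'n"
  assumes G: "\<And>v. v \<bullet> (G *v v) \<ge> 0" and "finite I"
    and "N \<in> sym_mats" "\<And>v. v \<bullet> (N *v v) \<ge> 0" "\<And>i j. i \<notin> I \<Longrightarrow> N $ i $ j = 0"
  shows "G \<bullet> N \<ge> 0"
  using assms(2-)
proof (induction I arbitrary: N rule: finite_induct)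
  case empty
  then have "N = 0" by (simp add: vec_eq_iff)
  then show ?case by simp
next
  case (insert i I)
  note N = insert.prems(1) and psd = insert.prems(2) and supp = insert.prems(3)
  show ?case
  proof (cases "N $ i $ i = 0")
    case True
    show ?thesis
      by (rule insert.IH[OF N psd]) (metis insert_iff supp psd_diag_zero_row[OF N psd True])
  next
    case False
    define d where "d = N $ i $ i"
    define r where "r = N *v axis i 1"
    have d: "d > 0" using psd[of "axis i 1"] False by (simp add: axis_inner_mult_axis d_def)
    have r: "r $ k = N $ k $ i" for k
      using axis_inner_mult_axis[of k N i] by (simp add: r_def inner_axis')
    have rr: "r \<bullet> axis i 1 = N $ i $ i" by (simp add: inner_axis r)
    \<comment> \<open>\<open>N' = N - r r\<^sup>T / d\<close> is the Schur complement of the entry \<open>d\<close>, padded by a zero row and column.\<close>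
    define N' where "N' = N - (1 / d) *\<^sub>R outer r r"
    have N': "N' \<in> sym_mats"
      unfolding N'_def
      by (intro subspace_diff[OF subspace_sym_mats] subspace_scale[OF subspace_sym_mats] N
          outer_in_sym_mats)
    have outer_form: "v \<bullet> (outer r r *v v) = (r \<bullet> v)\<^sup>2" for v
      by (simp add: outer_def matrix_vector_mult_def inner_vec_def power2_eq_square
          sum_distrib_left sum_distrib_right mult_ac)
    have "v \<bullet> (N' *v v) \<ge> 0" for v
    proof -
      define s where "s = (r \<bullet> v) / d"
      let ?w = "v - s *\<^sub>R axis i 1"
      have rv: "axis i 1 \<bullet> (N *v v) = r \<bullet> v"
        by (simp add: r_def sym_mats_inner_commute[OF N])
      have "?w \<bullet> (N *v ?w) = v \<bullet> (N *v v) - s * (r \<bullet> v) - s * (r \<bullet> v) + s * s * d"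
        by (simp add: matrix_vector_mult_diff_distrib matrix_vector_mult_scaleR inner_diff_left
            inner_diff_right rv axis_inner_mult_axis d_def rr flip: r_def)
           (simp add: inner_commute[of v r] inner_commute[of "axis i 1" r] rr algebra_simps)
      also have "\<dots> = v \<bullet> (N *v v) - (r \<bullet> v)\<^sup>2 / d"
        using d by (simp add: s_def field_simps power2_eq_square)
      also have "\<dots> = v \<bullet> (N' *v v)"
        by (simp add: N'_def matrix_vector_mult_diff_rdistrib inner_diff_right outer_form
            flip: scaleR_matrix_vector_assoc)
      finally show ?thesis using psd[of ?w] by simp
    qed
    moreover have "N' $ k $ j = 0" if "k \<notin> I" for k j
    proof (cases "k = i")
      case True
      then show ?thesis using d sym_mats_entry[OF N, of i j] by (simp add: N'_def outer_def r d_def)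
    next
      case False
      then have "N $ k $ j = 0" "N $ k $ i = 0" using supp that by auto
      then show ?thesis by (simp add: N'_def outer_def r)
    qed
    ultimately have "G \<bullet> N' \<ge> 0" by (intro insert.IH[OF N']) auto
    moreover have "G \<bullet> N = G \<bullet> N' + (1 / d) * (r \<bullet> (G *v r))"
      by (simp add: N'_def inner_diff_right quadratic_form_inner)
    ultimately show ?thesis using G[of r] d by simp
  qed
qed

lemma psd_inner_psd_nonneg:
  fixes N G :: "real ^ 'n ^ 'n"
  assumes "\<And>v. v \<bullet> (G *v v) \<ge> 0" and "N \<in> sym_mats" "\<And>v. v \<bullet> (N *v v) \<ge> 0"
  shows "G \<bullet> N \<ge> 0"
  by (rule psd_inner_psd_aux[OF assms(1) finite[of UNIV] assms(2,3)]) auto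

lemma coercive_inner_psd:
  fixes N G :: "real ^ 'n ^ 'n"
  assumes G: "\<And>v. v \<bullet> (G *v v) \<ge> c * (v \<bullet> v)" and N: "N \<in> sym_mats" "\<And>v. v \<bullet> (N *v v) \<ge> 0"
  shows "c * trace N \<le> G \<bullet> N"
proof -
  have "(G - c *\<^sub>R mat 1) \<bullet> N \<ge> 0"
    using G by (intro psd_inner_psd_nonneg N)
      (simp add: matrix_vector_mult_diff_rdistrib inner_diff_right flip: scaleR_matrix_vector_assoc)
  then show ?thesis by (simp add: inner_diff_left mat_1_inner)
qed

lemma psd_trace_pos:
  fixes N :: "real ^ 'n ^ 'n"
  assumes N: "N \<in> sym_mats" "\<And>v. v \<bullet> (N *v v) \<ge> 0" and "N \<noteq> 0"
  shows "trace N > 0"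
proof -
  have "N $ i $ i \<ge> 0" for i using N(2)[of "axis i 1"] by (simp add: axis_inner_mult_axis)
  moreover obtain i where "N $ i $ i \<noteq> 0"
    using psd_diag_zero_row[OF N] \<open>N \<noteq> 0\<close> by (auto simp: vec_eq_iff)
  ultimately show ?thesis
    unfolding trace_def by (intro sum_pos2[of _ i]) (auto simp: less_le)
qed

lemma pos_def_coercive:
  fixes G :: "real ^ 'n ^ 'n"
  assumes "G \<in> pos_def_mats"
  obtains c where "c > 0" "\<And>v. v \<bullet> (G *v v) \<ge> c * (v \<bullet> v)"
proof -
  have "continuous_on (sphere 0 1) (\<lambda>v :: real ^ 'n. v \<bullet> (G *v v))"
    by (intro continuous_intros linear_continuous_on) (simp add: linear_linear)
  moreover have "sphere (0 :: real ^ 'n) 1 \<noteq> {}" by simp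
  ultimately obtain w where w: "w \<in> sphere 0 1"
    and min: "\<forall>v \<in> sphere 0 1. w \<bullet> (G *v w) \<le> v \<bullet> (G *v v)"
    using continuous_attains_inf[OF compact_sphere, of 0 1 "\<lambda>v :: real ^ 'n. v \<bullet> (G *v v)"] by blast
  show ?thesis
  proof
    show "w \<bullet> (G *v w) > 0" 
    proof -
      have "w \<noteq> 0" using w by auto
      then show ?thesis using assms by (simp add: pos_def_mats_def)
    qed
    fix v
    show "(w \<bullet> (G *v w)) * (v \<bullet> v) \<le> v \<bullet> (G *v v)"
    proof (cases "v = 0")
      case False
      let ?n = "norm v"
      have "w \<bullet> (G *v w) \<le> ((1 / ?n) *\<^sub>R v) \<bullet> (G *v ((1 / ?n) *\<^sub>R v))"
        by (rule bspec[OF min]) (use False in simp)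
      also have "\<dots> = (v \<bullet> (G *v v)) / (v \<bullet> v)"
        by (simp add: matrix_vector_mult_scaleR power2_eq_square flip: power2_norm_eq_inner)
      finally show ?thesis using False by (simp add: field_simps)
    qed simp
  qed
qed

text \<open>
  Now for the operator \<open>F\<close> itself. Two facts about its level sets on \<open>U\<close> are needed: nearby matrices
  of the same level satisfy a linear uniformly elliptic relation, and two ordered matrices of the same
  level, however far apart, are equal.
\<close>

context
  fixes U :: "(real ^ 'n ^ 'n) set" and F :: "real ^ 'n ^ 'n \<Rightarrow> real"
  assumes U_open: "openin (top_of_set sym_mats) U"
    and F_C1: "C1_on_sym U F"
    and F_elliptic: "\<And>M. M \<in> U \<Longrightarrow> mat_gradient F M \<in> pos_def_mats"
begin

lemma domain_sym: "M \<in> U \<Longrightarrow> M \<in> sym_mats"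
  using openin_imp_subset[OF U_open] by blast

lemma local_ellipticity:
  assumes M0: "M0 \<in> U"
  shows "\<exists>\<epsilon>>0. \<exists>c>0. \<exists>C. \<forall>M\<in>sym_mats. norm (M - M0) < \<epsilon> \<longrightarrow>
     M \<in> U \<and> norm (mat_gradient F M) \<le> C \<and> (\<forall>v. v \<bullet> (mat_gradient F M *v v) \<ge> c * (v \<bullet> v))"
proof -
  let ?G = "mat_gradient F"
  obtain e1 where e1: "e1 > 0" "\<And>M. M \<in> sym_mats \<Longrightarrow> dist M M0 < e1 \<Longrightarrow> M \<in> U"
    using U_open M0 unfolding openin_euclidean_subtopology_iff by blast
  obtain c0 where c0: "c0 > 0" "\<And>v. v \<bullet> (?G M0 *v v) \<ge> c0 * (v \<bullet> v)"
    using pos_def_coercive[OF F_elliptic[OF M0]] by metis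
  have "continuous_on U ?G" using F_C1 by (simp add: C1_on_sym_def)
  then obtain e2 where e2: "e2 > 0" "\<And>M. M \<in> U \<Longrightarrow> dist M M0 < e2 \<Longrightarrow> dist (?G M) (?G M0) < c0 / 2"
    unfolding continuous_on_iff using M0 c0(1) by (meson half_gt_zero)
  have near: "M \<in> U \<and> norm (?G M - ?G M0) < c0 / 2"
    if "M \<in> sym_mats" "norm (M - M0) < min e1 e2" for M
    using that e1(2)[of M] e2(2)[of M] by (simp add: dist_norm)
  have "M \<in> U \<and> norm (?G M) \<le> norm (?G M0) + c0 / 2 \<and> (\<forall>v. c0 / 2 * (v \<bullet> v) \<le> v \<bullet> (?G M *v v))"
    if M: "M \<in> sym_mats" "norm (M - M0) < min e1 e2" for M
  proof (intro conjI allI)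
    show "M \<in> U" using near[OF M] by simp
    show "norm (?G M) \<le> norm (?G M0) + c0 / 2"
      using near[OF M] norm_triangle_sub[of "?G M" "?G M0"] by linarith
    fix v :: "real ^ 'n"
    have "v \<bullet> ((?G M - ?G M0) *v v) \<ge> - (norm (?G M - ?G M0) * (v \<bullet> v))"
      unfolding quadratic_form_inner
      using Cauchy_Schwarz_ineq2[of "?G M - ?G M0" "outer v v"]
      by (simp add: norm_outer power2_norm_eq_inner flip: power2_eq_square)
    moreover have "norm (?G M - ?G M0) * (v \<bullet> v) \<le> c0 / 2 * (v \<bullet> v)"
      using near[OF M] by (intro mult_right_mono) auto
    ultimately show "c0 / 2 * (v \<bullet> v) \<le> v \<bullet> (?G M *v v)"
      using c0(2)[of v] by (simp add: matrix_vector_mult_diff_rdistrib inner_diff_right)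
  qed
  moreover have "min e1 e2 > 0" "c0 / 2 > 0" using e1 e2 c0 by auto
  ultimately show ?thesis by blast
qed

lemma F_has_derivative_line:
  assumes M: "M \<in> sym_mats" and D: "D \<in> sym_mats" and t: "M + t *\<^sub>R D \<in> U"
  shows "((\<lambda>t. F (M + t *\<^sub>R D)) has_real_derivative mat_gradient F (M + t *\<^sub>R D) \<bullet> D) (at t)"
proof -
  define p where "p = (\<lambda>t::real. M + t *\<^sub>R D)"
  have p_sym: "p t \<in> sym_mats" for t
    unfolding p_def
    by (rule subspace_add[OF subspace_sym_mats M subspace_scale[OF subspace_sym_mats D]])
  have p_der: "(p has_derivative (\<lambda>t. t *\<^sub>R D)) (at t)"
    unfolding p_def by (auto intro!: derivative_eq_intros)
  have "F differentiable (at (p t) within sym_mats)"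
    using F_C1 t by (simp add: C1_on_sym_def p_def)
  from mat_gradient_exists(2)[OF p_sym this]
  have "(F has_derivative (\<lambda>H. mat_gradient F (p t) \<bullet> H)) (at (p t) within range p)"
    by (rule has_derivative_subset) (use p_sym in auto)
  from diff_chain_within[OF p_der this] show ?thesis
    unfolding has_field_derivative_def by (simp add: p_def o_def mult.commute[of _ "_ \<bullet> _"])
qed

text \<open>The matrix \<open>G\<close> is the gradient of \<open>F\<close> at the point of the segment that the mean value theorem provides.\<close>

lemma level_set_linearization:
  assumes M0: "M0 \<in> U"
  shows "\<exists>\<epsilon>>0. \<exists>c>0. \<exists>C. \<forall>M1\<in>U. \<forall>M2\<in>U. norm (M1 - M0) < \<epsilon> \<longrightarrow> norm (M2 - M0) < \<epsilon> \<longrightarrow> F M1 = F M2 \<longrightarrow>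
     (\<exists>G. norm G \<le> C \<and> (\<forall>v. v \<bullet> (G *v v) \<ge> c * (v \<bullet> v)) \<and> G \<bullet> (M1 - M2) = 0)"
proof -
  obtain \<epsilon> c C where *: "\<epsilon> > 0" "c > 0"
    and U: "\<And>M. M \<in> sym_mats \<Longrightarrow> norm (M - M0) < \<epsilon> \<Longrightarrow> M \<in> U"
    and G: "\<And>M. M \<in> sym_mats \<Longrightarrow> norm (M - M0) < \<epsilon> \<Longrightarrow> norm (mat_gradient F M) \<le> C"
      "\<And>M v. M \<in> sym_mats \<Longrightarrow> norm (M - M0) < \<epsilon> \<Longrightarrow> v \<bullet> (mat_gradient F M *v v) \<ge> c * (v \<bullet> v)"
    using local_ellipticity[OF M0] by blast
  have "\<exists>G. norm G \<le> C \<and> (\<forall>v. v \<bullet> (G *v v) \<ge> c * (v \<bullet> v)) \<and> G \<bullet> (M1 - M2) = 0"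
    if M: "M1 \<in> U" "M2 \<in> U" "norm (M1 - M0) < \<epsilon>" "norm (M2 - M0) < \<epsilon>" "F M1 = F M2" for M1 M2
  proof -
    let ?D = "M1 - M2"
    have D: "?D \<in> sym_mats" using subspace_diff[OF subspace_sym_mats] domain_sym M by blast
    have sym: "M2 + t *\<^sub>R ?D \<in> sym_mats" for t
      using subspace_add[OF subspace_sym_mats _ subspace_scale[OF subspace_sym_mats D]] domain_sym M
      by blast
    have near: "norm (M2 + t *\<^sub>R ?D - M0) < \<epsilon>" if "0 \<le> t" "t \<le> 1" for t
    proof -
      have "M2 + t *\<^sub>R ?D = (1 - t) *\<^sub>R M2 + t *\<^sub>R M1" by (simp add: algebra_simps)
      also have "\<dots> \<in> ball M0 \<epsilon>"
        by (rule convexD[OF convex_ball]) (use M that in \<open>auto simp: dist_norm norm_minus_commute\<close>)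
      finally show ?thesis by (simp add: dist_norm norm_minus_commute)
    qed
    have der: "((\<lambda>t. F (M2 + t *\<^sub>R ?D)) has_real_derivative mat_gradient F (M2 + t *\<^sub>R ?D) \<bullet> ?D) (at t)"
      if "0 \<le> t" "t \<le> 1" for t
      using F_has_derivative_line[OF domain_sym[OF M(2)] D U[OF sym near[OF that]]] .
    obtain t where t: "0 < t" "t < 1"
      "F (M2 + 1 *\<^sub>R ?D) - F (M2 + 0 *\<^sub>R ?D) = (1 - 0) * (mat_gradient F (M2 + t *\<^sub>R ?D) \<bullet> ?D)"
      using MVT2[of 0 1 "\<lambda>t. F (M2 + t *\<^sub>R ?D)" "\<lambda>t. mat_gradient F (M2 + t *\<^sub>R ?D) \<bullet> ?D"] der by auto
    then show ?thesis using G[OF sym near[of t]] M(5) by (intro exI[of _ "mat_gradient F (M2 + t *\<^sub>R ?D)"]) auto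
  qed
  then show ?thesis using * by blast
qed

text \<open>
  If \<open>N \<noteq> 0\<close>, then \<open>F\<close> increases by a definite amount along the initial part of the segment from \<open>M\<close> to
  \<open>M + N\<close>, and it does not decrease afterwards. Convexity of \<open>U\<close> is only given in positive definite
  directions, and the ray that is intersected with \<open>U\<close> does not contain its starting point. Hence \<open>N\<close> is
  replaced by \<open>N + s I\<close>, and \<open>s\<close> tends to \<open>0\<close> in the end.
\<close>

lemma level_set_rigid:
  assumes U_convex: "\<And>M N. M \<in> sym_mats \<Longrightarrow> N \<in> pos_def_mats \<Longrightarrow> convex (U \<inter> {M + t *\<^sub>R N | t. 0 < t})"
    and M: "M \<in> U" and MN: "M + N \<in> U" and N: "N \<in> sym_mats" and psd: "\<And>v. v \<bullet> (N *v v) \<ge> 0"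
    and eq: "F (M + N) = F M"
  shows "N = 0"
proof (rule ccontr)
  assume "N \<noteq> 0"
  define \<tau> where "\<tau> = trace N"
  have \<tau>: "\<tau> > 0" unfolding \<tau>_def by (rule psd_trace_pos[OF N psd \<open>N \<noteq> 0\<close>])
  obtain \<epsilon> c C where *: "\<epsilon> > 0" "c > 0"
    and U: "\<And>M'. M' \<in> sym_mats \<Longrightarrow> norm (M' - M) < \<epsilon> \<Longrightarrow> M' \<in> U"
    and G: "\<And>M' v. M' \<in> sym_mats \<Longrightarrow> norm (M' - M) < \<epsilon> \<Longrightarrow> v \<bullet> (mat_gradient F M' *v v) \<ge> c * (v \<bullet> v)"
    using local_ellipticity[OF M] by blast
  obtain e where e: "e > 0" and UN: "\<And>M'. M' \<in> sym_mats \<Longrightarrow> norm (M' - (M + N)) < e \<Longrightarrow> M' \<in> U"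
    using local_ellipticity[OF MN] by blast
  let ?I = "mat 1 :: real ^ 'n ^ 'n"
  define t0 where "t0 = min (1/2) (\<epsilon> / (2 * (norm N + norm ?I + 1)))"
  have pos: "norm N + norm ?I + 1 > 0" by (simp add: add_nonneg_pos)
  have t0: "t0 > 0" "t0 < 1" "t0 * (norm N + norm ?I) < \<epsilon>"
  proof -
    show "t0 > 0" "t0 < 1" using *(1) pos by (auto simp: t0_def)
    have "t0 * (norm N + norm ?I) \<le> \<epsilon> / (2 * (norm N + norm ?I + 1)) * (norm N + norm ?I)"
      by (intro mult_right_mono) (auto simp: t0_def)
    also have "\<dots> < \<epsilon>" using *(1) pos by (simp add: field_simps add_pos_nonneg add_nonneg_pos)
    finally show "t0 * (norm N + norm ?I) < \<epsilon>" .
  qed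
  have gap: "F (M + N + s *\<^sub>R ?I) \<ge> F M + t0 * (c * \<tau>)"
    if s: "0 < s" "s \<le> 1" "s * norm ?I < e" for s
  proof -
    define D where "D = N + s *\<^sub>R ?I"
    have D: "D \<in> sym_mats"
      unfolding D_def by (intro subspace_add[OF subspace_sym_mats] subspace_scale[OF subspace_sym_mats]
          N mat_1_in_sym_mats)
    have Dform: "v \<bullet> (D *v v) = v \<bullet> (N *v v) + s * (v \<bullet> v)" for v
      by (simp add: D_def matrix_vector_mult_add_rdistrib inner_add_right flip: scaleR_matrix_vector_assoc)
    have Dpsd: "v \<bullet> (D *v v) \<ge> 0" for v using psd[of v] s by (simp add: Dform)
    have "v \<bullet> (D *v v) > 0" if "v \<noteq> 0" for v
      using psd[of v] s that by (simp add: Dform add_nonneg_pos)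
    then have Dpd: "D \<in> pos_def_mats" using D by (simp add: pos_def_mats_def)
    have Dtr: "trace D \<ge> \<tau>"
      using s unfolding D_def \<tau>_def mat_1_inner[symmetric] by (simp add: inner_add_right)
    have sym: "M + t *\<^sub>R D \<in> sym_mats" for t
      using subspace_add[OF subspace_sym_mats _ subspace_scale[OF subspace_sym_mats D]] domain_sym M
      by blast
    have near: "norm (M + t *\<^sub>R D - M) < \<epsilon>" if "0 \<le> t" "t \<le> t0" for t
    proof -
      have "norm D \<le> norm N + norm ?I"
        unfolding D_def using s norm_triangle_ineq[of N "s *\<^sub>R ?I"] mult_right_mono[of s 1 "norm ?I"]
        by simp
      then have "t * norm D \<le> t0 * (norm N + norm ?I)" using that by (intro mult_mono) auto
      then show ?thesis using t0 that by simp
    qed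
    have in_U: "M + t *\<^sub>R D \<in> U" if t: "0 \<le> t" "t \<le> 1" for t
    proof (cases "t \<le> t0")
      case True then show ?thesis using U[OF sym near] t by simp
    next
      case False
      have "M + 1 *\<^sub>R D \<in> U" by (rule UN[OF sym]) (use s in \<open>simp add: D_def\<close>)
      moreover have "M + t0 *\<^sub>R D \<in> U" using U[OF sym near] t0 by simp
      ultimately have ends: "M + 1 *\<^sub>R D \<in> U \<inter> {M + t *\<^sub>R D | t. 0 < t}"
          "M + t0 *\<^sub>R D \<in> U \<inter> {M + t *\<^sub>R D | t. 0 < t}"
        using t0(1) zero_less_one by blast+
      \<comment> \<open>\<open>M\<close> itself is not on the open ray, so convexity is used from \<open>t0\<close> on.\<close>
      define q where "q = (t - t0) / (1 - t0)"
      have q: "0 \<le> q" "q \<le> 1" and "q * (1 - t0) = t - t0"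
        using False t t0 by (auto simp: q_def)
      then have tq: "t = (1 - q) * t0 + q" by (simp add: algebra_simps)
      have "(1 - q) *\<^sub>R (M + t0 *\<^sub>R D) + q *\<^sub>R (M + 1 *\<^sub>R D) \<in> U"
        using convexD[OF U_convex[OF domain_sym[OF M] Dpd] ends(2,1), of "1 - q" q] q by auto
      also have "(1 - q) *\<^sub>R (M + t0 *\<^sub>R D) + q *\<^sub>R (M + 1 *\<^sub>R D) = M + t *\<^sub>R D"
        unfolding tq by (simp add: algebra_simps)
      finally show ?thesis .
    qed
    have der: "((\<lambda>t. F (M + t *\<^sub>R D)) has_real_derivative mat_gradient F (M + t *\<^sub>R D) \<bullet> D) (at t)"
      if "0 \<le> t" "t \<le> 1" for t
      using F_has_derivative_line[OF domain_sym[OF M] D in_U[OF that]] .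
    obtain z where z: "0 < z" "z < t0"
      "F (M + t0 *\<^sub>R D) - F (M + 0 *\<^sub>R D) = (t0 - 0) * (mat_gradient F (M + z *\<^sub>R D) \<bullet> D)"
      using MVT2[OF t0(1), of "\<lambda>t. F (M + t *\<^sub>R D)" "\<lambda>t. mat_gradient F (M + t *\<^sub>R D) \<bullet> D"] der t0 by auto
    have "c * \<tau> \<le> c * trace D" using Dtr * by simp
    also have "\<dots> \<le> mat_gradient F (M + z *\<^sub>R D) \<bullet> D"
      by (rule coercive_inner_psd[OF G[OF sym near] D Dpsd]) (use z in auto)
    finally have "t0 * (c * \<tau>) \<le> F (M + t0 *\<^sub>R D) - F M"
      using z(3) t0(1) by simp
    moreover have "F (M + t0 *\<^sub>R D) \<le> F (M + 1 *\<^sub>R D)"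
    proof (rule DERIV_nonneg_imp_nondecreasing[of t0 1 "\<lambda>t. F (M + t *\<^sub>R D)"])
      show "t0 \<le> 1" using t0 by simp
      fix t assume t: "t0 \<le> t" "t \<le> 1"
      have "mat_gradient F (M + t *\<^sub>R D) \<in> pos_def_mats"
        by (rule F_elliptic[OF in_U]) (use t t0 in auto)
      then have "v \<bullet> (mat_gradient F (M + t *\<^sub>R D) *v v) \<ge> 0" for v
        by (cases "v = 0") (auto simp: pos_def_mats_def less_imp_le)
      then have "mat_gradient F (M + t *\<^sub>R D) \<bullet> D \<ge> 0" by (rule psd_inner_psd_nonneg[OF _ D Dpsd])
      then show "\<exists>y. ((\<lambda>t. F (M + t *\<^sub>R D)) has_real_derivative y) (at t) \<and> 0 \<le> y"
        using der[of t] t t0 by auto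
    qed
    ultimately show ?thesis by (simp add: D_def add.assoc)
  qed
  have "((\<lambda>s. F (M + N + s *\<^sub>R ?I)) has_real_derivative mat_gradient F (M + N + 0 *\<^sub>R ?I) \<bullet> ?I) (at 0)"
    by (rule F_has_derivative_line[OF domain_sym[OF MN] mat_1_in_sym_mats]) (use MN in simp)
  then have "((\<lambda>s. F (M + N + s *\<^sub>R ?I)) \<longlongrightarrow> F (M + N + 0 *\<^sub>R ?I)) (at_right 0)"
    using DERIV_isCont filterlim_at_split unfolding isCont_def by blast
  then have lim: "((\<lambda>s. F (M + N + s *\<^sub>R ?I)) \<longlongrightarrow> F M) (at_right 0)" using eq by simp
  have "\<forall>\<^sub>F s in at_right 0. F (M + N + s *\<^sub>R ?I) \<ge> F M + t0 * (c * \<tau>)"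
  proof -
    define b where "b = min 1 (e / (norm ?I + 1))"
    have ni: "norm ?I + 1 > 0" by (simp add: add_nonneg_pos)
    have b: "b > 0" using e ni by (simp add: b_def)
    have "s * norm ?I < e" if "0 < s" "s < b" for s
    proof -
      have "s * norm ?I \<le> s * (norm ?I + 1)" using that by simp
      also have "\<dots> < e" using that ni by (simp add: b_def pos_less_divide_eq)
      finally show ?thesis .
    qed
    then show ?thesis
      unfolding eventually_at_right_field using b gap by (intro exI[of _ b]) (auto simp: b_def)
  qed
  from tendsto_lowerbound[OF lim this] have "F M + t0 * (c * \<tau>) \<le> F M" by simp
  then show False using t0 * \<tau> by (simp add: mult_le_0_iff)
qed

end

section \<open>Hopf's lemma and the strong maximum principle\<close>

lemma has_jet_cong:
  fixes f :: "real ^ 'n \<Rightarrow> real"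
  assumes S: "open S" and jet: "has_jet f p H S" and eq: "\<And>x. x \<in> S \<Longrightarrow> f x = g x"
  shows "has_jet g p H S"
  using jet unfolding has_jet_def
  by (auto intro: has_derivative_transform_within_open[OF _ S] simp: eq)

lemma C2_on_schouten_cong:
  fixes f g :: "real ^ 'n \<Rightarrow> real"
  assumes S: "open S" and f: "C2_on S f" and eq: "\<And>x. x \<in> S \<Longrightarrow> f x = g x"
  shows "C2_on S g" and "\<And>x. x \<in> S \<Longrightarrow> schouten g x = schouten f x"
proof -
  note jet = has_jet_cong[OF S has_jet_grad_hessian[OF f] eq]
  show "C2_on S g" by (rule has_jet_C2_on[OF S jet])
  show "schouten g x = schouten f x" if "x \<in> S" for x
    using schouten_jet[OF S jet that] eq[OF that] by (simp add: schouten_def)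
qed

lemma continuous_on_schouten: "C2_on S f \<Longrightarrow> continuous_on S (schouten f)"
  unfolding schouten_def[abs_def]
  using has_jet_continuous_on[OF has_jet_grad_hessian] by (intro continuous_intros) auto

lemma tendsto_nhds_continuous_on:
  fixes h :: "'a::t2_space \<Rightarrow> 'b::topological_space"
  shows "continuous_on S h \<Longrightarrow> open S \<Longrightarrow> p \<in> S \<Longrightarrow> (h \<longlongrightarrow> h p) (nhds p)"
  using continuous_on_eq_continuous_at[of S h]
  by (auto simp: isCont_def simp flip: tendsto_at_iff_tendsto_nhds)

text \<open>
  From here on the operator enters only through the set \<open>E\<close> of the admissible matrices, those with
  \<open>F = 1\<close> and nonnegative trace; the trace carries the superharmonicity of \<open>u\<close>.
\<close>

locale elliptic_level_set =
  fixes E :: "(real ^ 'n ^ 'n) set"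
  assumes dim: "CARD('n) \<ge> 3"
    and sym: "M \<in> E \<Longrightarrow> M \<in> sym_mats"
    and trace_nonneg: "M \<in> E \<Longrightarrow> trace M \<ge> 0"
    and conj_closed: "orthogonal_matrix Q \<Longrightarrow> M \<in> E \<Longrightarrow> matrix_inv Q ** M ** Q \<in> E"
    and rigid: "M \<in> E \<Longrightarrow> M + N \<in> E \<Longrightarrow> N \<in> sym_mats \<Longrightarrow> (\<And>v. v \<bullet> (N *v v) \<ge> 0) \<Longrightarrow> N = 0"
    and linearization: "M0 \<in> E \<Longrightarrow> \<exists>\<epsilon>>0. \<exists>c>0. \<exists>C. \<forall>M1\<in>E. \<forall>M2\<in>E.
      norm (M1 - M0) < \<epsilon> \<longrightarrow> norm (M2 - M0) < \<epsilon> \<longrightarrow>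
      (\<exists>G. norm G \<le> C \<and> (\<forall>v. v \<bullet> (G *v v) \<ge> c * (v \<bullet> v)) \<and> G \<bullet> (M1 - M2) = 0)"
begin

definition solution :: "(real ^ 'n) set \<Rightarrow> (real ^ 'n \<Rightarrow> real) \<Rightarrow> bool" where
  "solution S f \<longleftrightarrow> open S \<and> C2_on S f \<and> (\<forall>x\<in>S. f x > 0 \<and> schouten f x \<in> E)"

lemma solution_subset: "solution S f \<Longrightarrow> open T \<Longrightarrow> T \<subseteq> S \<Longrightarrow> solution T f"
  unfolding solution_def C2_on_def by (blast intro: continuous_on_subset)

lemma solution_cong:
  assumes "solution S f" and "\<And>x. x \<in> S \<Longrightarrow> f x = g x"
  shows "solution S g"
  using assms C2_on_schouten_cong[of S f g] unfolding solution_def by auto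

lemma solution_similarity:
  assumes f: "solution S f" and c: "c > 0"
  shows "solution {y. z + c *\<^sub>R y \<in> S} (\<lambda>y. f (z + c *\<^sub>R y) / c)"
proof -
  have S: "open S" and C2: "C2_on S f" using f by (auto simp: solution_def)
  have c0: "c \<noteq> 0" using c by simp
  note jet = has_jet_similarity[OF has_jet_grad_hessian[OF C2] c0]
  show ?thesis
    using has_jet_C2_on[OF open_similarity[OF S] jet] schouten_similarity[OF S C2 c0]
      open_similarity[OF S] f c unfolding solution_def by auto
qed

lemma solution_kelvin:
  assumes f: "solution S f"
  shows "solution {y. y \<noteq> 0 \<and> inversion y \<in> S} (kelvin f)"
proof -
  have S: "open S" and C2: "C2_on S f" using f by (auto simp: solution_def)
  note jet = has_jet_kelvin[OF has_jet_grad_hessian[OF C2]]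
  show ?thesis
    using has_jet_C2_on[OF open_inversion_vimage[OF S] jet] schouten_kelvin[OF S C2]
      open_inversion_vimage[OF S] f conj_closed[OF orthogonal_householder]
    unfolding solution_def by (auto simp: kelvin_def)
qed

lemma solutionD:
  assumes "solution S f"
  shows "open S" "C2_on S f" "has_jet f (grad f) (hessian f) S"
    "\<And>x. x \<in> S \<Longrightarrow> f x > 0" "\<And>x. x \<in> S \<Longrightarrow> schouten f x \<in> E"
  using assms has_jet_grad_hessian unfolding solution_def by auto

lemma hessian_sym:
  assumes f: "solution S f" and x: "x \<in> S"
  shows "hessian f x \<in> sym_mats"
proof -
  have pos: "f x > 0" using solutionD(4)[OF f x] .
  have "hessian f x = (1 / f x) *\<^sub>R (schouten f x + ((grad f x \<bullet> grad f x) / 2) *\<^sub>R mat 1)"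
    using pos by (simp add: schouten_def)
  also have "\<dots> \<in> sym_mats"
    by (intro subspace_scale[OF subspace_sym_mats] subspace_add[OF subspace_sym_mats]
        sym solutionD(5)[OF f x] mat_1_in_sym_mats)
  finally show ?thesis .
qed

lemma has_jet_difference:
  assumes "solution S f" "solution S g"
  shows "has_jet (\<lambda>x. g x - f x) (\<lambda>x. grad g x - grad f x) (\<lambda>x. hessian g x - hessian f x) S"
  using has_jet_lincomb[OF solutionD(3)[OF assms(2)] solutionD(3)[OF assms(1)], of 1 "-1"] by simp

text \<open>
  The difference \<open>g - f\<close> vanishes at \<open>p\<close> together with its gradient and is positive in a ball that has \<open>p\<close>
  on its boundary. Its second derivatives in the directions that enter the ball are nonnegative, and the
  evenness of the quadratic form together with continuity covers all other directions. So the two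
  matrices at \<open>p\<close> are ordered, and rigidity makes them equal.
\<close>

lemma critical_boundary_contact:
  assumes f: "solution S f" and g: "solution S g"
    and ball: "ball z \<rho> \<subseteq> S" and p: "p \<in> S" "norm (p - z) = \<rho>" and \<rho>: "\<rho> > 0"
    and less: "\<And>y. y \<in> ball z \<rho> \<Longrightarrow> f y < g y" and eq: "f p = g p"
    and crit: "(grad g p - grad f p) \<bullet> (z - p) \<le> 0"
  shows "grad g p = grad f p" and "schouten g p = schouten f p"
proof -
  define n where "n = z - p"
  have nn: "n \<bullet> n = \<rho>\<^sup>2" using p(2) by (simp add: n_def norm_minus_commute flip: power2_norm_eq_inner)
  have inside: "\<exists>t0>0. \<forall>t. 0 < t \<longrightarrow> t < t0 \<longrightarrow> f p - f p \<le> g (p + t *\<^sub>R e) - f (p + t *\<^sub>R e)"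
    if e: "e \<bullet> n > 0" for e
  proof -
    have ee: "e \<bullet> e > 0" using e by (metis inner_gt_zero_iff inner_zero_left less_irrefl)
    have "f (p + t *\<^sub>R e) < g (p + t *\<^sub>R e)" if t: "0 < t" "t < 2 * (e \<bullet> n) / (e \<bullet> e)" for t
    proof (rule less)
      have "(norm (p + t *\<^sub>R e - z))\<^sup>2 = \<rho>\<^sup>2 - t * (2 * (e \<bullet> n) - t * (e \<bullet> e))"
        unfolding power2_norm_eq_inner nn[symmetric] n_def
        by (simp add: inner_diff_left inner_diff_right inner_add_left inner_add_right inner_commute
            algebra_simps)
      also have "\<dots> < \<rho>\<^sup>2" using t ee by (simp add: pos_less_divide_eq)
      finally have "norm (p + t *\<^sub>R e - z) < \<rho>" using \<rho> by (simp add: power2_less_imp_less)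
      then show "p + t *\<^sub>R e \<in> ball z \<rho>" by (simp add: dist_norm norm_minus_commute)
    qed
    then show ?thesis using e ee by (intro exI[of _ "2 * (e \<bullet> n) / (e \<bullet> e)"]) (auto simp: less_imp_le)
  qed
  note jet = has_jet_difference[OF f g]
  let ?P = "grad g p - grad f p" and ?K = "hessian g p - hessian f p"
  have P: "?P \<bullet> e \<ge> 0" if "e \<bullet> n > 0" for e
    using inside[OF that] ray_first_order[OF jet p(1)] eq by fastforce
  have nn0: "n \<bullet> n > 0" using nn \<rho> by simp
  have "?P \<bullet> n = 0" using P[OF nn0] crit by (simp add: n_def)
  moreover have "(n - ?P) \<bullet> n > 0" using nn0 calculation by (simp add: inner_diff_left)
  ultimately have "?P \<bullet> ?P \<le> 0" using P[of "n - ?P"] by (simp add: inner_diff_right)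
  then have P0: "?P = 0" by (meson inner_gt_zero_iff not_less)
  then show grads: "grad g p = grad f p" by simp
  have K1: "e \<bullet> (?K *v e) \<ge> 0" if e: "e \<bullet> n > 0" for e
    using inside[OF e] ray_second_order[OF solutionD(1)[OF f] jet p(1), of e] P0 eq by fastforce
  have K: "e \<bullet> (?K *v e) \<ge> 0" for e
  proof -
    consider "e \<bullet> n > 0" | "e \<bullet> n < 0" | "e \<bullet> n = 0" by linarith
    then show ?thesis
    proof cases
      case 1 then show ?thesis by (rule K1)
    next
      case 2
      have "(- e) \<bullet> (?K *v (- e)) = e \<bullet> (?K *v e)"
        using matrix_vector_mult_scaleR[of ?K "-1" e] by simp
      then show ?thesis using K1[of "- e"] 2 by simp
    next
      case 3
      have "\<forall>\<^sub>F \<kappa> in at_right 0. (e + \<kappa> *\<^sub>R n) \<bullet> (?K *v (e + \<kappa> *\<^sub>R n)) \<ge> 0"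
        unfolding eventually_at_right_field
      proof (intro exI[of _ 1] conjI allI impI)
        fix \<kappa> :: real assume "0 < \<kappa>"
        then show "(e + \<kappa> *\<^sub>R n) \<bullet> (?K *v (e + \<kappa> *\<^sub>R n)) \<ge> 0"
          using 3 nn0 by (intro K1) (simp add: inner_add_left)
      qed simp
      moreover have "((\<lambda>\<kappa>. (e + \<kappa> *\<^sub>R n) \<bullet> (?K *v (e + \<kappa> *\<^sub>R n))) \<longlongrightarrow>
          (e + 0 *\<^sub>R n) \<bullet> (?K *v (e + 0 *\<^sub>R n))) (at_right (0::real))"
        by (intro tendsto_intros
            bounded_linear.tendsto[OF matrix_vector_mul_bounded_linear])
      ultimately show ?thesis using tendsto_lowerbound by fastforce
    qed
  qed
  have gp: "g p > 0" using solutionD(4)[OF g p(1)] .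
  define N where "N = g p *\<^sub>R ?K"
  have gf: "schouten g p = schouten f p + N"
    using grads eq by (simp add: schouten_def N_def scaleR_diff_right)
  have "N \<in> sym_mats"
    unfolding N_def using hessian_sym f g p(1)
    by (intro subspace_scale[OF subspace_sym_mats] subspace_diff[OF subspace_sym_mats]) auto
  moreover have "v \<bullet> (N *v v) \<ge> 0" for v
    using K[of v] gp by (simp add: N_def flip: scaleR_matrix_vector_assoc)
  ultimately have "N = 0"
    using rigid[of "schouten f p" N] solutionD(5)[OF f p(1)] solutionD(5)[OF g p(1)] gf by simp
  then show "schouten g p = schouten f p" using gf by simp
qed

lemma schouten_difference:
  "schouten g x - schouten f x = g x *\<^sub>R (hessian g x - hessian f x) + (g x - f x) *\<^sub>R hessian f x
     - (((grad g x + grad f x) \<bullet> (grad g x - grad f x)) / 2) *\<^sub>R mat 1"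
proof -
  have "(grad g x + grad f x) \<bullet> (grad g x - grad f x) = grad g x \<bullet> grad g x - grad f x \<bullet> grad f x"
    by (simp add: inner_add_left inner_diff_right inner_commute[of "grad f x" "grad g x"])
  then show ?thesis
    by (simp add: schouten_def algebra_simps diff_divide_distrib)
qed

text \<open>
  The barrier \<open>\<sigma> + K \<sigma>\<^sup>2\<close> with \<open>\<sigma> = R\<^sup>2 - |y - z|\<^sup>2\<close> vanishes on the sphere. In a neighbourhood of the
  sphere where \<open>2 K \<sigma> \<le> 1\<close>, the rank one term of its Hessian dominates all others if \<open>K\<close> is large.
\<close>

lemma has_jet_barrier:
  "has_jet (\<lambda>y :: real ^ 'n. (R\<^sup>2 - (y - z) \<bullet> (y - z)) + K * (R\<^sup>2 - (y - z) \<bullet> (y - z))\<^sup>2)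
     (\<lambda>y. (- (1 + 2 * K * (R\<^sup>2 - (y - z) \<bullet> (y - z)))) *\<^sub>R (2 *\<^sub>R (y - z)))
     (\<lambda>y. (- (1 + 2 * K * (R\<^sup>2 - (y - z) \<bullet> (y - z)))) *\<^sub>R (2 *\<^sub>R mat 1)
         + (2 * K) *\<^sub>R outer (2 *\<^sub>R (y - z)) (2 *\<^sub>R (y - z))) S"
proof -
  have 1: "((\<lambda>t. (R\<^sup>2 - t) + K * (R\<^sup>2 - t)\<^sup>2) has_real_derivative - (1 + 2 * K * (R\<^sup>2 - t))) (at t)" for t
    by (auto intro!: derivative_eq_intros simp: algebra_simps)
  have 2: "((\<lambda>t. - (1 + 2 * K * (R\<^sup>2 - t))) has_real_derivative 2 * K) (at t)" for t
    by (auto intro!: derivative_eq_intros)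
  show ?thesis using has_jet_compose[OF has_jet_dist_sq 1 2 continuous_on_const] .
qed

text \<open>
  The nonlinear Hopf lemma. If the normal derivative vanished, the matrices of \<open>f\<close> and \<open>g\<close> would agree at \<open>p\<close>
  by \<open>critical_boundary_contact\<close>. They are then close to each other near \<open>p\<close>, the difference \<open>g - f\<close> solves a linear
  elliptic equation with bounded coefficients there, and the classical barrier argument gives a positive
  normal derivative after all.
\<close>

lemma hopf_boundary_point:
  assumes f: "solution S f" and g: "solution S g"
    and ball: "ball z \<rho> \<subseteq> S" and p: "p \<in> S" "norm (p - z) = \<rho>" and \<rho>: "\<rho> > 0"
    and less: "\<And>y. y \<in> ball z \<rho> \<Longrightarrow> f y < g y" and eq: "f p = g p"
  shows "(grad g p - grad f p) \<bullet> (z - p) > 0"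
proof (rule ccontr)
  assume "\<not> ?thesis"
  then have crit: "(grad g p - grad f p) \<bullet> (z - p) \<le> 0" by simp
  note contact = critical_boundary_contact[OF f g ball p \<rho> less eq crit]
  note Sf = solutionD[OF f] and Sg = solutionD[OF g]
  define M0 where "M0 = schouten f p"
  obtain \<epsilon> c C where \<epsilon>: "\<epsilon> > 0" and c: "c > 0"
    and lin: "\<forall>M1\<in>E. \<forall>M2\<in>E. norm (M1 - M0) < \<epsilon> \<longrightarrow> norm (M2 - M0) < \<epsilon> \<longrightarrow>
      (\<exists>G. norm G \<le> C \<and> (\<forall>v. v \<bullet> (G *v v) \<ge> c * (v \<bullet> v)) \<and> G \<bullet> (M1 - M2) = 0)"
    using linearization[OF Sf(5)[OF p(1)]] unfolding M0_def by blast
  define m where "m = g p / 2"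
  define K2 where "K2 = norm (hessian f p) + 1"
  define K3 where "K3 = norm (grad g p + grad f p) + 1"
  have m: "m > 0" using Sg(4)[OF p(1)] by (simp add: m_def)
  note cf = has_jet_continuous_on[OF Sf(3)] and cg = has_jet_continuous_on[OF Sg(3)]
  note lim = tendsto_nhds_continuous_on[OF _ Sf(1) p(1)]
  have "\<forall>\<^sub>F y in nhds p. y \<in> S \<and> norm (schouten f y - M0) < \<epsilon> \<and> norm (schouten g y - M0) < \<epsilon>
     \<and> g y > m \<and> norm (hessian f y) < K2 \<and> norm (grad g y + grad f y) < K3"
  proof (intro eventually_conj)
    show "\<forall>\<^sub>F y in nhds p. y \<in> S" using Sf(1) p(1) by (rule eventually_nhds_in_open)
    show "\<forall>\<^sub>F y in nhds p. norm (schouten f y - M0) < \<epsilon>"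
      using tendstoD[OF lim[OF continuous_on_schouten[OF Sf(2)]] \<epsilon>] by (simp add: M0_def dist_norm)
    show "\<forall>\<^sub>F y in nhds p. norm (schouten g y - M0) < \<epsilon>"
      using tendstoD[OF lim[OF continuous_on_schouten[OF Sg(2)]] \<epsilon>] contact
      by (simp add: M0_def dist_norm)
    show "\<forall>\<^sub>F y in nhds p. g y > m"
      by (rule order_tendstoD(1)[OF lim[OF cg(1)]]) (use m in \<open>simp add: m_def\<close>)
    show "\<forall>\<^sub>F y in nhds p. norm (hessian f y) < K2"
      by (rule order_tendstoD(2)[OF tendsto_norm[OF lim[OF cf(3)]]]) (simp add: K2_def)
    show "\<forall>\<^sub>F y in nhds p. norm (grad g y + grad f y) < K3"
      by (rule order_tendstoD(2)[OF tendsto_norm[OF tendsto_add[OF lim[OF cg(2)] lim[OF cf(2)]]]])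
         (simp add: K3_def)
  qed
  then obtain \<eta>1 where \<eta>1: "\<eta>1 > 0" and near: "\<And>y. dist y p < \<eta>1 \<Longrightarrow> y \<in> S
     \<and> norm (schouten f y - M0) < \<epsilon> \<and> norm (schouten g y - M0) < \<epsilon>
     \<and> g y > m \<and> norm (hessian f y) < K2 \<and> norm (grad g y + grad f y) < K3"
    unfolding eventually_nhds_metric by blast
  \<comment> \<open>A smaller ball that touches at \<open>p\<close> only, within the neighbourhood where the coefficients are controlled.\<close>
  define s where "s = min (1/2) (\<eta>1 / (4 * \<rho>))"
  have s: "0 < s" "s < 1" "4 * s * \<rho> \<le> \<eta>1"
    using \<eta>1 \<rho> by (auto simp: s_def min_def field_simps)
  define n where "n = z - p"
  have nn: "n \<bullet> n = \<rho>\<^sup>2" using p(2) by (simp add: n_def norm_minus_commute flip: power2_norm_eq_inner)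
  define z' where "z' = p + s *\<^sub>R n"
  define R where "R = s * \<rho>"
  have R: "R > 0" using s \<rho> by (simp add: R_def)
  have "norm n = \<rho>" using p(2) by (simp add: n_def norm_minus_commute)
  then have pz': "norm (p - z') = R" using s by (simp add: z'_def R_def)
  have inner_ball: "f y < g y" if y: "norm (y - z') \<le> R" "y \<noteq> p" for y
  proof (rule less)
    define w where "w = y - p"
    have w: "w \<bullet> w > 0" using y by (simp add: w_def)
    have "(norm (y - z'))\<^sup>2 \<le> R\<^sup>2" using y(1) by (intro power_mono) auto
    also have "(norm (y - z'))\<^sup>2 = w \<bullet> w - 2 * s * (w \<bullet> n) + s\<^sup>2 * (n \<bullet> n)"
    proof -
      have "y - z' = w - s *\<^sub>R n" by (simp add: z'_def w_def)
      then show ?thesis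
        by (simp add: power2_norm_eq_inner inner_diff_left inner_diff_right inner_commute[of n w])
          (simp add: power2_eq_square algebra_simps)
    qed
    finally have "w \<bullet> w \<le> s * (2 * (w \<bullet> n))" by (simp add: R_def nn power_mult_distrib)
    moreover have "s * (w \<bullet> w) < 1 * (w \<bullet> w)" using s w by (intro mult_strict_right_mono) auto
    ultimately have "s * (w \<bullet> w) < s * (2 * (w \<bullet> n))" by simp
    then have "w \<bullet> w < 2 * (w \<bullet> n)" using s by simp
    moreover have "(norm (y - z))\<^sup>2 = w \<bullet> w - 2 * (w \<bullet> n) + n \<bullet> n"
    proof -
      have "y - z = w - n" by (simp add: n_def w_def)
      then show ?thesis
        by (simp add: power2_norm_eq_inner inner_diff_left inner_diff_right inner_commute[of n w])
    qed
    ultimately have "(norm (y - z))\<^sup>2 < \<rho>\<^sup>2" by (simp add: nn)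
    then have "norm (y - z) < \<rho>" using \<rho> by (simp add: power2_less_imp_less)
    then show "y \<in> ball z \<rho>" by (simp add: dist_norm norm_minus_commute)
  qed
  have W0: "g y - f y \<ge> 0" if "norm (y - z') \<le> R" for y
    using inner_ball[OF that] eq by (cases "y = p") auto
  have nearR: "dist y p < \<eta>1" if "norm (y - z') \<le> R" for y
  proof -
    have "dist y p \<le> norm (y - z') + norm (p - z')"
      using dist_triangle2[of y p z'] by (simp add: dist_norm)
    also have "\<dots> \<le> 2 * R" using that pz' by simp
    also have "\<dots> < \<eta>1" using s R by (simp add: R_def)
    finally show ?thesis .
  qed
  define T where "T = max 0 C * norm (mat 1 :: real ^ 'n ^ 'n)"
  \<comment> \<open>\<open>k\<close> makes the good term of the barrier exceed the zeroth order, first order and trace terms.\<close>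
  define k where "k = max 1 ((4 * T + (max 0 C * K2 + 2 * K3 * R * T + 1) / m) / (2 * c * R\<^sup>2))"
  have k: "k \<ge> 1" "m * (2 * k * c * R\<^sup>2 - 4 * T) \<ge> max 0 C * K2 + 2 * K3 * R * T + 1"
  proof -
    show "k \<ge> 1" by (simp add: k_def)
    have cR: "2 * c * R\<^sup>2 > 0" using c R by simp
    have "(4 * T + (max 0 C * K2 + 2 * K3 * R * T + 1) / m) / (2 * c * R\<^sup>2) \<le> k"
      by (simp add: k_def)
    then have "4 * T + (max 0 C * K2 + 2 * K3 * R * T + 1) / m \<le> k * (2 * c * R\<^sup>2)"
      using cR by (simp add: pos_divide_le_eq)
    then have "(max 0 C * K2 + 2 * K3 * R * T + 1) / m \<le> 2 * k * c * R\<^sup>2 - 4 * T"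
      by (simp add: mult_ac)
    then show "m * (2 * k * c * R\<^sup>2 - 4 * T) \<ge> max 0 C * K2 + 2 * K3 * R * T + 1"
      using m by (simp add: pos_divide_le_eq mult.commute)
  qed
  \<comment> \<open>In \<open>cball p \<eta>\<close> one has \<open>|y - z'| \<ge> R/2\<close> and \<open>2 k \<sigma> \<le> 1\<close>.\<close>
  define \<eta> where "\<eta> = min (R / 2) (1 / (4 * k * R))"
  have \<eta>: "\<eta> > 0" "\<eta> \<le> R / 2" "4 * k * R * \<eta> \<le> 1"
    using R k by (auto simp: \<eta>_def min_def field_simps)
  define \<sigma> where "\<sigma> = (\<lambda>y. R\<^sup>2 - (y - z') \<bullet> (y - z'))"
  define h where "h = (\<lambda>y. \<sigma> y + k * (\<sigma> y)\<^sup>2)"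
  define dh where "dh = (\<lambda>y. (- (1 + 2 * k * \<sigma> y)) *\<^sub>R (2 *\<^sub>R (y - z')))"
  define Hh where "Hh = (\<lambda>y. (- (1 + 2 * k * \<sigma> y)) *\<^sub>R (2 *\<^sub>R mat 1)
         + (2 * k) *\<^sub>R outer (2 *\<^sub>R (y - z')) (2 *\<^sub>R (y - z')))"
  have jet_h: "has_jet h dh Hh S"
    unfolding h_def dh_def Hh_def \<sigma>_def by (rule has_jet_barrier)
  define \<Omega> where "\<Omega> = cball z' R \<inter> cball p \<eta>"
  have \<Omega>: "norm (y - z') \<le> R" "R / 2 \<le> norm (y - z')" "0 \<le> \<sigma> y" "2 * k * \<sigma> y \<le> 1" "h y \<le> 1"
    if "y \<in> \<Omega>" for y
  proof -
    show 1: "norm (y - z') \<le> R" using that by (simp add: \<Omega>_def dist_norm norm_minus_commute)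
    have yp: "norm (y - p) \<le> \<eta>" using that by (simp add: \<Omega>_def dist_norm norm_minus_commute)
    have 2: "R - \<eta> \<le> norm (y - z')"
      using norm_triangle_ineq4[of "y - z'" "y - p"] pz' yp by (simp add: norm_minus_commute)
    then show "R / 2 \<le> norm (y - z')" using \<eta> by simp
    have sg: "\<sigma> y = R\<^sup>2 - (norm (y - z'))\<^sup>2" by (simp add: \<sigma>_def power2_norm_eq_inner)
    show 3: "0 \<le> \<sigma> y" unfolding sg using 1 by (simp add: power_mono)
    have "(R - \<eta>)\<^sup>2 \<le> (norm (y - z'))\<^sup>2" using 2 \<eta> R by (intro power_mono) auto
    then have "\<sigma> y \<le> R\<^sup>2 - (R - \<eta>)\<^sup>2" unfolding sg by simp
    also have "\<dots> \<le> 2 * R * \<eta>" by (simp add: power2_eq_square algebra_simps)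
    finally have "2 * k * \<sigma> y \<le> 2 * k * (2 * R * \<eta>)" using k by (intro mult_left_mono) auto
    then show 4: "2 * k * \<sigma> y \<le> 1" using \<eta> by (simp add: mult_ac)
    have "2 * \<sigma> y \<le> 2 * k * \<sigma> y" using k 3 by (simp add: mult_right_mono)
    then have 5: "2 * \<sigma> y \<le> 1" using 4 by simp
    have "k * (\<sigma> y)\<^sup>2 = (k * \<sigma> y) * \<sigma> y" by (simp add: power2_eq_square)
    also have "\<dots> \<le> (1/2) * (1/2)" using 3 4 5 k by (intro mult_mono) auto
    finally show "h y \<le> 1" using 5 by (simp add: h_def)
  qed
  have compact_part: "compact (cball z' R \<inter> sphere p \<eta>)" by (intro compact_Int_closed) auto
  have cW: "continuous_on (cball z' R) (\<lambda>y. g y - f y)"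
  proof -
    have "cball z' R \<subseteq> S" using near nearR by (auto simp: dist_norm norm_minus_commute)
    then show ?thesis
      using continuous_on_subset cf(1) cg(1) by (intro continuous_on_diff) blast+
  qed
  obtain \<delta> where \<delta>: "\<delta> > 0" and W\<delta>: "\<And>y. y \<in> cball z' R \<inter> sphere p \<eta> \<Longrightarrow> g y - f y \<ge> \<delta>"
  proof (cases "cball z' R \<inter> sphere p \<eta> = {}")
    case True then show ?thesis using that[of 1] by auto
  next
    case False
    obtain y0 where y0: "y0 \<in> cball z' R \<inter> sphere p \<eta>"
      and min: "\<forall>y \<in> cball z' R \<inter> sphere p \<eta>. g y0 - f y0 \<le> g y - f y"
      using continuous_attains_inf[OF compact_part False continuous_on_subset[OF cW]] by blast
    show ?thesis
    proof (rule that)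
      have "y0 \<noteq> p" using y0 \<eta> by auto
      then show "g y0 - f y0 > 0" using inner_ball[of y0] y0 by (simp add: dist_norm norm_minus_commute)
    qed (use min in auto)
  qed
  define e where "e = \<delta> / 2"
  have e: "e > 0" "e < \<delta>" using \<delta> by (auto simp: e_def)
  \<comment> \<open>\<open>V \<ge> 0\<close> near \<open>p\<close> is the comparison of \<open>g - f\<close> with the barrier \<open>e h\<close>.\<close>
  define V where "V = (\<lambda>y. 1 * (g y - f y) + (- e) * h y)"
  define dV where "dV = (\<lambda>y. 1 *\<^sub>R (grad g y - grad f y) + (- e) *\<^sub>R dh y)"
  define HV where "HV = (\<lambda>y. 1 *\<^sub>R (hessian g y - hessian f y) + (- e) *\<^sub>R Hh y)"
  have jet_V: "has_jet V dV HV S"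
    unfolding V_def dV_def HV_def by (rule has_jet_lincomb[OF has_jet_difference[OF f g] jet_h])
  have V_nonneg: "V y \<ge> 0" if "y \<in> \<Omega>" for y
  proof (rule ccontr)
    assume neg: "\<not> V y \<ge> 0"
    have comp: "compact \<Omega>" unfolding \<Omega>_def by (intro compact_Int_closed) auto
    have sub: "\<Omega> \<subseteq> S" using near nearR \<Omega>(1) by blast
    obtain q where q: "q \<in> \<Omega>" and qmin: "\<forall>y\<in>\<Omega>. V q \<le> V y"
      using continuous_attains_inf[OF comp _ continuous_on_subset[OF has_jet_continuous_on(1)[OF jet_V] sub]]
        \<open>y \<in> \<Omega>\<close> by blast
    have Vq: "V q < 0" using qmin \<open>y \<in> \<Omega>\<close> neg by force
    have qS: "q \<in> S" using q sub by blast
    have 1: "norm (q - z') < R"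
    proof (rule ccontr)
      assume "\<not> ?thesis"
      then have "norm (q - z') = R" using \<Omega>(1)[OF q] by simp
      then have "\<sigma> q = 0" by (simp add: \<sigma>_def flip: power2_norm_eq_inner)
      then show False using Vq W0[OF \<Omega>(1)[OF q]] by (simp add: V_def h_def)
    qed
    have 2: "dist p q < \<eta>"
    proof (rule ccontr)
      assume "\<not> ?thesis"
      then have "q \<in> cball z' R \<inter> sphere p \<eta>" using q by (auto simp: \<Omega>_def)
      from W\<delta>[OF this] have "g q - f q \<ge> \<delta>" .
      moreover have "e * h q \<le> e * 1" using \<Omega>(5)[OF q] e by (intro mult_left_mono) auto
      moreover have "g q - f q < e * h q" using Vq by (simp add: V_def)
      ultimately show False using e by linarith
    qed
    let ?O = "ball z' R \<inter> ball p \<eta>"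
    have O\<Omega>: "?O \<subseteq> \<Omega>" by (auto simp: \<Omega>_def)
    have jO: "has_jet V dV HV ?O" by (rule has_jet_subset[OF jet_V]) (use O\<Omega> sub in blast)
    have qO: "q \<in> ?O" using 1 2 by (simp add: dist_norm norm_minus_commute)
    note lm = local_min_jet[of ?O V dV HV q, OF _ jO qO]
    have crit: "grad g q - grad f q = e *\<^sub>R dh q"
    proof -
      have "dV q = 0" by (rule lm(1)) (use qmin O\<Omega> in auto)
      then show ?thesis by (simp add: dV_def)
    qed
    have hess: "v \<bullet> (HV q *v v) \<ge> 0" for v by (rule lm(2)) (use qmin O\<Omega> in auto)
    note nq = near[OF nearR[OF \<Omega>(1)[OF q]]]
    obtain G where G: "norm G \<le> C" "\<And>v. v \<bullet> (G *v v) \<ge> c * (v \<bullet> v)"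
      "G \<bullet> (schouten g q - schouten f q) = 0"
      using lin Sf(5)[OF qS] Sg(5)[OF qS] nq by blast
    have C0: "max 0 C = C" using norm_ge_zero[of G] G(1) by linarith
    have trG: "\<bar>G \<bullet> mat 1\<bar> \<le> T"
      unfolding T_def C0 using Cauchy_Schwarz_ineq2[of G "mat 1"] G(1)
      by (meson mult_right_mono norm_ge_zero order_trans)
    have T0: "T \<ge> 0" using trG by linarith
    have "Hh q \<in> sym_mats"
      unfolding Hh_def by (intro subspace_add[OF subspace_sym_mats] subspace_scale[OF subspace_sym_mats]
          mat_1_in_sym_mats outer_in_sym_mats)
    then have "HV q \<in> sym_mats"
      unfolding HV_def using hessian_sym f g qS
      by (intro subspace_add[OF subspace_sym_mats] subspace_diff[OF subspace_sym_mats]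
          subspace_scale[OF subspace_sym_mats]) auto
    moreover have "v \<bullet> (G *v v) \<ge> 0" for v
    proof -
      have "0 \<le> c * (v \<bullet> v)" using c by simp
      also have "\<dots> \<le> v \<bullet> (G *v v)" by (rule G(2))
      finally show ?thesis .
    qed
    ultimately have "G \<bullet> HV q \<ge> 0" using hess by (intro psd_inner_psd_nonneg)
    then have GK: "G \<bullet> (hessian g q - hessian f q) \<ge> e * (G \<bullet> Hh q)"
      by (simp add: HV_def inner_add_right inner_diff_right)
    have GH: "G \<bullet> Hh q \<ge> 2 * k * c * R\<^sup>2 - 4 * T"
    proof -
      have a: "(1 + 2 * k * \<sigma> q) * (2 * (G \<bullet> mat 1)) \<le> 2 * (2 * T)"
      proof -
        have "(1 + 2 * k * \<sigma> q) * (2 * (G \<bullet> mat 1)) \<le> (1 + 2 * k * \<sigma> q) * (2 * T)"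
          using \<Omega>(3)[OF q] trG k by (intro mult_left_mono) auto
        also have "\<dots> \<le> 2 * (2 * T)" using \<Omega>(4)[OF q] T0 by (intro mult_right_mono) auto
        finally show ?thesis .
      qed
      have "(R / 2)\<^sup>2 \<le> (norm (q - z'))\<^sup>2" using \<Omega>(2)[OF q] R by (intro power_mono) auto
      then have "R\<^sup>2 \<le> 4 * ((q - z') \<bullet> (q - z'))"
        by (simp add: power2_norm_eq_inner power_divide)
      then have "c * R\<^sup>2 \<le> c * (4 * ((q - z') \<bullet> (q - z')))" using c by simp
      also have "\<dots> = c * ((2 *\<^sub>R (q - z')) \<bullet> (2 *\<^sub>R (q - z')))" by simp
      also have "\<dots> \<le> G \<bullet> outer (2 *\<^sub>R (q - z')) (2 *\<^sub>R (q - z'))"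
        unfolding quadratic_form_inner[symmetric] by (rule G(2))
      finally have "2 * k * (c * R\<^sup>2) \<le> 2 * k * (G \<bullet> outer (2 *\<^sub>R (q - z')) (2 *\<^sub>R (q - z')))"
        using k by (intro mult_left_mono) auto
      then show ?thesis
        using a by (simp add: Hh_def inner_add_right algebra_simps)
    qed
    have Wq: "0 \<le> g q - f q" "g q - f q \<le> e"
    proof -
      show "0 \<le> g q - f q" by (rule W0[OF \<Omega>(1)[OF q]])
      have "g q - f q \<le> e * h q" using Vq by (simp add: V_def)
      also have "\<dots> \<le> e * 1" using \<Omega>(5)[OF q] e by (intro mult_left_mono) auto
      finally show "g q - f q \<le> e" by simp
    qed
    have t2: "(g q - f q) * (G \<bullet> hessian f q) \<ge> - (e * (C * K2))"
    proof -
      have "\<bar>G \<bullet> hessian f q\<bar> \<le> C * K2"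
      proof -
        have "norm G * norm (hessian f q) \<le> C * K2"
          using nq C0 G(1) by (intro mult_mono) auto
        then show ?thesis using Cauchy_Schwarz_ineq2[of G "hessian f q"] by linarith
      qed
      then have "(g q - f q) * \<bar>G \<bullet> hessian f q\<bar> \<le> e * (C * K2)"
        using Wq e by (intro mult_mono) auto
      then show ?thesis using Wq(1) abs_ge_minus_self[of "G \<bullet> hessian f q"]
        by (smt (verit) mult_left_mono mult_minus_right)
    qed
    have t3: "((grad g q + grad f q) \<bullet> (e *\<^sub>R dh q)) / 2 * (G \<bullet> mat 1) \<le> e * (2 * K3 * R * T)"
    proof -
      have "norm (dh q) = (1 + 2 * k * \<sigma> q) * (2 * norm (q - z'))"
      proof -
        have "0 \<le> 2 * k * \<sigma> q" using \<Omega>(3)[OF q] k by simp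
        then have "\<bar>- (1 + 2 * k * \<sigma> q)\<bar> = 1 + 2 * k * \<sigma> q" by linarith
        then show ?thesis unfolding dh_def by simp
      qed
      also have "\<dots> \<le> 2 * (2 * R)"
        using \<Omega>(1,3,4)[OF q] k by (intro mult_mono) auto
      finally have ndh: "norm (dh q) \<le> 4 * R" by simp
      have "\<bar>(grad g q + grad f q) \<bullet> dh q\<bar> \<le> K3 * (4 * R)"
        using Cauchy_Schwarz_ineq2[of "grad g q + grad f q" "dh q"]
          mult_mono[of "norm (grad g q + grad f q)" K3 "norm (dh q)" "4 * R"] nq ndh norm_ge_zero
        by (smt (verit) norm_ge_zero)
      then have "\<bar>(grad g q + grad f q) \<bullet> dh q\<bar> * \<bar>G \<bullet> mat 1\<bar> \<le> (K3 * (4 * R)) * T"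
        using trG T0 by (intro mult_mono) auto
      then have "((grad g q + grad f q) \<bullet> dh q) * (G \<bullet> mat 1) \<le> 4 * K3 * R * T"
        using abs_ge_self[of "((grad g q + grad f q) \<bullet> dh q) * (G \<bullet> mat 1)"]
        by (simp add: abs_mult)
      then have "e * (((grad g q + grad f q) \<bullet> dh q) * (G \<bullet> mat 1)) \<le> e * (4 * K3 * R * T)"
        using e by (intro mult_left_mono) auto
      then show ?thesis by (simp add: mult_ac)
    qed
    have "0 = g q * (G \<bullet> (hessian g q - hessian f q)) + (g q - f q) * (G \<bullet> hessian f q)
       - ((grad g q + grad f q) \<bullet> (e *\<^sub>R dh q)) / 2 * (G \<bullet> mat 1)"
      using G(3) unfolding schouten_difference crit by (simp add: inner_diff_right inner_add_right)
    moreover have "g q * (G \<bullet> (hessian g q - hessian f q)) \<ge> e * (C * K2 + 2 * K3 * R * T + 1)"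
    proof -
      have K23: "K2 \<ge> 0" "K3 \<ge> 0" by (auto simp: K2_def K3_def)
      have low: "2 * k * c * R\<^sup>2 - 4 * T \<ge> 0"
      proof -
        have "m * (2 * k * c * R\<^sup>2 - 4 * T) > 0"
          using k(2) K23 T0 R by (smt (verit) max.cobounded1 mult_nonneg_nonneg)
        then show ?thesis using m by (simp add: zero_less_mult_iff)
      qed
      have "e * (C * K2 + 2 * K3 * R * T + 1) \<le> e * (m * (2 * k * c * R\<^sup>2 - 4 * T))"
        using k(2) e unfolding C0 by (intro mult_left_mono) auto
      also have "\<dots> \<le> e * (g q * (G \<bullet> Hh q))"
        using low GH nq e m by (intro mult_left_mono mult_mono) auto
      also have "\<dots> = g q * (e * (G \<bullet> Hh q))" by simp
      also have "\<dots> \<le> g q * (G \<bullet> (hessian g q - hessian f q))"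
        using GK Sg(4)[OF qS] by (intro mult_left_mono) auto
      finally show ?thesis .
    qed
    ultimately have "e * (C * K2 + 2 * K3 * R * T + 1) \<le> e * (C * K2) + e * (2 * K3 * R * T)"
      using t2 t3 by linarith
    then show False using e by (simp add: distrib_left)
  qed
  have Vp: "V p = 0"
    using pz' eq by (simp add: V_def h_def \<sigma>_def flip: power2_norm_eq_inner)
  have sgp: "\<sigma> p = 0" using pz' by (simp add: \<sigma>_def flip: power2_norm_eq_inner)
  have "dV p \<bullet> (z' - p) \<ge> 0"
  proof (rule ray_first_order[OF jet_V p(1)])
    show "min 1 (\<eta> / R) > 0" using \<eta> R by simp
    fix t assume t: "0 < t" "t < min 1 (\<eta> / R)"
    have "p + t *\<^sub>R (z' - p) - z' = (1 - t) *\<^sub>R (p - z')" by (simp add: algebra_simps)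
    then have "norm (p + t *\<^sub>R (z' - p) - z') = (1 - t) * R" using t pz' by simp
    also have "\<dots> \<le> R" using t R by simp
    finally have "p + t *\<^sub>R (z' - p) \<in> cball z' R" by (simp add: dist_norm norm_minus_commute)
    moreover have "t * R \<le> \<eta>" using t R by (simp add: pos_less_divide_eq)
    then have "p + t *\<^sub>R (z' - p) \<in> cball p \<eta>"
      using t pz' by (simp add: dist_norm norm_minus_commute)
    ultimately show "V p \<le> V (p + t *\<^sub>R (z' - p))" unfolding Vp by (intro V_nonneg) (simp add: \<Omega>_def)
  qed
  moreover have "dV p \<bullet> (z' - p) = - (2 * e * R\<^sup>2)"
  proof -
    have "dV p = (- (2 * e)) *\<^sub>R (z' - p)"
      using contact(1) by (simp add: dV_def dh_def sgp algebra_simps)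
    then have "dV p \<bullet> (z' - p) = - (2 * e) * ((z' - p) \<bullet> (z' - p))" by simp
    also have "(z' - p) \<bullet> (z' - p) = R\<^sup>2" using pz' by (simp add: norm_minus_commute flip: power2_norm_eq_inner)
    finally show ?thesis by simp
  qed
  moreover have "2 * e * R\<^sup>2 > 0" using e R by simp
  ultimately show False by linarith
qed

text \<open>
  If the contact set were not open, a largest ball in its complement would touch it at a point where
  Hopf's lemma contradicts that \<open>g - f\<close> has a minimum.
\<close>

lemma strong_maximum_principle:
  assumes f: "solution S f" and g: "solution S g" and S: "connected S"
    and le: "\<And>x. x \<in> S \<Longrightarrow> f x \<le> g x" and x: "x \<in> S" "f x = g x" and y: "y \<in> S"
  shows "f y = g y"
proof -
  note Sf = solutionD[OF f] and Sg = solutionD[OF g]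
  define T where "T = {x \<in> S. g x - f x = 0}"
  have cont: "continuous_on S (\<lambda>x. g x - f x)"
    using has_jet_continuous_on(1)[OF has_jet_difference[OF f g]] .
  have closed: "closedin (top_of_set S) T"
    unfolding T_def using continuous_closedin_preimage_constant[OF cont, of 0] by simp
  have "open T"
  proof (rule openI)
    fix x assume x: "x \<in> T"
    then have "x \<in> S" by (simp add: T_def)
    then obtain r where r: "r > 0" "cball x r \<subseteq> S" using Sf(1) open_contains_cball by blast
    have "ball x (r / 2) \<subseteq> T"
    proof
      fix q assume q: "q \<in> ball x (r / 2)"
      show "q \<in> T"
      proof (rule ccontr)
        assume qT: "q \<notin> T"
        have "closed (T \<inter> cball x r)"
        proof -
          have "closed ({y \<in> cball x r. g y - f y = 0})"
            using continuous_closed_preimage_constant[OF continuous_on_subset[OF cont r(2)] closed_cball, of 0] .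
          moreover have "{y \<in> cball x r. g y - f y = 0} = T \<inter> cball x r" using r(2) by (auto simp: T_def)
          ultimately show ?thesis by simp
        qed
        moreover have "T \<inter> cball x r \<noteq> {}" using x r by auto
        ultimately obtain p where p: "p \<in> T \<inter> cball x r"
          and pmin: "\<forall>y \<in> T \<inter> cball x r. dist q p \<le> dist q y"
          using distance_attains_inf by metis
        have pS: "p \<in> S" and pe: "f p = g p" using p by (auto simp: T_def)
        let ?d = "norm (p - q)"
        have d: "?d > 0" using p qT by auto
        have dx: "dist q p \<le> dist q x" using pmin x r by auto
        have qx: "dist q x < r / 2" using q by (simp add: dist_commute)
        have ball_sub: "ball q ?d \<subseteq> cball x r"
        proof
          fix y assume "y \<in> ball q ?d"
          then have "dist q y < dist q p" by (simp add: dist_norm norm_minus_commute)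
          then have "dist x y < r" using dist_triangle[of x y q] dx qx by (simp add: dist_commute)
          then show "y \<in> cball x r" by simp
        qed
        have "(grad g p - grad f p) \<bullet> (q - p) > 0"
        proof (rule hopf_boundary_point[OF f g _ pS refl d _ pe])
          show "ball q ?d \<subseteq> S" using ball_sub r(2) by blast
          fix y assume y: "y \<in> ball q ?d"
          then have "dist q y < dist q p" by (simp add: dist_norm norm_minus_commute)
          then have "y \<notin> T" using pmin y ball_sub by force
          moreover have "y \<in> S" using y ball_sub r(2) by blast
          ultimately show "f y < g y" using le[of y] by (auto simp: T_def)
        qed
        moreover have "grad g p - grad f p = 0"
          by (rule local_min_jet(1)[OF Sf(1) has_jet_difference[OF f g] pS]) (use le pe in auto)
        ultimately show False by simp
      qed
    qed
    then show "\<exists>e>0. ball x e \<subseteq> T" using r(1) by (intro exI[of _ "r / 2"]) auto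
  qed
  then have "openin (top_of_set S) T"
    by (metis (no_types, lifting) T_def mem_Collect_eq open_subset subsetI)
  with closed S have "T = {} \<or> T = S" unfolding connected_clopen by blast
  moreover have "x \<in> T" using x by (simp add: T_def)
  ultimately have "y \<in> T" using y by blast
  then show ?thesis by (simp add: T_def)
qed

end

section \<open>Subharmonicity near a puncture\<close>

lemma trace_outer: "trace (outer v w) = v \<bullet> w"
  by (simp add: trace_def outer_def inner_vec_def)

lemma trace_lincomb: "trace (a *\<^sub>R M + b *\<^sub>R N) = a * trace M + b * trace (N :: real ^ 'n ^ 'n)"
  by (simp add: inner_add_right flip: mat_1_inner)

lemma trace_scaleR: "trace (a *\<^sub>R M) = a * trace (M :: real ^ 'n ^ 'n)"
  by (simp flip: mat_1_inner)

lemma trace_psd_nonneg: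
  fixes M :: "real ^ 'n ^ 'n"
  assumes "\<And>v. v \<bullet> (M *v v) \<ge> 0"
  shows "trace M \<ge> 0"
  unfolding trace_def by (intro sum_nonneg) (metis assms axis_inner_mult_axis)

text \<open>
  A superharmonic function that is bounded below does not notice a puncture. The function \<open>|x|\<^sup>-\<^sup>1\<^sup>/\<^sup>2\<close> is
  strictly superharmonic for \<open>n \<ge> 3\<close> and infinite at the puncture; a small multiple of it is added, which
  keeps the minimum away from the puncture and makes an interior minimum impossible.
\<close>

lemma punctured_minimum_principle:
  fixes w :: "real ^ 'n \<Rightarrow> real"
  assumes dim: "CARD('n) \<ge> 3" and jet: "has_jet w p H (ball 0 R - {0})" and r: "0 < r" "r < R"
    and superharmonic: "\<And>x. x \<noteq> 0 \<Longrightarrow> norm x < R \<Longrightarrow> trace (H x) \<le> 0"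
    and bdd: "\<And>x. x \<noteq> 0 \<Longrightarrow> norm x \<le> r \<Longrightarrow> w x \<ge> - M"
    and bdry: "\<And>x. norm x = r \<Longrightarrow> w x \<ge> 0"
    and y: "y \<noteq> 0" "norm y \<le> r"
  shows "w y \<ge> 0"
proof (rule ccontr)
  assume neg: "\<not> w y \<ge> 0"
  define M' where "M' = max M 0 + 1"
  have M': "M' > 0" "- M > - M'" by (auto simp: M'_def)
  define \<Phi> where "\<Phi> = (\<lambda>x :: real ^ 'n. ((x - 0) \<bullet> (x - 0)) powr (- 1/4))"
  have \<Phi>pos: "\<Phi> x > 0" if "x \<noteq> 0" for x using that by (simp add: \<Phi>_def)
  define \<delta> where "\<delta> = - w y / (2 * \<Phi> y)"
  have \<delta>: "\<delta> > 0" using neg \<Phi>pos[OF y(1)] by (simp add: \<delta>_def divide_neg_pos)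
  \<comment> \<open>On the sphere \<open>|x| = \<rho>\<close> the singular term \<open>\<delta> \<Phi>\<close> outweighs the lower bound \<open>- M\<close> of \<open>w\<close>.\<close>
  define L where "L = M' / \<delta>"
  have L: "L > 0" using M' \<delta> by (simp add: L_def)
  define \<rho> where "\<rho> = min (norm y) (sqrt (L powr (- 4)))"
  have \<rho>: "\<rho> > 0" "\<rho> \<le> norm y" using y L by (auto simp: \<rho>_def)
  have big: "\<delta> * \<Phi> x \<ge> M'" if x: "norm x = \<rho>" for x
  proof -
    have "norm x \<le> sqrt (L powr (- 4))" using x by (simp add: \<rho>_def)
    then have "(norm x)\<^sup>2 \<le> L powr (- 4)"
      using power_mono[of "norm x" "sqrt (L powr (- 4))" 2] by simp
    then have "x \<bullet> x \<le> L powr (- 4)" by (simp add: power2_norm_eq_inner)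
    moreover have "x \<bullet> x > 0" using x \<rho> by auto
    ultimately have "(L powr (- 4)) powr (- 1/4) \<le> (x \<bullet> x) powr (- 1/4)"
      by (intro powr_mono2') auto
    then have "L \<le> \<Phi> x" using L by (simp add: \<Phi>_def powr_powr)
    then show ?thesis using \<delta> by (simp add: L_def pos_divide_le_eq mult.commute)
  qed
  define S where "S = ball (0 :: real ^ 'n) R - {0}"
  let ?q = "\<lambda>x :: real ^ 'n. (x - 0) \<bullet> (x - 0)"
  define d\<Phi> where "d\<Phi> = (\<lambda>x :: real ^ 'n. ((- 1/4) * ?q x powr (- 1/4 - 1)) *\<^sub>R (2 *\<^sub>R (x - 0)))"
  define H\<Phi> where "H\<Phi> = (\<lambda>x :: real ^ 'n. ((- 1/4) * ?q x powr (- 1/4 - 1)) *\<^sub>R (2 *\<^sub>R mat 1)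
     + ((- 1/4) * ((- 1/4 - 1) * ?q x powr (- 1/4 - 2))) *\<^sub>R outer (2 *\<^sub>R (x - 0)) (2 *\<^sub>R (x - 0)))"
  have jet\<Phi>: "has_jet \<Phi> d\<Phi> H\<Phi> S"
    unfolding \<Phi>_def d\<Phi>_def H\<Phi>_def
    by (rule has_jet_powr[OF has_jet_dist_sq]) (simp add: S_def)
  have tr\<Phi>: "trace (H\<Phi> x) < 0" if "x \<noteq> 0" for x
  proof -
    define q where "q = x \<bullet> x"
    have q: "q > 0" using that by (simp add: q_def)
    have e: "q powr (- 1/4 - 2) * q = q powr (- 1/4 - 1)"
      using q powr_add[of q "- 1/4 - 2" 1] by simp
    have "trace (H\<Phi> x) = (- 1/4) * q powr (- 1/4 - 1) * (2 * real CARD('n))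
        + (- 1/4) * (- 1/4 - 1) * 4 * (q powr (- 1/4 - 2) * q)"
      unfolding H\<Phi>_def trace_lincomb trace_scaleR trace_I trace_outer by (simp add: q_def)
    also have "\<dots> = - (1/2) * q powr (- 1/4 - 1) * (real CARD('n) - 5/2)"
      unfolding e by (simp add: algebra_simps diff_divide_distrib)
    also have "\<dots> < 0" using q dim by (simp add: mult_pos_pos)
    finally show ?thesis .
  qed
  define V where "V = (\<lambda>x. 1 * w x + \<delta> * \<Phi> x)"
  have jetV: "has_jet V (\<lambda>x. 1 *\<^sub>R p x + \<delta> *\<^sub>R d\<Phi> x) (\<lambda>x. 1 *\<^sub>R H x + \<delta> *\<^sub>R H\<Phi> x) S"
    unfolding V_def by (rule has_jet_lincomb[OF jet[folded S_def] jet\<Phi>])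
  define A where "A = cball 0 r - ball (0 :: real ^ 'n) \<rho>"
  have A: "compact A" unfolding A_def by (intro compact_diff) auto
  have AS: "A \<subseteq> S" using r \<rho> by (auto simp: A_def S_def)
  have yA: "y \<in> A" using y \<rho> by (auto simp: A_def)
  obtain q where q: "q \<in> A" and qmin: "\<forall>x\<in>A. V q \<le> V x"
    using continuous_attains_inf[OF A _ continuous_on_subset[OF has_jet_continuous_on(1)[OF jetV] AS]] yA
    by blast
  have "V y < 0" using neg \<Phi>pos[OF y(1)] by (simp add: V_def \<delta>_def)
  then have Vq: "V q < 0" using qmin yA by force
  have q0: "q \<noteq> 0" using q \<rho> by (auto simp: A_def)
  have "norm q \<noteq> r"
  proof
    assume "norm q = r"
    from bdry[OF this] have "V q > 0" using \<delta> \<Phi>pos[OF q0] by (simp add: V_def add_nonneg_pos)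
    then show False using Vq by simp
  qed
  moreover have "norm q \<noteq> \<rho>"
  proof
    assume "norm q = \<rho>"
    from big[OF this] bdd[OF q0] Vq q M' show False by (simp add: V_def A_def)
  qed
  ultimately have qO: "q \<in> ball 0 r - cball 0 \<rho>" using q by (auto simp: A_def)
  have "v \<bullet> ((1 *\<^sub>R H q + \<delta> *\<^sub>R H\<Phi> q) *v v) \<ge> 0" for v
  proof (rule local_min_jet(2)[OF _ has_jet_subset[OF jetV] qO])
    show "open (ball 0 r - cball (0 :: real ^ 'n) \<rho>)" by (intro open_Diff) auto
    show "ball 0 r - cball 0 \<rho> \<subseteq> S" using r \<rho> by (auto simp: S_def)
    show "V q \<le> V y" if "y \<in> ball 0 r - cball 0 \<rho>" for y using qmin that by (auto simp: A_def)
  qed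
  then have "trace (1 *\<^sub>R H q + \<delta> *\<^sub>R H\<Phi> q) \<ge> 0" by (rule trace_psd_nonneg)
  moreover have "trace (H q) \<le> 0" using superharmonic[OF q0] AS q by (auto simp: S_def)
  moreover have "\<delta> * trace (H\<Phi> q) < 0" using tr\<Phi>[OF q0] \<delta> by (simp add: mult_pos_neg)
  ultimately show False unfolding trace_lincomb by simp
qed

context elliptic_level_set
begin

text \<open>
  The trace condition reads \<open>f \<Delta>f \<ge> n/2 |\<nabla>f|\<^sup>2\<close>. So \<open>f\<close> is subharmonic; the stronger
  first inequality says that \<open>f powr (- 1/2)\<close> is superharmonic.
\<close>

lemma solution_laplacian:
  assumes "solution S f" and "x \<in> S"
  shows "f x * trace (hessian f x) \<ge> 3/2 * (grad f x \<bullet> grad f x)"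
    and "trace (hessian f x) \<ge> 0"
proof -
  have "trace (schouten f x) = f x * trace (hessian f x) - real CARD('n) / 2 * (grad f x \<bullet> grad f x)"
    using trace_lincomb[of "f x" "hessian f x" "- ((grad f x \<bullet> grad f x) / 2)" "mat 1"]
    by (simp add: schouten_def trace_I)
  then have "f x * trace (hessian f x) \<ge> real CARD('n) / 2 * (grad f x \<bullet> grad f x)"
    using trace_nonneg[OF solutionD(5)[OF assms]] by simp
  moreover have "3/2 * (grad f x \<bullet> grad f x) \<le> real CARD('n) / 2 * (grad f x \<bullet> grad f x)"
    using dim by (intro mult_right_mono) auto
  ultimately show 1: "f x * trace (hessian f x) \<ge> 3/2 * (grad f x \<bullet> grad f x)" by linarith
  have "0 \<le> 3/2 * (grad f x \<bullet> grad f x)" by simp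
  also note 1
  finally show "trace (hessian f x) \<ge> 0"
    using solutionD(4)[OF assms] by (simp add: zero_le_mult_iff)
qed

text \<open>
  The positive superharmonic function \<open>f powr (- 1/2)\<close> is bounded below near the puncture by its minimum on a
  sphere.
\<close>

lemma bounded_near_puncture:
  assumes f: "solution (ball 0 R - {0}) f" and r: "0 < r" "r < R"
  shows "\<exists>C>0. \<forall>y. y \<noteq> 0 \<longrightarrow> norm y \<le> r \<longrightarrow> f y \<le> C"
proof -
  let ?S = "ball (0 :: real ^ 'n) R - {0}"
  define k :: real where "k = - 1/2"
  let ?Hs = "\<lambda>x. (k * f x powr (k - 1)) *\<^sub>R hessian f x
     + (k * ((k - 1) * f x powr (k - 2))) *\<^sub>R outer (grad f x) (grad f x)"
  have jet: "has_jet (\<lambda>x. f x powr k) (\<lambda>x. (k * f x powr (k - 1)) *\<^sub>R grad f x) ?Hs ?S"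
    by (rule has_jet_powr[OF solutionD(3,4)[OF f]])
  have sph: "sphere (0 :: real ^ 'n) r \<subseteq> ?S" using r by auto
  have "sphere (0 :: real ^ 'n) r \<noteq> {}" using r by simp
  then obtain x0 where x0: "x0 \<in> sphere 0 r" and min: "\<forall>x\<in>sphere 0 r. f x0 powr k \<le> f x powr k"
    using continuous_attains_inf[OF compact_sphere _
        continuous_on_subset[OF has_jet_continuous_on(1)[OF jet] sph]] by blast
  define c where "c = f x0 powr k"
  have "f x0 > 0" using x0 sph by (intro solutionD(4)[OF f]) blast
  then have c: "c > 0" by (simp add: c_def)
  have jet': "has_jet (\<lambda>x. 1 * (f x powr k) + 1 * (- c + 0 \<bullet> x))
      (\<lambda>x. 1 *\<^sub>R ((k * f x powr (k - 1)) *\<^sub>R grad f x) + 1 *\<^sub>R 0) (\<lambda>x. 1 *\<^sub>R ?Hs x + 1 *\<^sub>R 0) ?S"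
    by (rule has_jet_lincomb[OF jet has_jet_affine])
  have "f y \<le> c powr (- 2)" if y: "y \<noteq> 0" "norm y \<le> r" for y
  proof -
    have "1 * (f y powr k) + 1 * (- c + 0 \<bullet> y) \<ge> 0"
    proof (rule punctured_minimum_principle[OF dim jet' r _ _ _ y, where M = c])
      fix x :: "real ^ 'n"
      assume "x \<noteq> 0" "norm x < R"
      then have x: "x \<in> ?S" by simp
      let ?q = "grad f x \<bullet> grad f x"
      have pos: "f x > 0" by (rule solutionD(4)[OF f x])
      have e: "f x powr (k - 1) = f x powr (k - 2) * f x"
        using powr_add[of "f x" "k - 2" 1] pos by simp
      have "trace (?Hs x) = k * f x powr (k - 2) * (f x * trace (hessian f x) + (k - 1) * ?q)"
        unfolding trace_lincomb trace_outer e by (simp add: algebra_simps)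
      also have "\<dots> = - (1/2) * f x powr (k - 2) * (f x * trace (hessian f x) - 3/2 * ?q)"
        by (simp add: k_def)
      also have "\<dots> \<le> 0" using solution_laplacian(1)[OF f x] pos by (simp add: mult_nonneg_nonneg)
      finally show "trace (1 *\<^sub>R ?Hs x + 1 *\<^sub>R 0) \<le> 0" by simp
    qed (use c min in \<open>auto simp: c_def\<close>)
    then have cf: "c \<le> f y powr k" by simp
    have pos: "f y > 0" using solutionD(4)[OF f, of y] y r by auto
    have "(f y powr k) powr (- 2) \<le> c powr (- 2)" using cf c by (intro powr_mono2') auto
    then show ?thesis using pos by (simp add: k_def powr_powr)
  qed
  then show ?thesis using c by (intro exI[of _ "c powr (- 2)"]) auto
qed

text \<open>
  With \<open>m\<close> and \<open>d\<close> half the sum and half the difference of the two gradients, \<open>f \<le> a + m\<bullet>y - |d\<bullet>y| + \<epsilon> r\<close>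
  on the sphere of radius \<open>r\<close>. There \<open>|d\<bullet>y| \<ge> (d\<bullet>y)\<^sup>2/(|d| r)\<close>, and \<open>(d\<bullet>y)\<^sup>2\<close> agrees with the
  harmonic polynomial \<open>(d\<bullet>y)\<^sup>2 - |d|\<^sup>2 |y|\<^sup>2/n\<close> up to a positive constant. This gives a harmonic majorant of \<open>f\<close> in the punctured
  ball whose value at the puncture is less than \<open>a\<close> by a multiple of \<open>r\<close>.
\<close>

lemma drop_at_puncture:
  assumes f: "solution (ball 0 R - {0}) f" and R: "R > 0"
    and g1: "(g1 has_derivative (\<lambda>h. p1 \<bullet> h)) (at 0)" "g1 0 = a"
    and g2: "(g2 has_derivative (\<lambda>h. p2 \<bullet> h)) (at 0)" "g2 0 = a"
    and ne: "p1 \<noteq> p2"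
    and le: "\<And>y. y \<noteq> 0 \<Longrightarrow> norm y < R \<Longrightarrow> f y \<le> g1 y \<and> f y \<le> g2 y"
  shows "\<exists>\<delta>>0. \<exists>r>0. \<forall>y. y \<noteq> 0 \<longrightarrow> norm y < r \<longrightarrow> f y \<le> a - \<delta>"
proof -
  define m where "m = (1/2) *\<^sub>R (p1 + p2)"
  define d where "d = (1/2) *\<^sub>R (p1 - p2)"
  have md: "p1 = m + d" "p2 = m - d"
    by (simp_all add: m_def d_def flip: scaleR_add_right scaleR_diff_right scaleR_2)
  have d: "norm d > 0" using ne by (simp add: d_def)
  let ?n = "real CARD('n)"
  have n: "?n > 0" by simp
  define \<epsilon> where "\<epsilon> = norm d / (2 * ?n)"
  have \<epsilon>: "\<epsilon> > 0" using d by (simp add: \<epsilon>_def)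
  obtain r1 where r1: "r1 > 0" "\<And>y. norm y < r1 \<Longrightarrow> norm (g1 y - a - p1 \<bullet> y) \<le> \<epsilon> * norm y"
    using g1 \<epsilon> unfolding has_derivative_at_alt by (metis diff_zero)
  obtain r2 where r2: "r2 > 0" "\<And>y. norm y < r2 \<Longrightarrow> norm (g2 y - a - p2 \<bullet> y) \<le> \<epsilon> * norm y"
    using g2 \<epsilon> unfolding has_derivative_at_alt by (metis diff_zero)
  define r where "r = min R (min r1 r2) / 2"
  have r: "r > 0" "r < R" "r < r1" "r < r2" using R r1 r2 by (auto simp: r_def)
  have f1: "f y \<le> a + p1 \<bullet> y + \<epsilon> * r" and f2: "f y \<le> a + p2 \<bullet> y + \<epsilon> * r"
    if y: "y \<noteq> 0" "norm y \<le> r" for y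
  proof -
    have "\<epsilon> * norm y \<le> \<epsilon> * r" using y \<epsilon> by (intro mult_left_mono) auto
    then show "f y \<le> a + p1 \<bullet> y + \<epsilon> * r" "f y \<le> a + p2 \<bullet> y + \<epsilon> * r"
      using r1(2)[of y] r2(2)[of y] le[of y] y r by (auto simp: abs_le_iff)
  qed
  let ?S = "ball (0 :: real ^ 'n) R - {0}"
  define h where "h = (\<lambda>y. 1 * ((a + \<epsilon> * r - norm d * r / ?n) + m \<bullet> y)
      + 1 * ((- (1 / (norm d * r))) * (d \<bullet> y)\<^sup>2 + (norm d / (?n * r)) * ((y - 0) \<bullet> (y - 0))))"
  define Hh :: "real ^ 'n \<Rightarrow> real ^ 'n ^ 'n" where "Hh = (\<lambda>y. 1 *\<^sub>R 0
      + 1 *\<^sub>R ((- (1 / (norm d * r))) *\<^sub>R (2 *\<^sub>R outer d d) + (norm d / (?n * r)) *\<^sub>R (2 *\<^sub>R mat 1)))"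
  obtain ph where jet_h: "has_jet h ph Hh S" for S
    using has_jet_lincomb[OF has_jet_affine has_jet_lincomb[OF has_jet_square has_jet_dist_sq],
        of 1 "a + \<epsilon> * r - norm d * r / ?n" m 1 "- (1 / (norm d * r))" d "norm d / (?n * r)" 0]
    unfolding h_def Hh_def by blast
  have trh: "trace (Hh y) = 0" for y
  proof -
    have "trace (Hh y) = - (1 / (norm d * r)) * (2 * (norm d)\<^sup>2) + norm d / (?n * r) * (2 * ?n)"
      unfolding Hh_def scaleR_one add_0_left trace_lincomb trace_scaleR trace_outer trace_I
      by (simp add: power2_norm_eq_inner)
    also have "\<dots> = 0" using d r n by (simp add: field_simps power2_eq_square)
    finally show ?thesis .
  qed
  have jet_w: "has_jet (\<lambda>y. 1 * h y + (- 1) * f y) (\<lambda>y. 1 *\<^sub>R ph y + (- 1) *\<^sub>R grad f y)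
     (\<lambda>y. 1 *\<^sub>R Hh y + (- 1) *\<^sub>R hessian f y) ?S"
    by (rule has_jet_lincomb[OF jet_h solutionD(3)[OF f]])
  have conth: "continuous_on S h" for S using has_jet_continuous_on(1)[OF jet_h] .
  obtain x0 where x0: "\<forall>x\<in>cball 0 r. h x0 \<le> h x"
    using continuous_attains_inf[OF compact_cball _ conth, of 0 r] r by auto
  have fh: "f y \<le> h y" if y: "y \<noteq> 0" "norm y \<le> r" for y
  proof -
    have "1 * h y + (- 1) * f y \<ge> 0"
    proof (rule punctured_minimum_principle[OF dim jet_w r(1,2) _ _ _ y,
          where M = "a + norm p1 * r + \<epsilon> * r - h x0"])
      fix x :: "real ^ 'n" assume "x \<noteq> 0" "norm x < R"
      then show "trace (1 *\<^sub>R Hh x + (- 1) *\<^sub>R hessian f x) \<le> 0"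
        using solution_laplacian(2)[OF f, of x] unfolding trace_lincomb trh by simp
    next
      fix x :: "real ^ 'n" assume x: "x \<noteq> 0" "norm x \<le> r"
      have "p1 \<bullet> x \<le> norm p1 * norm x" by (rule norm_cauchy_schwarz)
      also have "\<dots> \<le> norm p1 * r" using x by (intro mult_left_mono) auto
      finally have "f x \<le> a + norm p1 * r + \<epsilon> * r" using f1[OF x] by simp
      moreover have "h x0 \<le> h x" using x0 x by simp
      ultimately show "- (a + norm p1 * r + \<epsilon> * r - h x0) \<le> 1 * h x + (- 1) * f x" by simp
    next
      fix x :: "real ^ 'n" assume x: "norm x = r"
      then have x0: "x \<noteq> 0" using r by auto
      have "f x \<le> a + m \<bullet> x - \<bar>d \<bullet> x\<bar> + \<epsilon> * r"
        using f1[OF x0] f2[OF x0] x by (auto simp: md inner_add_left inner_diff_left)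
      moreover have "(d \<bullet> x)\<^sup>2 / (norm d * r) \<le> \<bar>d \<bullet> x\<bar>"
      proof -
        have "(d \<bullet> x)\<^sup>2 = \<bar>d \<bullet> x\<bar> * \<bar>d \<bullet> x\<bar>" by (simp add: power2_eq_square)
        also have "\<dots> \<le> \<bar>d \<bullet> x\<bar> * (norm d * r)"
          using Cauchy_Schwarz_ineq2[of d x] x by (intro mult_left_mono) auto
        finally show ?thesis using d r by (simp add: pos_divide_le_eq)
      qed
      moreover have "h x = a + \<epsilon> * r + m \<bullet> x - (d \<bullet> x)\<^sup>2 / (norm d * r)"
      proof -
        have "x \<bullet> x = r * r" using x by (simp add: power2_eq_square flip: power2_norm_eq_inner)
        then show ?thesis using d r n by (simp add: h_def field_simps)
      qed
      ultimately show "1 * h x + (- 1) * f x \<ge> 0" by simp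
    qed
    then show ?thesis by simp
  qed
  define \<delta> where "\<delta> = norm d * r / (4 * ?n)"
  have \<delta>: "\<delta> > 0" using d r n by (simp add: \<delta>_def)
  have h0: "h 0 = a - 2 * \<delta>" using n by (simp add: h_def \<delta>_def \<epsilon>_def field_simps)
  have "isCont h 0" using conth[of UNIV] by (simp add: continuous_on_eq_continuous_at)
  then obtain r' where r': "r' > 0" "\<And>y. dist y 0 < r' \<Longrightarrow> dist (h y) (h 0) < \<delta>"
    unfolding continuous_at_eps_delta using \<delta> by blast
  have "f y \<le> a - \<delta>" if "y \<noteq> 0" "norm y < min r r'" for y
    using fh[of y] r'(2)[of y] that h0 by (auto simp: dist_real_def abs_less_iff)
  then show ?thesis using \<delta> r r' by (intro exI[of _ \<delta>] conjI exI[of _ "min r r'"]) auto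
qed

end

section \<open>Strict separation at a puncture\<close>

text \<open>
  Special conformal transformations: inversion, translation by \<open>-b\<close>, inversion. They fix the origin to first
  order but tilt the gradient of a transformed function there. The explicit formulas also make sense
  at the origin, where the inversions do not.
\<close>

definition sct_factor :: "real ^ 'n \<Rightarrow> real ^ 'n \<Rightarrow> real" where
  "sct_factor b y = 1 - 2 * (b \<bullet> y) + (b \<bullet> b) * (y \<bullet> y)"

definition sct_map :: "real ^ 'n \<Rightarrow> real ^ 'n \<Rightarrow> real ^ 'n" where
  "sct_map b y = (1 / sct_factor b y) *\<^sub>R (y - (y \<bullet> y) *\<^sub>R b)"

definition sct :: "real ^ 'n \<Rightarrow> (real ^ 'n \<Rightarrow> real) \<Rightarrow> real ^ 'n \<Rightarrow> real" where
  "sct b g y = sct_factor b y * g (sct_map b y)"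

lemma sct_bounds:
  assumes "r > 0" "norm b \<le> 1 / (4 * r)" "norm y \<le> r"
  shows "sct_factor b y \<ge> 1/2" and "norm (sct_map b y) \<le> 5/2 * norm y"
proof -
  have nby: "norm b * norm y \<le> 1/4"
  proof -
    have "norm b * norm y \<le> 1 / (4 * r) * r" using assms by (intro mult_mono) auto
    then show ?thesis using assms(1) by simp
  qed
  have "b \<bullet> y \<le> 1/4" using norm_cauchy_schwarz[of b y] nby by linarith
  then show s: "sct_factor b y \<ge> 1/2"
    using mult_nonneg_nonneg[OF inner_ge_zero[of b] inner_ge_zero[of y]] unfolding sct_factor_def by linarith
  have "norm (y - (y \<bullet> y) *\<^sub>R b) \<le> norm y + norm y * (norm b * norm y)"
    using norm_triangle_ineq4[of y "(y \<bullet> y) *\<^sub>R b"]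
    by (simp add: mult_ac power2_eq_square flip: power2_norm_eq_inner)
  also have "\<dots> \<le> norm y + norm y * (1/4)" using nby by (intro add_left_mono mult_left_mono) auto
  finally have n: "norm (y - (y \<bullet> y) *\<^sub>R b) \<le> 5/4 * norm y" by simp
  have "1 / sct_factor b y \<le> 2" using s by (simp add: divide_le_eq)
  then have "1 / sct_factor b y * norm (y - (y \<bullet> y) *\<^sub>R b) \<le> 2 * (5/4 * norm y)"
    using n by (intro mult_mono) auto
  then show "norm (sct_map b y) \<le> 5/2 * norm y" using s by (simp add: sct_map_def)
qed

lemma sct_zero: "sct 0 g y = g y"
  by (simp add: sct_def sct_map_def sct_factor_def)

lemma sct_at_zero: "sct b g 0 = g 0"
  by (simp add: sct_def sct_map_def sct_factor_def)

lemma has_derivative_sct_at_zero: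
  assumes g: "(g has_derivative (\<lambda>h. p \<bullet> h)) (at 0)"
  shows "(sct b g has_derivative (\<lambda>h. (p - (2 * g 0) *\<^sub>R b) \<bullet> h)) (at 0)"
proof -
  have s: "(sct_factor b has_derivative (\<lambda>h. - 2 * (b \<bullet> h))) (at 0)"
    unfolding sct_factor_def[abs_def] by (auto intro!: derivative_eq_intros)
  have s0: "sct_factor b 0 = 1" by (simp add: sct_factor_def)
  have m: "(sct_map b has_derivative (\<lambda>h. h)) (at 0)"
    unfolding sct_map_def[abs_def]
    by (rule has_derivative_eq_rhs[OF has_derivative_scaleR[OF
          has_derivative_divide'[OF has_derivative_const s]
          has_derivative_diff[OF has_derivative_ident has_derivative_scaleR[OF
            has_derivative_inner[OF has_derivative_ident has_derivative_ident] has_derivative_const]]]])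
       (simp_all add: s0)
  have m0: "sct_map b 0 = 0" by (simp add: sct_map_def)
  have "((\<lambda>y. g (sct_map b y)) has_derivative (\<lambda>h. p \<bullet> h)) (at 0)"
    using has_derivative_compose[OF m, of g] g m0 by simp
  from has_derivative_mult[OF s this] show ?thesis
    unfolding sct_def[abs_def]
    by (rule has_derivative_eq_rhs) (simp add: s0 m0 fun_eq_iff inner_diff_left)
qed

lemma sct_eq_kelvin:
  assumes y: "y \<noteq> 0" and b: "inversion y \<noteq> b"
  shows "sct b g y = kelvin (\<lambda>z. kelvin g (- b + 1 *\<^sub>R z) / 1) y"
    and "sct_map b y = inversion (- b + 1 *\<^sub>R inversion y)"
proof -
  define w where "w = inversion y - b"
  have w: "w \<bullet> w \<noteq> 0" using b by (simp add: w_def)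
  have yy: "y \<bullet> y \<noteq> 0" using y by simp
  have wy: "y - (y \<bullet> y) *\<^sub>R b = (y \<bullet> y) *\<^sub>R w"
    using yy by (simp add: w_def inversion_def scaleR_diff_right)
  have s: "sct_factor b y = (y \<bullet> y) * (w \<bullet> w)"
    using yy by (simp add: sct_factor_def w_def inversion_def inner_diff_left inner_diff_right
        inner_commute[of y b] field_simps)
  have w': "- b + 1 *\<^sub>R inversion y = w" by (simp add: w_def)
  show m: "sct_map b y = inversion (- b + 1 *\<^sub>R inversion y)"
    unfolding sct_map_def wy s w' using yy by (simp add: inversion_def)
  show "sct b g y = kelvin (\<lambda>z. kelvin g (- b + 1 *\<^sub>R z) / 1) y"
    unfolding sct_def m s kelvin_def w' by simp
qed

lemma continuous_on_sct:
  fixes g :: "real ^ 'n \<Rightarrow> real"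
  assumes g: "continuous_on (ball 0 R) g" and r: "r > 0" "4 * r \<le> R"
  shows "continuous_on (cball 0 (1 / (4 * r)) \<times> cball 0 r) (\<lambda>(b, y). sct b g y)"
proof -
  let ?D = "cball (0 :: real ^ 'n) (1 / (4 * r)) \<times> cball (0 :: real ^ 'n) r"
  have nz: "sct_factor b y \<noteq> 0" "sct_map b y \<in> ball 0 R" if "(b, y) \<in> ?D" for b y
    using sct_bounds[of r b y] that r by auto
  have s: "continuous_on ?D (\<lambda>x. sct_factor (fst x) (snd x))"
    unfolding sct_factor_def by (intro continuous_intros)
  have m: "continuous_on ?D (\<lambda>x. sct_map (fst x) (snd x))"
    unfolding sct_map_def by (intro continuous_intros s) (use nz in auto)
  show ?thesis
    unfolding sct_def split_def
    by (intro continuous_on_mult s continuous_on_compose2[OF g m]) (use nz in auto)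
qed

context elliptic_level_set
begin

lemma solution_sct:
  assumes g: "solution (ball 0 R) g" and r: "r > 0" "4 * r \<le> R" and b: "norm b \<le> 1 / (4 * r)"
  shows "solution (ball 0 r - {0}) (sct b g)"
proof -
  have inv: "inversion y \<noteq> b" if y: "y \<in> ball 0 r - {0}" for y
  proof
    assume "inversion y = b"
    then have "norm b * norm y = 1" using y by (auto simp: inversion_def divide_simps
          power2_eq_square simp flip: power2_norm_eq_inner)
    moreover have "norm b * norm y \<le> 1 / (4 * r) * r" using b y r by (intro mult_mono) auto
    ultimately show False using r by simp
  qed
  have "solution {y. y \<noteq> 0 \<and> inversion y \<in> {z. - b + 1 *\<^sub>R z \<in> {x. x \<noteq> 0 \<and> inversion x \<in> ball 0 R}}}
      (kelvin (\<lambda>z. kelvin g (- b + 1 *\<^sub>R z) / 1))"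
    by (intro solution_kelvin solution_similarity g) simp
  then have "solution (ball 0 r - {0}) (kelvin (\<lambda>z. kelvin g (- b + 1 *\<^sub>R z) / 1))"
  proof (rule solution_subset)
    show "ball 0 r - {0} \<subseteq>
        {y. y \<noteq> 0 \<and> inversion y \<in> {z. - b + 1 *\<^sub>R z \<in> {x. x \<noteq> 0 \<and> inversion x \<in> ball 0 R}}}"
    proof
      fix y :: "real ^ 'n" assume y: "y \<in> ball 0 r - {0}"
      then have "norm (sct_map b y) < R" using sct_bounds(2)[OF r(1) b, of y] r by auto
      then show "y \<in> {y. y \<noteq> 0 \<and> inversion y \<in>
          {z. - b + 1 *\<^sub>R z \<in> {x. x \<noteq> 0 \<and> inversion x \<in> ball 0 R}}}"
        using inv[OF y] y sct_eq_kelvin(2)[of y b] by auto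
    qed
  qed auto
  then show ?thesis
  proof (rule solution_cong)
    fix y :: "real ^ 'n" assume y: "y \<in> ball 0 r - {0}"
    then show "kelvin (\<lambda>z. kelvin g (- b + 1 *\<^sub>R z) / 1) y = sct b g y"
      using sct_eq_kelvin(1)[OF _ inv[OF y]] by simp
  qed
qed

text \<open>
  Where \<open>g\<close> is positive, the logarithmic derivative of \<open>t \<mapsto> g(x + t y)/t\<close> is dominated by that of \<open>1/t\<close> for
  small \<open>y\<close>. Both the dilations below and small moving spheres rely on this.
\<close>

lemma scaling_monotone_near:
  assumes g: "solution S g" and x: "x \<in> S"
  shows "\<exists>r>0. \<forall>y. norm y \<le> r \<longrightarrow> x + y \<in> S \<and> \<bar>g (x + y) - g x\<bar> < g x / 8 \<and>
     (\<forall>t. 0 < t \<longrightarrow> t \<le> 1 \<longrightarrow> g (x + y) \<le> g (x + t *\<^sub>R y) / t)"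
proof -
  note Sg = solutionD[OF g]
  note cg = has_jet_continuous_on[OF Sg(3)]
  have g0: "g x > 0" by (rule Sg(4)[OF x])
  note lim = tendsto_nhds_continuous_on[OF _ Sg(1) x]
  define L where "L = norm (grad g x) + 1"
  have L: "L > 0" by (simp add: L_def add_nonneg_pos)
  have "\<forall>\<^sub>F y in nhds x. y \<in> S \<and> dist (g y) (g x) < g x / 8 \<and> norm (grad g y) < L"
    by (intro eventually_conj eventually_nhds_in_open[OF Sg(1) x] tendstoD[OF lim[OF cg(1)]]
        order_tendstoD(2)[OF tendsto_norm[OF lim[OF cg(2)]]])
       (use g0 in \<open>auto simp: L_def\<close>)
  then obtain r0 where r0: "r0 > 0"
    and "\<And>y. dist y x < r0 \<Longrightarrow> y \<in> S \<and> dist (g y) (g x) < g x / 8 \<and> norm (grad g y) < L"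
    unfolding eventually_nhds_metric by blast
  from this(2)[of "x + y" for y]
  have near: "x + y \<in> S \<and> \<bar>g (x + y) - g x\<bar> < g x / 8 \<and> norm (grad g (x + y)) < L"
    if "norm y < r0" for y
    using that by (simp add: dist_norm)
  define r where "r = min (r0 / 2) (g x / (2 * L))"
  have "r \<le> r0 / 2" "r \<le> g x / (2 * L)" by (simp_all add: r_def)
  then have r: "r < r0" "L * r \<le> g x / 2" using r0 L by (simp_all add: field_simps)
  have r_pos: "r > 0" using r0 g0 L by (simp add: r_def)
  have "g (x + y) \<le> g (x + t *\<^sub>R y) / t" if t: "0 < t" "t \<le> 1" and y: "norm y \<le> r" for t y
  proof (cases "t = 1")
    case False
    have small: "norm (s *\<^sub>R y) \<le> r" if "t \<le> s" "s \<le> 1" for s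
      using mult_mono[of s 1 "norm y" r] that t y by simp
    have "((\<lambda>s. g (x + s *\<^sub>R y)) has_real_derivative grad g (x + s *\<^sub>R y) \<bullet> y) (at s)"
      if "t \<le> s" "s \<le> 1" for s
      by (rule has_jet_ray(1)[OF Sg(3)]) (use near[of "s *\<^sub>R y"] small[OF that] r in simp)
    then obtain \<xi> where \<xi>: "t < \<xi>" "\<xi> < 1"
      "g (x + 1 *\<^sub>R y) - g (x + t *\<^sub>R y) = (1 - t) * (grad g (x + \<xi> *\<^sub>R y) \<bullet> y)"
      using MVT2[of t 1 "\<lambda>s. g (x + s *\<^sub>R y)" "\<lambda>s. grad g (x + s *\<^sub>R y) \<bullet> y"] False t by auto
    have "norm (grad g (x + \<xi> *\<^sub>R y)) * norm y \<le> L * r"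
      using near[of "\<xi> *\<^sub>R y"] small[of \<xi>] \<xi> y r L by (intro mult_mono) auto
    then have "grad g (x + \<xi> *\<^sub>R y) \<bullet> y \<le> g x / 2"
      using norm_cauchy_schwarz[of "grad g (x + \<xi> *\<^sub>R y)" y] r by linarith
    also have "\<dots> \<le> g (x + y)"
    proof -
      have "\<bar>g (x + y) - g x\<bar> < g x / 8" using near[of y] y r by simp
      then show ?thesis using g0 by linarith
    qed
    finally have "(1 - t) * (grad g (x + \<xi> *\<^sub>R y) \<bullet> y) \<le> (1 - t) * g (x + y)"
      using t by (intro mult_left_mono) auto
    then have "t * g (x + y) \<le> g (x + t *\<^sub>R y)" using \<xi>(3) by (simp add: algebra_simps)
    then show ?thesis using t by (simp add: field_simps)
  qed simp
  then show ?thesis using near r r_pos by (intro exI[of _ r]) auto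
qed

text \<open>
  The punctured solution \<open>f\<close> is caught below two regular solutions with the same value and different
  gradients at the puncture, \<open>g\<close> and its image \<open>G\<close> under a special conformal transformation. The proof that
  \<open>f \<le> G\<close> slides the dilates \<open>G(t y)/t\<close>. At \<open>t = 1/2\<close> they lie above \<open>f\<close> since \<open>2 g(y/2)\<close> is nearly
  \<open>2 g(0)\<close>. In the annulus \<open>A\<close> they stay above \<open>f\<close> for all \<open>t \<le> 1\<close>, as \<open>G\<close> is close to \<open>g\<close> and dilation
  with \<open>t < 1\<close> increases \<open>g\<close>.
\<close>

lemma no_touching_at_puncture:
  assumes f: "solution (ball 0 R - {0}) f" and g: "solution (ball 0 R) g" and R: "R > 0"
    and less: "\<And>y. y \<noteq> 0 \<Longrightarrow> norm y < R \<Longrightarrow> f y < g y"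
  shows "\<exists>\<delta>>0. \<exists>r>0. \<forall>y. y \<noteq> 0 \<longrightarrow> norm y < r \<longrightarrow> f y \<le> g 0 - \<delta>"
proof -
  note Sg = solutionD[OF g] and Sf = solutionD[OF f]
  note cg = has_jet_continuous_on[OF Sg(3)] and cf = has_jet_continuous_on[OF Sf(3)]
  have zero: "0 \<in> ball (0 :: real ^ 'n) R" using R by simp
  have g0: "g 0 > 0" by (rule Sg(4)[OF zero])
  obtain r1 where r1: "r1 > 0" and near: "\<forall>y. norm y \<le> r1 \<longrightarrow> 0 + y \<in> ball 0 R \<and> \<bar>g (0 + y) - g 0\<bar> < g 0 / 8 \<and>
      (\<forall>t. 0 < t \<longrightarrow> t \<le> 1 \<longrightarrow> g (0 + y) \<le> g (0 + t *\<^sub>R y) / t)"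
    using scaling_monotone_near[OF g zero] by blast
  define r where "r = min r1 (R / 4)"
  have r: "r > 0" "r \<le> r1" "4 * r \<le> R" "r < R"
    using r1 R by (auto simp: r_def)
  have gnear: "7/8 * g 0 < g y" "g y < 9/8 * g 0" if "norm y \<le> r" for y
  proof -
    have "\<bar>g y - g 0\<bar> < g 0 / 8" using near that r by simp
    then show "7/8 * g 0 < g y" "g y < 9/8 * g 0" by linarith+
  qed
  have radial: "g y \<le> g (t *\<^sub>R y) / t" if "0 < t" "t \<le> 1" "norm y \<le> r" for t y
    using near that r by simp
  define A where "A = cball 0 r - ball (0 :: real ^ 'n) (r / 2)"
  have A: "compact A" unfolding A_def by (intro compact_diff) auto
  have "(r / 2) *\<^sub>R axis undefined 1 \<in> A" using r by (simp add: A_def)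
  then have A_ne: "A \<noteq> {}" by blast
  have "continuous_on A (\<lambda>y. g y - f y)"
    using r by (intro continuous_on_diff continuous_on_subset[OF cf(1)] continuous_on_subset[OF cg(1)])
      (auto simp: A_def)
  then obtain a where a: "a \<in> A" "\<forall>y\<in>A. g a - f a \<le> g y - f y"
    using continuous_attains_inf[OF A A_ne] by blast
  define \<eta> where "\<eta> = min ((g a - f a) / 4) (g 0 / 8)"
  have "f a < g a" using a(1) r by (intro less) (auto simp: A_def)
  then have \<eta>: "\<eta> > 0" "4 * \<eta> \<le> g 0 / 2" using g0 by (auto simp: \<eta>_def)
  have gap: "f y + 4 * \<eta> \<le> g y" if "y \<in> A" for y
  proof -
    have "\<eta> \<le> (g a - f a) / 4" unfolding \<eta>_def by (rule min.cobounded1)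
    then have "4 * \<eta> \<le> g a - f a" by simp
    also have "\<dots> \<le> g y - f y" using a(2) that by blast
    finally show ?thesis by simp
  qed
  have "uniformly_continuous_on (cball 0 (1 / (4 * r)) \<times> cball 0 r) (\<lambda>(b, y). sct b g y)"
    by (intro compact_uniformly_continuous continuous_on_sct[OF cg(1) r(1,3)] compact_Times compact_cball)
  then obtain d where d: "d > 0" and unif: "\<And>x x'. x \<in> cball 0 (1 / (4 * r)) \<times> cball 0 r \<Longrightarrow>
      x' \<in> cball 0 (1 / (4 * r)) \<times> cball 0 r \<Longrightarrow> dist x' x < d \<Longrightarrow>
      dist ((\<lambda>(b, y). sct b g y) x') ((\<lambda>(b, y). sct b g y) x) < \<eta>"
    unfolding uniformly_continuous_on_def using \<eta>(1) by metis
  define b :: "real ^ 'n" where "b = (min (d / 2) (1 / (4 * r))) *\<^sub>R axis undefined 1"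
  have nb: "norm b = min (d / 2) (1 / (4 * r))" using d r by (simp add: b_def)
  moreover have "min (d / 2) (1 / (4 * r)) > 0" using d r by simp
  ultimately have "norm b > 0" by linarith
  then have b: "b \<noteq> 0" "norm b < d" "norm b \<le> 1 / (4 * r)"
    using d by (simp_all only: zero_less_norm_iff) (simp_all add: nb)
  define G where "G = sct b g"
  have Gg: "g y - \<eta> < G y" if "norm y \<le> r" for y
    using unif[of "(0, y)" "(b, y)"] that b r
    by (auto simp: dist_Pair_Pair sct_zero G_def dist_real_def abs_less_iff)
  have G_cont: "continuous_on (cball 0 r) G"
  proof -
    have "continuous_on (cball 0 r) (\<lambda>y. (\<lambda>(b, y). sct b g y) (b, y))"
      by (rule continuous_on_compose2[OF continuous_on_sct[OF cg(1) r(1,3)]])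
         (use b in \<open>auto intro!: continuous_intros\<close>)
    then show ?thesis by (simp add: G_def)
  qed
  have G_sol: "solution (ball 0 r - {0}) G"
    unfolding G_def by (rule solution_sct[OF g r(1,3) b(3)])
  have shrink: "norm (t *\<^sub>R y) \<le> r" if "0 < t" "t \<le> 1" "norm y \<le> r" for t and y :: "real ^ 'n"
    using mult_mono[of t 1 "norm y" r] that by simp
  define Gt where "Gt = (\<lambda>t y. G (0 + t *\<^sub>R y) / t)"
  have Gt_low: "Gt t y > g (t *\<^sub>R y) / t - 2 * \<eta>" if t: "1/2 \<le> t" "t \<le> 1" and y: "norm y \<le> r" for t y
  proof -
    have "Gt t y > (g (t *\<^sub>R y) - \<eta>) / t"
      using Gg[OF shrink[of t y]] t y by (simp add: Gt_def divide_strict_right_mono)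
    moreover have "\<eta> / t \<le> 2 * \<eta>" using t \<eta> by (simp add: field_simps)
    ultimately show ?thesis by (simp add: diff_divide_distrib)
  qed
  have Gt_gap: "f y < Gt t y" if t: "1/2 \<le> t" "t \<le> 1" and y: "y \<in> A" for t y
  proof -
    have yr: "norm y \<le> r" using y by (simp add: A_def)
    show ?thesis using Gt_low[OF t yr] radial[of t y] t yr gap[OF y] \<eta> by linarith
  qed
  have Gt_half: "f y < Gt (1/2) y" if y: "y \<noteq> 0" "norm y \<le> r" for y
  proof -
    have "g ((1/2) *\<^sub>R y) > 7/8 * g 0" using gnear(1)[OF shrink[of "1/2" y]] y by simp
    moreover have "f y < g y" using less[OF y(1)] y(2) r by simp
    ultimately show ?thesis using Gt_low[of "1/2" y] gnear(2)[OF y(2)] y(2) \<eta> by simp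
  qed
  have Gt_lim: "(\<lambda>k. Gt (t k) (y k)) \<longlonglongrightarrow> Gt t' y'"
    if "t \<longlonglongrightarrow> t'" "y \<longlonglongrightarrow> y'" and t: "\<And>k. 1/2 \<le> t k" "\<And>k. t k \<le> 1" "1/2 \<le> t'" "t' \<le> 1"
      and y: "\<And>k. norm (y k) \<le> r" "norm y' \<le> r" for t y t' y'
  proof -
    have "(\<lambda>k. G (0 + t k *\<^sub>R y k)) \<longlonglongrightarrow> G (0 + t' *\<^sub>R y')"
    proof (rule continuous_on_tendsto_compose[OF G_cont])
      show "(\<lambda>k. 0 + t k *\<^sub>R y k) \<longlonglongrightarrow> 0 + t' *\<^sub>R y'" using that by (intro tendsto_intros)
      show "0 + t' *\<^sub>R y' \<in> cball 0 r" using shrink[of t' y'] t y by simp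
      have "0 + t k *\<^sub>R y k \<in> cball 0 r" for k
        using shrink[of "t k" "y k"] t(1,2)[of k] y(1)[of k] by simp
      then show "\<forall>\<^sub>F k in sequentially. 0 + t k *\<^sub>R y k \<in> cball 0 r" by simp
    qed
    then show ?thesis unfolding Gt_def using that by (intro tendsto_divide) auto
  qed
  have slide: "f y \<le> Gt t y" if t: "1/2 \<le> t" "t \<le> 1" and y: "y \<noteq> 0" "norm y \<le> r" for t y
  proof (rule ccontr)
    assume viol: "\<not> f y \<le> Gt t y"
    \<comment> \<open>\<open>t'\<close> is the first parameter at which the order is about to fail.\<close>
    define B where "B = {t. 1/2 \<le> t \<and> t \<le> 1 \<and> (\<exists>y. y \<noteq> 0 \<and> norm y \<le> r \<and> Gt t y < f y)}"
    define t' where "t' = Inf B"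
    have B_ne: "B \<noteq> {}" using viol t y unfolding B_def by force
    have B_bdd: "bdd_below B" unfolding B_def by (rule bdd_belowI[of _ "1/2"]) auto
    have t': "1/2 \<le> t'" "t' \<le> 1"
    proof -
      show "1/2 \<le> t'" unfolding t'_def by (rule cInf_greatest[OF B_ne]) (auto simp: B_def)
      obtain s where "s \<in> B" using B_ne by blast
      then show "t' \<le> 1" unfolding t'_def using cInf_lower[OF _ B_bdd, of s] by (auto simp: B_def)
    qed
    have below: "f y \<le> Gt s y" if "1/2 \<le> s" "s < t'" "y \<noteq> 0" "norm y \<le> r" for s y
    proof (rule ccontr)
      assume "\<not> ?thesis"
      then have "s \<in> B" using that t' unfolding B_def by auto
      then show False using cInf_lower[OF _ B_bdd, of s] that by (simp add: t'_def)
    qed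
    have at_t': "f y \<le> Gt t' y" if y: "y \<noteq> 0" "norm y \<le> r" for y
    proof (cases "t' = 1/2")
      case True show ?thesis unfolding True by (rule less_imp_le[OF Gt_half[OF y]])
    next
      case False
      define s where "s = (\<lambda>k::nat. t' - (t' - 1/2) / real (Suc k))"
      have s1: "1/2 \<le> s k" "s k < t'" for k
      proof -
        have "(t' - 1/2) / real (Suc k) \<le> (t' - 1/2) / 1" using t' by (intro divide_left_mono) auto
        from this[unfolded div_by_1] show "1/2 \<le> s k" unfolding s_def by linarith
        have "(t' - 1/2) / real (Suc k) > 0" using t' False by simp
        then show "s k < t'" unfolding s_def by linarith
      qed
      have "s \<longlonglongrightarrow> t' - 0" unfolding s_def
        by (intro tendsto_diff tendsto_const LIMSEQ_Suc[OF lim_const_over_n])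
      then have "s \<longlonglongrightarrow> t'" by simp
      have "(\<lambda>k. Gt (s k) y) \<longlonglongrightarrow> Gt t' y"
      proof (rule Gt_lim[OF \<open>s \<longlonglongrightarrow> t'\<close> tendsto_const])
        show "1/2 \<le> s k" "s k \<le> 1" for k using s1[of k] t' by auto
      qed (use t' y in auto)
      then show ?thesis by (rule LIMSEQ_le_const) (use below s1 y in blast)
    qed
    have "\<exists>s\<in>B. s < t' + 1 / real (Suc k)" for k
      using cInf_lessD[OF B_ne, of "t' + 1 / real (Suc k)"] by (auto simp: t'_def)
    then obtain \<tau> where \<tau>: "\<And>k. \<tau> k \<in> B" "\<And>k. \<tau> k < t' + 1 / real (Suc k)" by metis
    have \<tau>_ge: "t' \<le> \<tau> k" for k unfolding t'_def by (rule cInf_lower[OF \<tau>(1) B_bdd])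
    have \<tau>_lim: "\<tau> \<longlonglongrightarrow> t'"
    proof (rule tendsto_sandwich[of "\<lambda>_. t'" \<tau> _ "\<lambda>k. t' + 1 / real (Suc k)"])
      have "(\<lambda>k. t' + 1 / real (Suc k)) \<longlonglongrightarrow> t' + 0"
        by (intro tendsto_add tendsto_const LIMSEQ_Suc[OF lim_const_over_n])
      then show "(\<lambda>k. t' + 1 / real (Suc k)) \<longlonglongrightarrow> t'" by simp
    qed (use \<tau>(2) \<tau>_ge in \<open>auto simp: less_imp_le\<close>)
    have "\<exists>y. y \<noteq> 0 \<and> norm y \<le> r \<and> Gt (\<tau> k) y < f y" for k using \<tau>(1)[of k] by (simp add: B_def)
    then obtain z where z: "\<And>k. z k \<noteq> 0" "\<And>k. norm (z k) \<le> r" "\<And>k. Gt (\<tau> k) (z k) < f (z k)" by metis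
    have "\<forall>k. z k \<in> cball 0 r" using z(2) by simp
    then obtain z' \<phi> where z': "z' \<in> cball 0 r" and \<phi>: "strict_mono \<phi>" and z\<phi>: "(z \<circ> \<phi>) \<longlonglongrightarrow> z'"
      using compact_cball unfolding compact_def by blast
    have \<tau>\<phi>: "(\<tau> \<circ> \<phi>) \<longlonglongrightarrow> t'" using LIMSEQ_subseq_LIMSEQ[OF \<tau>_lim \<phi>] .
    have G\<phi>: "(\<lambda>k. Gt ((\<tau> \<circ> \<phi>) k) ((z \<circ> \<phi>) k)) \<longlonglongrightarrow> Gt t' z'"
      by (rule Gt_lim[OF \<tau>\<phi> z\<phi>]) (use \<tau>(1) z(2) z' t' in \<open>auto simp: B_def\<close>)
    show False
    proof (cases "z' = 0")
      case True
      \<comment> \<open>Contact at the puncture: possible at \<open>t' = 1\<close> only, where the order still holds.\<close>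
      have "t' < 1"
      proof (rule ccontr)
        assume "\<not> t' < 1"
        then have "t' = 1" using t' by simp
        then have "\<tau> 0 = t'" using \<tau>(1)[of 0] \<tau>_ge[of 0] by (auto simp: B_def)
        then show False using z[of 0] at_t'[of "z 0"] by simp
      qed
      have "(\<lambda>k. g ((z \<circ> \<phi>) k)) \<longlonglongrightarrow> g 0"
      proof (rule continuous_on_tendsto_compose[OF cg(1)])
        show "(z \<circ> \<phi>) \<longlonglongrightarrow> 0" using z\<phi> True by simp
        have "(z \<circ> \<phi>) k \<in> ball 0 R" for k using z(2)[of "\<phi> k"] r by simp
        then show "\<forall>\<^sub>F k in sequentially. (z \<circ> \<phi>) k \<in> ball 0 R" by simp
      qed (rule zero)
      moreover have "Gt ((\<tau> \<circ> \<phi>) k) ((z \<circ> \<phi>) k) \<le> g ((z \<circ> \<phi>) k)" for k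
        using z[of "\<phi> k"] less[of "z (\<phi> k)"] r by simp
      ultimately have "Gt t' z' \<le> g 0" using LIMSEQ_le[OF G\<phi>] by blast
      moreover have "Gt t' z' = g 0 / t'" using True by (simp add: Gt_def G_def sct_at_zero)
      ultimately show False using \<open>t' < 1\<close> t' g0 by (simp add: field_simps)
    next
      case False
      have "(\<lambda>k. f ((z \<circ> \<phi>) k)) \<longlonglongrightarrow> f z'"
      proof (rule continuous_on_tendsto_compose[OF cf(1) z\<phi>])
        show "z' \<in> ball 0 R - {0}" using z' r False by simp
        have "(z \<circ> \<phi>) k \<in> ball 0 R - {0}" for k using z(1,2)[of "\<phi> k"] r by simp
        then show "\<forall>\<^sub>F k in sequentially. (z \<circ> \<phi>) k \<in> ball 0 R - {0}" by simp
      qed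
      then have "Gt t' z' \<le> f z'" using LIMSEQ_le[OF G\<phi>] z(3) by (auto simp: less_imp_le)
      with at_t'[OF False] z' have eq: "f z' = Gt t' z'" by simp
      have "z' \<notin> A" using Gt_gap[OF t'] eq by force
      then have "norm z' < r / 2" using z' by (simp add: A_def)
      then have z'r: "norm z' < r" using r by simp
      have "solution {y. 0 + t' *\<^sub>R y \<in> ball 0 r - {0}} (\<lambda>y. G (0 + t' *\<^sub>R y) / t')"
        by (rule solution_similarity[OF G_sol]) (use t' in simp)
      then have Gs: "solution (ball 0 r - {0}) (Gt t')"
        unfolding Gt_def
      proof (rule solution_subset)
        show "ball 0 r - {0} \<subseteq> {y :: real ^ 'n. 0 + t' *\<^sub>R y \<in> ball 0 r - {0}}"
        proof
          fix y :: "real ^ 'n" assume y: "y \<in> ball 0 r - {0}"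
          have "t' * norm y \<le> 1 * norm y" using t' by (intro mult_right_mono) auto
          also have "\<dots> < r" using y by simp
          finally show "y \<in> {y. 0 + t' *\<^sub>R y \<in> ball 0 r - {0}}" using y t' by auto
        qed
      qed auto
      have fs: "solution (ball 0 r - {0}) f" by (rule solution_subset[OF f]) (use r in auto)
      have conn: "connected (ball (0 :: real ^ 'n) r - {0})"
        using dim by (intro connected_open_delete) auto
      define y0 :: "real ^ 'n" where "y0 = (r / 2) *\<^sub>R axis undefined 1"
      have y0: "norm y0 = r / 2" using r by (simp add: y0_def)
      have "f y0 = Gt t' y0"
      proof (rule strong_maximum_principle[OF fs Gs conn _ _ eq])
        show "f x \<le> Gt t' x" if "x \<in> ball 0 r - {0}" for x using at_t' that by simp
        show "z' \<in> ball 0 r - {0}" using False z'r by simp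
        have "y0 \<noteq> 0" using y0 r by auto
        then show "y0 \<in> ball 0 r - {0}" using y0 r by simp
      qed
      moreover have "f y0 < Gt t' y0" using Gt_gap[OF t', of y0] y0 r by (simp add: A_def)
      ultimately show False by simp
    qed
  qed
  have le: "f y \<le> g y \<and> f y \<le> G y" if "y \<noteq> 0" "norm y < r" for y
    using less[of y] slide[of 1 y] that r by (simp add: Gt_def)
  have g': "(g has_derivative (\<lambda>h. grad g 0 \<bullet> h)) (at 0)"
    using Sg(3) zero by (simp add: has_jet_def)
  have fr: "solution (ball 0 r - {0}) f" by (rule solution_subset[OF f]) (use r in auto)
  show ?thesis
  proof (rule drop_at_puncture[OF fr r(1) g' refl _ _ _ le])
    show "(G has_derivative (\<lambda>h. (grad g 0 - (2 * g 0) *\<^sub>R b) \<bullet> h)) (at 0)"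
      unfolding G_def by (rule has_derivative_sct_at_zero[OF g'])
    show "G 0 = g 0" by (simp add: G_def sct_at_zero)
    show "grad g 0 \<noteq> grad g 0 - (2 * g 0) *\<^sub>R b" using b g0 by simp
  qed auto
qed

end

section \<open>The moving sphere argument\<close>

text \<open>Inversion in the sphere of radius \<open>l\<close> about \<open>x\<close>, and the corresponding Kelvin transform.\<close>

definition sphere_inv :: "real ^ 'n \<Rightarrow> real \<Rightarrow> real ^ 'n \<Rightarrow> real ^ 'n" where
  "sphere_inv x l y = x + (l\<^sup>2 / ((y - x) \<bullet> (y - x))) *\<^sub>R (y - x)"

definition sphere_kelvin :: "real ^ 'n \<Rightarrow> real \<Rightarrow> (real ^ 'n \<Rightarrow> real) \<Rightarrow> real ^ 'n \<Rightarrow> real" where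
  "sphere_kelvin x l f y = ((y - x) \<bullet> (y - x)) / l\<^sup>2 * f (sphere_inv x l y)"

definition below_sphere_kelvin :: "(real ^ 'n \<Rightarrow> real) \<Rightarrow> real ^ 'n \<Rightarrow> real \<Rightarrow> bool" where
  "below_sphere_kelvin f x l \<longleftrightarrow>
     (\<forall>y. y \<noteq> 0 \<longrightarrow> l \<le> norm (y - x) \<longrightarrow> f y \<le> sphere_kelvin x l f y)"

lemma norm_sphere_inv:
  assumes "y \<noteq> x"
  shows "norm (sphere_inv x l y - x) = l\<^sup>2 / norm (y - x)"
  using assms by (simp add: sphere_inv_def power2_eq_square flip: power2_norm_eq_inner)

lemma sphere_inv_involution:
  assumes "y \<noteq> x" "l \<noteq> 0"
  shows "sphere_inv x l (sphere_inv x l y) = y"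
proof -
  define w where "w = y - x"
  have w: "w \<bullet> w \<noteq> 0" using assms by (simp add: w_def)
  have "sphere_inv x l y - x = (l\<^sup>2 / (w \<bullet> w)) *\<^sub>R w" by (simp add: sphere_inv_def w_def)
  then have "sphere_inv x l (sphere_inv x l y)
      = x + (l\<^sup>2 / ((l\<^sup>2 / (w \<bullet> w)) * ((l\<^sup>2 / (w \<bullet> w)) * (w \<bullet> w))) * (l\<^sup>2 / (w \<bullet> w))) *\<^sub>R w"
    unfolding sphere_inv_def[of x l "sphere_inv x l y"] by simp
  also have "l\<^sup>2 / ((l\<^sup>2 / (w \<bullet> w)) * ((l\<^sup>2 / (w \<bullet> w)) * (w \<bullet> w))) * (l\<^sup>2 / (w \<bullet> w)) = 1"
    using w assms(2) by (simp add: field_simps)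
  finally show ?thesis by (simp add: w_def)
qed

lemma sphere_inv_fixed: "norm (y - x) = l \<Longrightarrow> l \<noteq> 0 \<Longrightarrow> sphere_inv x l y = y"
  by (auto simp: sphere_inv_def simp flip: power2_norm_eq_inner)

lemma sphere_kelvin_fixed: "norm (y - x) = l \<Longrightarrow> l \<noteq> 0 \<Longrightarrow> sphere_kelvin x l f y = f y"
  by (auto simp: sphere_kelvin_def sphere_inv_fixed simp flip: power2_norm_eq_inner)

lemma sphere_inv_nonzero:
  assumes "0 < l" "l < norm x" "l \<le> norm (y - x)"
  shows "sphere_inv x l y \<noteq> 0"
proof
  assume z: "sphere_inv x l y = 0"
  have "y \<noteq> x" using assms by auto
  from norm_sphere_inv[OF this, of l] z have "norm x = l\<^sup>2 / norm (y - x)" by simp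
  also have "\<dots> \<le> l\<^sup>2 / l"
    using assms \<open>y \<noteq> x\<close> by (intro divide_left_mono mult_pos_pos) auto
  also have "\<dots> = l" by (simp add: power2_eq_square)
  finally show False using assms by simp
qed

lemma tendsto_sphere_inv [tendsto_intros]:
  assumes "(m \<longlongrightarrow> l) G" "(z \<longlongrightarrow> y) G" "y \<noteq> x"
  shows "((\<lambda>k. sphere_inv x (m k) (z k)) \<longlongrightarrow> sphere_inv x l y) G"
  unfolding sphere_inv_def using assms by (intro tendsto_intros) auto

lemma tendsto_sphere_kelvin:
  assumes "(m \<longlongrightarrow> l) G" "(z \<longlongrightarrow> y) G" "y \<noteq> x" "l \<noteq> 0" "isCont f (sphere_inv x l y)"
  shows "((\<lambda>k. sphere_kelvin x (m k) f (z k)) \<longlongrightarrow> sphere_kelvin x l f y) G"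
  unfolding sphere_kelvin_def using assms
  by (intro tendsto_intros isCont_tendsto_compose[OF assms(5)]) auto

context elliptic_level_set
begin

lemma solution_sphere_kelvin:
  assumes f: "solution S f" and l: "l > 0"
  shows "solution {y. y \<noteq> x \<and> sphere_inv x l y \<in> S} (sphere_kelvin x l f)"
proof -
  let ?w = "\<lambda>y. - (1 / l) *\<^sub>R x + (1 / l) *\<^sub>R y"
  have w: "?w y = (1 / l) *\<^sub>R (y - x)" for y by (simp add: scaleR_diff_right)
  have inv: "x + l *\<^sub>R inversion (?w y) = sphere_inv x l y" for y
    unfolding w inversion_def sphere_inv_def using l by (simp add: power2_eq_square)
  have "solution {y. ?w y \<in> {w. w \<noteq> 0 \<and> inversion w \<in> {z. x + l *\<^sub>R z \<in> S}}}
      (\<lambda>y. kelvin (\<lambda>z. f (x + l *\<^sub>R z) / l) (?w y) / (1 / l))"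
    by (intro solution_similarity solution_kelvin f) (use l in auto)
  moreover have "{y. ?w y \<in> {w. w \<noteq> 0 \<and> inversion w \<in> {z. x + l *\<^sub>R z \<in> S}}}
      = {y. y \<noteq> x \<and> sphere_inv x l y \<in> S}"
    unfolding mem_Collect_eq inv using l by (simp add: w)
  moreover have "(\<lambda>y. kelvin (\<lambda>z. f (x + l *\<^sub>R z) / l) (?w y) / (1 / l)) = sphere_kelvin x l f"
  proof
    fix y
    have "?w y \<bullet> ?w y = ((y - x) \<bullet> (y - x)) / l\<^sup>2" unfolding w by (simp add: power2_eq_square)
    then show "kelvin (\<lambda>z. f (x + l *\<^sub>R z) / l) (?w y) / (1 / l) = sphere_kelvin x l f y"
      unfolding kelvin_def inv sphere_kelvin_def using l by simp
  qed
  ultimately show ?thesis by simp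
qed

end

text \<open>
  The situation of the theorem in terms of \<open>f\<close>. That \<open>f\<close> has no extension across the origin is what
  excludes \<open>f = sphere_kelvin x l f\<close>.
\<close>

locale singular_entire_solution = elliptic_level_set E for E :: "(real ^ 'n ^ 'n) set" +
  fixes f :: "real ^ 'n \<Rightarrow> real"
  assumes f: "solution (- {0}) f"
    and not_removable: "\<not> (\<exists>h r. (\<forall>y. y \<noteq> 0 \<longrightarrow> h y = f y) \<and> r > 0 \<and> solution (ball 0 r) h)"
begin

lemma f_cont: "y \<noteq> 0 \<Longrightarrow> isCont f y"
  using has_jet_continuous_on(1)[OF solutionD(3)[OF f]]
  by (simp add: continuous_on_eq_continuous_at open_Compl)

lemma f_pos: "y \<noteq> 0 \<Longrightarrow> f y > 0"
  using solutionD(4)[OF f] by simp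

text \<open>Boundedness near the origin, applied to \<open>f\<close> and to its Kelvin transform.\<close>

lemma growth: "\<exists>C>0. \<forall>y. y \<noteq> 0 \<longrightarrow> f y \<le> C * (1 + y \<bullet> y)"
proof -
  have "solution (ball 0 2 - {0}) f" by (rule solution_subset[OF f]) auto
  from bounded_near_puncture[OF this, of 1]
  obtain C1 where C1: "C1 > 0" "\<And>y. y \<noteq> 0 \<Longrightarrow> norm y \<le> 1 \<Longrightarrow> f y \<le> C1" by auto
  have "solution (ball 0 2 - {0}) (kelvin f)"
    by (rule solution_subset[OF solution_kelvin[OF f]]) (auto simp: inversion_def)
  from bounded_near_puncture[OF this, of 1]
  obtain C2 where C2: "C2 > 0" "\<And>y. y \<noteq> 0 \<Longrightarrow> norm y \<le> 1 \<Longrightarrow> kelvin f y \<le> C2" by auto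
  have "f y \<le> max C1 C2 * (1 + y \<bullet> y)" if y: "y \<noteq> 0" for y
  proof (cases "norm y \<le> 1")
    case True
    have "f y \<le> max C1 C2 * 1" using C1(2)[OF y True] by simp
    also have "\<dots> \<le> max C1 C2 * (1 + y \<bullet> y)" using C1 by (intro mult_left_mono) auto
    finally show ?thesis .
  next
    case False
    define z where "z = inversion y"
    have yy: "y \<bullet> y > 0" using y by simp
    have z: "z \<noteq> 0" "inversion z = y" "z \<bullet> z = 1 / (y \<bullet> y)"
      using y by (auto simp: z_def inversion_def)
    have "norm z = 1 / norm y"
      using yy by (simp add: z_def inversion_def power2_eq_square flip: power2_norm_eq_inner)
    then have "norm z \<le> 1" using False by (simp add: divide_le_eq_1)
    from C2(2)[OF z(1) this] have "f y \<le> C2 * (y \<bullet> y)"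
      using yy by (simp add: kelvin_def z pos_divide_le_eq)
    also have "\<dots> \<le> max C1 C2 * (1 + y \<bullet> y)" using C1 yy by (intro mult_mono) auto
    finally show ?thesis .
  qed
  then show ?thesis using C1(1) by (intro exI[of _ "max C1 C2"]) auto
qed

text \<open>
  For \<open>|y - x| \<le> r0\<close> the inequality is the monotonicity of \<open>t \<mapsto> f(x + t w)/t\<close>. Farther away
  the transform is at least of the order \<open>|y - x|\<^sup>2 f(x)/l\<^sup>2\<close>, which beats the quadratic growth of \<open>f\<close> if \<open>l\<close> is small.
\<close>

lemma start_moving_spheres:
  assumes x: "x \<noteq> 0"
  shows "\<exists>l0>0. \<forall>l. 0 < l \<longrightarrow> l \<le> l0 \<longrightarrow> below_sphere_kelvin f x l"
proof -
  have fx: "f x > 0" by (rule f_pos[OF x])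
  obtain r0 where r0: "r0 > 0" and near: "\<forall>y. norm y \<le> r0 \<longrightarrow> x + y \<in> - {0} \<and> \<bar>f (x + y) - f x\<bar> < f x / 8 \<and>
     (\<forall>t. 0 < t \<longrightarrow> t \<le> 1 \<longrightarrow> f (x + y) \<le> f (x + t *\<^sub>R y) / t)"
    using scaling_monotone_near[OF f, of x] x by auto
  obtain C where C: "C > 0" "\<And>y. y \<noteq> 0 \<Longrightarrow> f y \<le> C * (1 + y \<bullet> y)" using growth by blast
  define C' where "C' = C * (2 + (1 + 2 * (x \<bullet> x)) / r0\<^sup>2)"
  have C': "C' > 0" using C r0 unfolding C'_def by (intro mult_pos_pos add_pos_nonneg) auto
  define l0 where "l0 = min r0 (sqrt (f x / (2 * C')))"
  have l0: "l0 > 0" using r0 fx C' by (simp add: l0_def)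
  have "below_sphere_kelvin f x l" if l: "0 < l" "l \<le> l0" for l
    unfolding below_sphere_kelvin_def
  proof (intro allI impI)
    fix y assume y: "y \<noteq> 0" "l \<le> norm (y - x)"
    define w where "w = y - x"
    have yw: "y = x + w" and lw: "l \<le> norm w" using y by (simp_all add: w_def)
    have ww: "w \<bullet> w > 0" using lw l by auto
    have lr0: "l \<le> r0" using l by (simp add: l0_def)
    have lww: "l\<^sup>2 \<le> w \<bullet> w" using lw l by (simp add: power_mono flip: power2_norm_eq_inner)
    have kel: "sphere_kelvin x l f y = (w \<bullet> w) / l\<^sup>2 * f (x + (l\<^sup>2 / (w \<bullet> w)) *\<^sub>R w)"
      by (simp add: sphere_kelvin_def sphere_inv_def w_def)
    show "f y \<le> sphere_kelvin x l f y"
    proof (cases "norm w \<le> r0")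
      case True
      define t where "t = l\<^sup>2 / (w \<bullet> w)"
      have "0 < t" "t \<le> 1" using l ww lww by (auto simp: t_def)
      with near True have "f (x + w) \<le> f (x + t *\<^sub>R w) / t" by blast
      then show ?thesis unfolding kel by (simp add: yw t_def mult.commute)
    next
      case False
      define v where "v = (l\<^sup>2 / (w \<bullet> w)) *\<^sub>R w"
      have "norm v = l\<^sup>2 / norm w"
        using ww by (simp add: v_def power2_eq_square flip: power2_norm_eq_inner)
      also have "\<dots> \<le> l\<^sup>2 / l" using lw l by (intro divide_left_mono mult_pos_pos) auto
      also have "\<dots> \<le> r0" using lr0 by (simp add: power2_eq_square)
      finally have "\<bar>f (x + v) - f x\<bar> < f x / 8" using near by blast
      then have fv: "f x / 2 \<le> f (x + v)" using fx by linarith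
      have "l \<le> sqrt (f x / (2 * C'))" using l by (simp add: l0_def)
      then have "l\<^sup>2 \<le> f x / (2 * C')" using l power_mono[of l "sqrt (f x / (2 * C'))" 2] fx C' by simp
      then have "C' \<le> f x / 2 / l\<^sup>2" using C' l by (simp add: field_simps)
      also have "\<dots> \<le> f (x + v) / l\<^sup>2" using fv by (intro divide_right_mono) auto
      finally have "(w \<bullet> w) * C' \<le> (w \<bullet> w) * (f (x + v) / l\<^sup>2)" using ww by (intro mult_left_mono) auto
      then have 1: "(w \<bullet> w) * C' \<le> sphere_kelvin x l f y" by (simp add: kel v_def)
      have "r0\<^sup>2 \<le> w \<bullet> w" using False r0 by (simp add: power_mono flip: power2_norm_eq_inner)
      then have "1 \<le> (w \<bullet> w) / r0\<^sup>2" using r0 by simp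
      then have "(1 + 2 * (x \<bullet> x)) * 1 \<le> (1 + 2 * (x \<bullet> x)) * ((w \<bullet> w) / r0\<^sup>2)"
        by (intro mult_left_mono) auto
      moreover have "y \<bullet> y \<le> 2 * (w \<bullet> w) + 2 * (x \<bullet> x)"
        using inner_ge_zero[of "w - x"] unfolding yw
        by (simp add: inner_add_left inner_add_right inner_diff_left inner_diff_right inner_commute)
      ultimately have "1 + y \<bullet> y \<le> (w \<bullet> w) * (2 + (1 + 2 * (x \<bullet> x)) / r0\<^sup>2)"
        by (simp add: algebra_simps)
      then have "C * (1 + y \<bullet> y) \<le> C * ((w \<bullet> w) * (2 + (1 + 2 * (x \<bullet> x)) / r0\<^sup>2))"
        using C by (intro mult_left_mono) auto
      with C(2)[OF y(1)] have "f y \<le> (w \<bullet> w) * C'" by (simp add: C'_def mult_ac)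
      with 1 show ?thesis by simp
    qed
  qed
  then show ?thesis using l0 by blast
qed

lemma below_sphere_kelvin_limit:
  assumes l: "0 < l" and below: "\<And>m. 0 < m \<Longrightarrow> m < l \<Longrightarrow> below_sphere_kelvin f x m"
    and y: "y \<noteq> 0" "l \<le> norm (y - x)" "sphere_inv x l y \<noteq> 0"
  shows "f y \<le> sphere_kelvin x l f y"
proof -
  have lim: "((\<lambda>m. sphere_kelvin x m f y) \<longlongrightarrow> sphere_kelvin x l f y) (at_left l)"
    by (rule tendsto_sphere_kelvin[OF tendsto_ident_at tendsto_const _ _ f_cont[OF y(3)]])
       (use l y in auto)
  have "\<forall>\<^sub>F m in at_left l. f y \<le> sphere_kelvin x m f y"
    using eventually_at_left_real[OF l]
  proof eventually_elim
    case (elim m)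
    then have "below_sphere_kelvin f x m" using below by simp
    then show ?case using y elim by (simp add: below_sphere_kelvin_def)
  qed
  from tendsto_lowerbound[OF lim this] show ?thesis by simp
qed

lemma solution_sphere_kelvin_outside:
  assumes "0 < l" "l < norm x" "open T" and T: "\<And>y. y \<in> T \<Longrightarrow> l < norm (y - x)"
  shows "solution T (sphere_kelvin x l f)"
proof (rule solution_subset[OF solution_sphere_kelvin[OF f assms(1), of x] assms(3)])
  show "T \<subseteq> {y. y \<noteq> x \<and> sphere_inv x l y \<in> - {0}}"
  proof
    fix y assume "y \<in> T"
    then have "l < norm (y - x)" by (rule T)
    then show "y \<in> {y. y \<noteq> x \<and> sphere_inv x l y \<in> - {0}}"
      using assms(1) sphere_inv_nonzero[OF assms(1,2), of y] by auto
  qed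
qed

text \<open>
  Contact outside the sphere would spread to the whole complement of the ball, in particular to a
  neighbourhood of the origin, where the transform is regular because \<open>l < |x|\<close>.
\<close>

lemma below_strict:
  assumes l: "0 < l" "l < norm x" and below: "below_sphere_kelvin f x l"
    and y: "y \<noteq> 0" "l < norm (y - x)"
  shows "f y < sphere_kelvin x l f y"
proof (rule ccontr)
  assume "\<not> ?thesis"
  then have touch: "f y = sphere_kelvin x l f y"
    using below y unfolding below_sphere_kelvin_def by (meson antisym_conv2 less_imp_le)
  define D where "D = - cball x l - {0 :: real ^ 'n}"
  have D: "z \<in> D \<longleftrightarrow> z \<noteq> 0 \<and> l < norm (z - x)" for z
    by (auto simp: D_def dist_norm norm_minus_commute)
  have oD: "open D" unfolding D_def by (intro open_Diff) auto
  have "connected D"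
    unfolding D_def using dim
    by (intro connected_open_delete connected_complement_bounded_convex) auto
  have v: "solution D (sphere_kelvin x l f)"
    by (rule solution_sphere_kelvin_outside[OF l oD]) (simp add: D)
  have fD: "solution D f" by (rule solution_subset[OF f oD]) (auto simp: D)
  have eq: "f z = sphere_kelvin x l f z" if "z \<in> D" for z
    by (rule strong_maximum_principle[OF fD v \<open>connected D\<close> _ _ touch that])
       (use below y in \<open>auto simp: D below_sphere_kelvin_def\<close>)
  define r where "r = norm x - l"
  have r: "r > 0" using l by (simp add: r_def)
  have far: "l < norm (z - x)" if "z \<in> ball 0 r" for z
    using that norm_triangle_sub[of x z] by (simp add: r_def norm_minus_commute)
  have vr: "solution (ball 0 r) (sphere_kelvin x l f)"
    by (rule solution_sphere_kelvin_outside[OF l open_ball far])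
  define h where "h = (\<lambda>z. if z = 0 then sphere_kelvin x l f 0 else f z)"
  have "solution (ball 0 r) h"
    by (rule solution_cong[OF vr]) (use eq far in \<open>auto simp: h_def D\<close>)
  moreover have "\<forall>z. z \<noteq> 0 \<longrightarrow> h z = f z" by (simp add: h_def)
  ultimately show False using not_removable r by blast
qed

lemma below_strict_at_zero:
  assumes l: "0 < l" "l < norm x" and below: "below_sphere_kelvin f x l"
  shows "\<exists>\<delta>>0. \<exists>r>0. \<forall>y. y \<noteq> 0 \<longrightarrow> norm y < r \<longrightarrow> f y \<le> sphere_kelvin x l f 0 - \<delta>"
proof -
  define R where "R = norm x - l"
  have R: "R > 0" using l by (simp add: R_def)
  have far: "l < norm (z - x)" if "norm z < R" for z
    using that norm_triangle_sub[of x z] by (simp add: R_def norm_minus_commute)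
  have v: "solution (ball 0 R) (sphere_kelvin x l f)"
    by (rule solution_sphere_kelvin_outside[OF l open_ball]) (simp add: far)
  have fR: "solution (ball 0 R - {0}) f" by (rule solution_subset[OF f]) auto
  show ?thesis
    by (rule no_touching_at_puncture[OF fR v R]) (use below_strict[OF l below] far in auto)
qed

text \<open>
  The inversion exchanges infinity with \<open>x\<close>. There \<open>f\<close> is regular and its transform has the puncture; the
  order of the two is reversed because the inversion exchanges the inside and the outside of the sphere.
\<close>

lemma below_strict_at_infinity:
  assumes l: "0 < l" "l < norm x" and below: "below_sphere_kelvin f x l"
  shows "\<exists>\<delta>>0. \<exists>r>0. \<forall>y. y \<noteq> 0 \<longrightarrow> r < norm (y - x) \<longrightarrow> l\<^sup>2 * f y \<le> ((y - x) \<bullet> (y - x)) * (f x - \<delta>)"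
proof -
  define v where "v = sphere_kelvin x l f"
  define R where "R = l\<^sup>2 / norm x"
  have x: "norm x > 0" using l by linarith
  have R: "R > 0" using l x by (simp add: R_def)
  have Rl: "R < norm x"
  proof -
    have "l * l < norm x * norm x" using l by (intro mult_strict_mono) auto
    then show ?thesis using x by (simp add: R_def power2_eq_square divide_less_eq)
  qed
  have far: "norm x < norm (sphere_inv x l z - x)" if "z \<noteq> x" "norm (z - x) < R" for z
  proof -
    have "norm x * norm (z - x) < l\<^sup>2" using that x by (simp add: R_def pos_less_divide_eq mult.commute)
    then show ?thesis unfolding norm_sphere_inv[OF that(1)] using that by (simp add: pos_less_divide_eq)
  qed
  have inv0: "sphere_inv x l z \<noteq> 0" if "z \<noteq> x" "norm (z - x) < R" for z
    using far[OF that] by auto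
  have z0: "z \<noteq> 0" if "norm (z - x) < R" for z using that Rl by auto
  have "solution {h. x + 1 *\<^sub>R h \<in> {y. y \<noteq> x \<and> sphere_inv x l y \<in> - {0}}} (\<lambda>h. v (x + 1 *\<^sub>R h) / 1)"
    unfolding v_def by (intro solution_similarity solution_sphere_kelvin f l) simp
  then have s1: "solution (ball 0 R - {0}) (\<lambda>h. v (x + 1 *\<^sub>R h) / 1)"
    by (rule solution_subset) (use inv0[of "x + h" for h] in auto)
  have "solution {h. x + 1 *\<^sub>R h \<in> - {0}} (\<lambda>h. f (x + 1 *\<^sub>R h) / 1)"
    by (intro solution_similarity f) simp
  then have s2: "solution (ball 0 R) (\<lambda>h. f (x + 1 *\<^sub>R h) / 1)"
    by (rule solution_subset) (use z0[of "x + h" for h] in auto)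
  have "v (x + 1 *\<^sub>R h) / 1 < f (x + 1 *\<^sub>R h) / 1" if h: "h \<noteq> 0" "norm h < R" for h
  proof -
    define y where "y = sphere_inv x l (x + h)"
    have hx: "x + h \<noteq> x" "norm (x + h - x) < R" using h by auto
    have y: "y \<noteq> 0" "sphere_inv x l y = x + h" "norm (y - x) > norm x"
      using inv0[OF hx] far[OF hx] sphere_inv_involution[OF hx(1)] l by (auto simp: y_def)
    have "f y < sphere_kelvin x l f y"
      by (rule below_strict[OF l below y(1)]) (use y l in simp)
    also have "\<dots> = ((y - x) \<bullet> (y - x)) / l\<^sup>2 * f (x + h)" by (simp add: sphere_kelvin_def y)
    finally have "(h \<bullet> h) / l\<^sup>2 * f y < (h \<bullet> h) / l\<^sup>2 * (((y - x) \<bullet> (y - x)) / l\<^sup>2 * f (x + h))"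
      using h l by (intro mult_strict_left_mono) auto
    also have "(h \<bullet> h) / l\<^sup>2 * (((y - x) \<bullet> (y - x)) / l\<^sup>2 * f (x + h)) = f (x + h)"
    proof -
      have "norm (y - x) = l\<^sup>2 / norm h" unfolding y_def norm_sphere_inv[OF hx(1)] by simp
      then have "(y - x) \<bullet> (y - x) = (l\<^sup>2 / norm h)\<^sup>2" by (simp flip: power2_norm_eq_inner)
      then show ?thesis using h l by (simp add: power_divide field_simps flip: power2_norm_eq_inner)
    qed
    finally show ?thesis by (simp add: v_def sphere_kelvin_def y_def)
  qed
  from no_touching_at_puncture[OF s1 s2 R this]
  obtain \<delta> r where \<delta>: "\<delta> > 0" "r > 0" and drop: "\<And>h. h \<noteq> 0 \<Longrightarrow> norm h < r \<Longrightarrow> v (x + h) \<le> f x - \<delta>"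
    by auto
  have "l\<^sup>2 * f y \<le> ((y - x) \<bullet> (y - x)) * (f x - \<delta>)" if y: "y \<noteq> 0" "l\<^sup>2 / r < norm (y - x)" for y
  proof -
    have "l\<^sup>2 / r > 0" using l \<delta> by simp
    then have yx: "y \<noteq> x" using y by auto
    define h where "h = sphere_inv x l y - x"
    have nh: "norm h = l\<^sup>2 / norm (y - x)" using norm_sphere_inv[OF yx] by (simp add: h_def)
    have "norm h < r" using y yx \<delta> by (simp add: nh divide_less_eq mult.commute)
    moreover have "h \<noteq> 0" using nh yx l by auto
    ultimately have "v (x + h) \<le> f x - \<delta>" by (intro drop)
    moreover have "v (x + h) = (h \<bullet> h) / l\<^sup>2 * f y"
      unfolding v_def sphere_kelvin_def using sphere_inv_involution[OF yx] l by (simp add: h_def)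
    moreover have "(h \<bullet> h) / l\<^sup>2 = l\<^sup>2 / ((y - x) \<bullet> (y - x))"
      using nh l by (simp add: power_divide power2_eq_square flip: power2_norm_eq_inner)
    ultimately have "l\<^sup>2 / ((y - x) \<bullet> (y - x)) * f y \<le> f x - \<delta>" by simp
    then show ?thesis using yx by (simp add: field_simps)
  qed
  moreover have "l\<^sup>2 / r > 0" using l \<delta> by simp
  ultimately show ?thesis using \<delta>(1) by blast
qed

text \<open>
  On the sphere \<open>f\<close> agrees with its transform \<open>v\<close>. Along the ray through \<open>y\<close> with \<open>e = y - x\<close> one has
  \<open>v(x + t e) = t\<^sup>2 f(x + e/t)\<close>, so the radial derivative of \<open>v - f\<close> is
  \<open>2 (f(y) - grad f y \<bullet> e)\<close>, and Hopf's lemma gives its sign.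
\<close>

lemma boundary_derivative:
  assumes l: "0 < l" "l < norm x" and below: "below_sphere_kelvin f x l"
    and y: "norm (y - x) = l"
  shows "grad f y \<bullet> (y - x) < f y"
proof -
  have y0: "y \<noteq> 0" using y l by auto
  have yx: "y \<noteq> x" using y l by auto
  define e where "e = y - x"
  have ee: "e \<bullet> e = l\<^sup>2" using y by (simp add: e_def flip: power2_norm_eq_inner)
  define v where "v = sphere_kelvin x l f"
  define S where "S = {y. y \<noteq> x \<and> sphere_inv x l y \<in> - {0}} \<inter> - {0}"
  note kel = solution_sphere_kelvin[OF f l(1), of x]
  have oS: "open S" unfolding S_def using solutionD(1)[OF kel] by (intro open_Int) auto
  have v: "solution S v" unfolding v_def by (rule solution_subset[OF kel oS]) (auto simp: S_def)
  have fS: "solution S f" by (rule solution_subset[OF f oS]) (auto simp: S_def)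
  have yS: "y \<in> S" using y0 yx sphere_inv_fixed[OF y] l by (simp add: S_def)
  have fv: "f y = v y" using sphere_kelvin_fixed[OF y] l by (simp add: v_def)
  define s where "s = norm y / (2 * l)"
  have s: "s > 0" using y0 l by (simp add: s_def)
  define z where "z = y + s *\<^sub>R e"
  have ne: "norm e = l" using y by (simp add: e_def)
  have zball: "q \<noteq> 0 \<and> l < norm (q - x)" if q: "q \<in> ball z (s * l)" for q
  proof
    have qz: "norm (q - z) < s * l" using q by (simp add: dist_norm norm_minus_commute)
    have "z - x = (1 + s) *\<^sub>R e" by (simp add: z_def e_def algebra_simps)
    then have "norm (z - x) = (1 + s) * l" using s ne by simp
    moreover have "norm (z - x) \<le> norm (q - x) + norm (q - z)"
      using norm_triangle_ineq4[of "q - x" "q - z"] by simp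
    ultimately show "l < norm (q - x)" using qz by (simp add: algebra_simps)
    show "q \<noteq> 0"
    proof
      assume "q = 0"
      then have "norm z < s * l" using qz by simp
      moreover have "norm y \<le> norm z + s * l"
        using norm_triangle_ineq4[of z "s *\<^sub>R e"] s ne by (simp add: z_def)
      ultimately show False using l by (simp add: s_def)
    qed
  qed
  have "(grad v y - grad f y) \<bullet> (z - y) > 0"
  proof (rule hopf_boundary_point[OF fS v _ yS _ _ _ fv])
    show "ball z (s * l) \<subseteq> S"
    proof
      fix q assume "q \<in> ball z (s * l)"
      from zball[OF this] show "q \<in> S"
        using sphere_inv_nonzero[OF l, of q] l by (auto simp: S_def)
    qed
    show "norm (y - z) = s * l" using s ne by (simp add: z_def)
    show "s * l > 0" using s l by simp
    show "f q < v q" if "q \<in> ball z (s * l)" for q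
      unfolding v_def using below_strict[OF l below] zball[OF that] by blast
  qed
  then have hopf: "(grad v y - grad f y) \<bullet> e > 0" using s by (simp add: z_def zero_less_mult_iff)
  have ye: "y = x + 1 *\<^sub>R e" by (simp add: e_def)
  have 1: "((\<lambda>t. v (x + t *\<^sub>R e)) has_real_derivative grad v y \<bullet> e) (at 1)"
    using has_jet_ray(1)[OF solutionD(3)[OF v], of x 1 e] yS ye by simp
  have "((\<lambda>t. t\<^sup>2 * f (x + (1 / t) *\<^sub>R e)) has_real_derivative 2 * f y - grad f y \<bullet> e) (at 1)"
  proof -
    have fd: "((\<lambda>t. f (x + t *\<^sub>R e)) has_real_derivative grad f y \<bullet> e) (at (1 / 1))"
      using has_jet_ray(1)[OF solutionD(3)[OF fS], of x 1 e] yS ye by simp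
    have inv: "((\<lambda>t::real. 1 / t) has_real_derivative - 1) (at 1)"
      by (auto intro!: derivative_eq_intros)
    have "((\<lambda>t. f (x + (1 / t) *\<^sub>R e)) has_real_derivative (grad f y \<bullet> e) * - 1) (at 1)"
      using DERIV_chain2[OF fd inv] .
    then have "((\<lambda>t. f (x + (1 / t) *\<^sub>R e)) has_real_derivative - (grad f y \<bullet> e)) (at 1)" by simp
    moreover have "((\<lambda>t::real. t\<^sup>2) has_real_derivative 2) (at 1)"
      by (auto intro!: derivative_eq_intros)
    ultimately show ?thesis using DERIV_mult[of "\<lambda>t::real. t\<^sup>2" 2 1 UNIV] ye by fastforce
  qed
  then have 2: "((\<lambda>t. v (x + t *\<^sub>R e)) has_real_derivative 2 * f y - grad f y \<bullet> e) (at 1)"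
  proof (rule has_field_derivative_transform_within_open[of _ _ _ "{0<..}"])
    fix t :: real assume "t \<in> {0<..}"
    then show "t\<^sup>2 * f (x + (1 / t) *\<^sub>R e) = v (x + t *\<^sub>R e)"
      using ee l by (simp add: v_def sphere_kelvin_def sphere_inv_def power2_eq_square)
  qed auto
  have "grad v y \<bullet> e = 2 * f y - grad f y \<bullet> e" by (rule DERIV_unique[OF 1 2])
  then show ?thesis using hopf by (simp add: inner_diff_left e_def)
qed

text \<open>
  Otherwise there are radii \<open>m k \<ge> l\<close> converging to \<open>l\<close> and points \<open>y k\<close> at which the inequality fails. They
  cannot escape to infinity and cannot converge to the origin, where the gap is uniform, nor to another point
  outside the sphere, where the inequality is strict. If they converge to a point of the sphere, both \<open>y k\<close>
  and its image are near that point, on a ray along which \<open>t \<mapsto> f(x + t w)/t\<close> decreases by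
  \<open>boundary_derivative\<close>; this monotonicity is the inequality in question.
\<close>

lemma continue_moving_spheres:
  assumes l: "0 < l" "l < norm x" and below: "below_sphere_kelvin f x l"
  shows "\<exists>e>0. \<forall>m. l \<le> m \<longrightarrow> m < l + e \<longrightarrow> below_sphere_kelvin f x m"
proof (rule ccontr)
  assume no_room: "\<not> ?thesis"
  define e where "e = (\<lambda>k::nat. (norm x - l) / real (Suc k))"
  have e: "e k > 0" for k using l by (simp add: e_def)
  have "\<exists>m y. l \<le> m \<and> m < l + e k \<and> y \<noteq> 0 \<and> m \<le> norm (y - x) \<and> sphere_kelvin x m f y < f y" for k
    using no_room e[of k] unfolding below_sphere_kelvin_def not_ex not_all not_imp
    by (meson not_le)
  then obtain m y where m: "\<And>k. l \<le> m k" "\<And>k. m k < l + e k"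
    and y: "\<And>k. y k \<noteq> 0" "\<And>k. m k \<le> norm (y k - x)" "\<And>k. sphere_kelvin x (m k) f (y k) < f (y k)"
    by metis
  have m_pos: "m k > 0" for k using m(1)[of k] l by simp
  have mx: "m k < norm x" for k
  proof -
    have "e k \<le> (norm x - l) / 1" unfolding e_def using l by (intro divide_left_mono) auto
    then show ?thesis using m(2)[of k] by simp
  qed
  have m_lim: "m \<longlonglongrightarrow> l"
  proof (rule tendsto_sandwich[of "\<lambda>_. l" m _ "\<lambda>k. l + e k"])
    have "(\<lambda>k. l + e k) \<longlonglongrightarrow> l + 0"
      unfolding e_def by (intro tendsto_add tendsto_const LIMSEQ_Suc[OF lim_const_over_n])
    then show "(\<lambda>k. l + e k) \<longlonglongrightarrow> l" by simp
  qed (use m in \<open>auto simp: less_imp_le\<close>)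
  have lx: "x \<noteq> 0" using l by auto
  \<comment> \<open>The violating points stay bounded by the uniform gap at infinity.\<close>
  obtain \<rho> where \<rho>: "\<forall>\<^sub>F k in sequentially. norm (y k - x) \<le> \<rho>"
  proof -
    obtain \<delta> r where \<delta>: "\<delta> > 0" and inf: "\<And>y. y \<noteq> 0 \<Longrightarrow> r < norm (y - x) \<Longrightarrow>
        l\<^sup>2 * f y \<le> ((y - x) \<bullet> (y - x)) * (f x - \<delta>)"
      using below_strict_at_infinity[OF l below] by blast
    obtain s where s: "s > 0" and fs: "\<And>z. dist z x < s \<Longrightarrow> dist (f z) (f x) < \<delta> / 2"
      using f_cont[OF lx] \<delta> unfolding continuous_at_eps_delta by (meson half_gt_zero)
    define \<rho> where "\<rho> = max r ((norm x)\<^sup>2 / s)"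
    have "(\<lambda>k. l\<^sup>2 * (f x - \<delta> / 2) - (m k)\<^sup>2 * (f x - \<delta>)) \<longlonglongrightarrow> l\<^sup>2 * (f x - \<delta> / 2) - l\<^sup>2 * (f x - \<delta>)"
      by (intro tendsto_intros m_lim)
    moreover have "l\<^sup>2 * (f x - \<delta> / 2) - l\<^sup>2 * (f x - \<delta>) > 0"
      using \<delta> l by (simp add: algebra_simps)
    ultimately have "\<forall>\<^sub>F k in sequentially. l\<^sup>2 * (f x - \<delta> / 2) - (m k)\<^sup>2 * (f x - \<delta>) > 0"
      by (rule order_tendstoD(1))
    then have "\<forall>\<^sub>F k in sequentially. norm (y k - x) \<le> \<rho>"
    proof eventually_elim
      case (elim k)
      show ?case
      proof (rule ccontr)
        assume "\<not> norm (y k - x) \<le> \<rho>"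
        then have big: "r < norm (y k - x)" "(norm x)\<^sup>2 / s < norm (y k - x)" by (auto simp: \<rho>_def)
        have "(norm x)\<^sup>2 / s > 0" using lx s by simp
        then have d: "norm (y k - x) > 0" using big by linarith
        then have yx: "y k \<noteq> x" by auto
        let ?d2 = "(y k - x) \<bullet> (y k - x)"
        have d2: "?d2 > 0" using yx by simp
        have "norm (sphere_inv x (m k) (y k) - x) = (m k)\<^sup>2 / norm (y k - x)"
          by (rule norm_sphere_inv[OF yx])
        also have "\<dots> \<le> (norm x)\<^sup>2 / norm (y k - x)"
          using mx[of k] m_pos[of k] by (intro divide_right_mono power_mono) auto
        also have "\<dots> < s" using big(2) d s by (simp add: field_simps)
        finally have "dist (f (sphere_inv x (m k) (y k))) (f x) < \<delta> / 2"
          by (intro fs) (simp add: dist_norm)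
        then have "f x - \<delta> / 2 < f (sphere_inv x (m k) (y k))" unfolding dist_real_def by linarith
        then have "?d2 * (f x - \<delta> / 2) < ?d2 * f (sphere_inv x (m k) (y k))"
          using d2 by (rule mult_strict_left_mono)
        also have "\<dots> = (m k)\<^sup>2 * sphere_kelvin x (m k) f (y k)"
          using m_pos[of k] by (simp add: sphere_kelvin_def)
        also have "\<dots> < (m k)\<^sup>2 * f (y k)"
          using y(3) m_pos[of k] by (intro mult_strict_left_mono) auto
        finally have "l\<^sup>2 * (?d2 * (f x - \<delta> / 2)) < l\<^sup>2 * ((m k)\<^sup>2 * f (y k))"
          using l by (intro mult_strict_left_mono) auto
        also have "\<dots> = (m k)\<^sup>2 * (l\<^sup>2 * f (y k))" by simp
        also have "\<dots> \<le> (m k)\<^sup>2 * (?d2 * (f x - \<delta>))"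
          using inf[OF y(1) big(1)] by (intro mult_left_mono) auto
        finally have "?d2 * (l\<^sup>2 * (f x - \<delta> / 2) - (m k)\<^sup>2 * (f x - \<delta>)) < 0"
          by (simp only: right_diff_distrib mult.left_commute)
        then show False using d2 elim by (simp add: mult_less_0_iff)
      qed
    qed
    then show ?thesis by (rule that)
  qed
  then obtain K where K: "\<And>k. K \<le> k \<Longrightarrow> norm (y k - x) \<le> \<rho>" unfolding eventually_sequentially by blast
  have "\<forall>k. y (k + K) \<in> cball x \<rho>" using K by (simp add: dist_norm norm_minus_commute)
  then obtain y' \<phi> where \<phi>: "strict_mono \<phi>" and lim0: "((\<lambda>k. y (k + K)) \<circ> \<phi>) \<longlonglongrightarrow> y'"
    using compact_cball[of x \<rho>] unfolding compact_def by (metis (no_types, lifting))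
  define j where "j = (\<lambda>k. \<phi> k + K)"
  have yj: "(\<lambda>k. y (j k)) \<longlonglongrightarrow> y'" using lim0 by (simp add: j_def o_def)
  have mj: "(\<lambda>k. m (j k)) \<longlonglongrightarrow> l"
    using LIMSEQ_subseq_LIMSEQ[OF LIMSEQ_ignore_initial_segment[OF m_lim, of K] \<phi>]
    by (simp add: j_def o_def)
  have dist_ge: "l \<le> norm (y' - x)"
  proof (rule LIMSEQ_le_const)
    show "(\<lambda>k. norm (y (j k) - x)) \<longlonglongrightarrow> norm (y' - x)" by (intro tendsto_intros yj)
    show "\<exists>N. \<forall>n\<ge>N. l \<le> norm (y (j n) - x)" using m(1) y(2) order_trans by blast
  qed
  have y'x: "y' \<noteq> x" using dist_ge l by auto
  have inv0: "sphere_inv x l y' \<noteq> 0" by (rule sphere_inv_nonzero[OF l dist_ge])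
  have kel_lim: "(\<lambda>k. sphere_kelvin x (m (j k)) f (y (j k))) \<longlonglongrightarrow> sphere_kelvin x l f y'"
    by (rule tendsto_sphere_kelvin[OF mj yj y'x _ f_cont[OF inv0]]) (use l in simp)
  show False
  proof (cases "y' = 0")
    case True
    obtain \<delta> r where \<delta>: "\<delta> > 0" "r > 0" and gap: "\<And>y. y \<noteq> 0 \<Longrightarrow> norm y < r \<Longrightarrow> f y \<le> sphere_kelvin x l f 0 - \<delta>"
      using below_strict_at_zero[OF l below] by blast
    have "\<forall>\<^sub>F k in sequentially. norm (y (j k)) < r"
      using order_tendstoD(2)[OF tendsto_norm[OF yj], of r] True \<delta> by simp
    then have "\<forall>\<^sub>F k in sequentially. sphere_kelvin x (m (j k)) f (y (j k)) \<le> sphere_kelvin x l f 0 - \<delta>"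
      by eventually_elim (use gap y(1,3) in \<open>meson less_imp_le less_le_trans\<close>)
    from tendsto_upperbound[OF kel_lim this] show False using \<delta> True by simp
  next
    case False
    have f_lim: "(\<lambda>k. f (y (j k))) \<longlonglongrightarrow> f y'"
      by (rule isCont_tendsto_compose[OF f_cont[OF False] yj])
    have le: "sphere_kelvin x l f y' \<le> f y'"
      by (rule LIMSEQ_le[OF kel_lim f_lim]) (use y(3) less_imp_le in blast)
    have dist_eq: "norm (y' - x) = l"
      using below_strict[OF l below False] le dist_ge by force
    \<comment> \<open>\<open>H q / t\<^sup>2\<close> is minus the derivative of \<open>t \<mapsto> f(x + t w)/t\<close> at the point \<open>q = x + t w\<close>.\<close>
    define H where "H = (\<lambda>q. f q - grad f q \<bullet> (q - x))"
    note cf = has_jet_continuous_on[OF solutionD(3)[OF f]]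
    have "H y' > 0"
      using boundary_derivative[OF l below dist_eq] by (simp add: H_def)
    moreover have "(H \<longlongrightarrow> H y') (nhds y')"
      using False unfolding H_def
      by (intro tendsto_nhds_continuous_on[of "- {0}"] continuous_intros cf) auto
    ultimately have "\<forall>\<^sub>F q in nhds y'. H q > 0" by (rule order_tendstoD(1)[rotated])
    moreover have "\<forall>\<^sub>F q in nhds y'. q \<in> - {0}"
      by (rule eventually_nhds_in_open) (use False in auto)
    ultimately have "\<forall>\<^sub>F q in nhds y'. H q > 0 \<and> q \<noteq> 0" by eventually_elim simp
    then obtain r where r: "r > 0" and good: "\<And>q. dist q y' < r \<Longrightarrow> H q > 0 \<and> q \<noteq> 0"
      unfolding eventually_nhds_metric by blast
    define w where "w = (\<lambda>k. y (j k) - x)"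
    define \<tau> where "\<tau> = (\<lambda>k. (m (j k))\<^sup>2 / (w k \<bullet> w k))"
    have w_lim: "w \<longlonglongrightarrow> y' - x" unfolding w_def by (intro tendsto_intros yj)
    have yy: "(y' - x) \<bullet> (y' - x) = l\<^sup>2" using dist_eq by (simp flip: power2_norm_eq_inner)
    have "\<tau> \<longlonglongrightarrow> l\<^sup>2 / ((y' - x) \<bullet> (y' - x))"
      unfolding \<tau>_def by (intro tendsto_intros w_lim mj) (use y'x in simp)
    then have \<tau>_lim: "\<tau> \<longlonglongrightarrow> 1" using l by (simp add: yy)
    have "(\<lambda>k. norm (y (j k) - y') + (1 - \<tau> k) * norm (w k)) \<longlonglongrightarrow> norm (y' - y') + (1 - 1) * norm (y' - x)"
      by (intro tendsto_intros yj \<tau>_lim w_lim)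
    then have "\<forall>\<^sub>F k in sequentially. norm (y (j k) - y') + (1 - \<tau> k) * norm (w k) < r"
      by (rule order_tendstoD(2)) (use r in simp)
    then obtain k where k: "norm (y (j k) - y') + (1 - \<tau> k) * norm (w k) < r"
      unfolding eventually_sequentially by blast
    have mw: "m (j k) \<le> norm (w k)" unfolding w_def by (rule y(2))
    have ww: "w k \<bullet> w k > 0" using mw m_pos[of "j k"] by auto
    have "(m (j k))\<^sup>2 \<le> w k \<bullet> w k"
      using mw m_pos[of "j k"] by (simp add: power_mono flip: power2_norm_eq_inner)
    then have \<tau>: "0 < \<tau> k" "\<tau> k \<le> 1" using ww m_pos[of "j k"] by (auto simp: \<tau>_def)
    have viol: "f (x + \<tau> k *\<^sub>R w k) / \<tau> k < f (x + 1 *\<^sub>R w k) / 1"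
      using y(3)[of "j k"] by (simp add: sphere_kelvin_def sphere_inv_def \<tau>_def w_def mult.commute)
    \<comment> \<open>The segment from the image of \<open>y (j k)\<close> to \<open>y (j k)\<close> is close to \<open>y'\<close>, hence avoids the origin.\<close>
    have seg: "H (x + t *\<^sub>R w k) > 0 \<and> x + t *\<^sub>R w k \<noteq> 0" if t: "\<tau> k \<le> t" "t \<le> 1" for t
    proof (rule good)
      have eq: "x + t *\<^sub>R w k - y' = (y (j k) - y') - (1 - t) *\<^sub>R w k"
        by (simp add: w_def algebra_simps)
      have "norm (x + t *\<^sub>R w k - y') \<le> norm (y (j k) - y') + (1 - t) * norm (w k)"
        unfolding eq using norm_triangle_ineq4[of "y (j k) - y'" "(1 - t) *\<^sub>R w k"] t by simp
      also have "\<dots> \<le> norm (y (j k) - y') + (1 - \<tau> k) * norm (w k)"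
        using t by (intro add_left_mono mult_right_mono) auto
      finally show "dist (x + t *\<^sub>R w k) y' < r" using k by (simp add: dist_norm)
    qed
    have "f (x + 1 *\<^sub>R w k) / 1 \<le> f (x + \<tau> k *\<^sub>R w k) / \<tau> k"
    proof (rule DERIV_nonpos_imp_nonincreasing[of "\<tau> k" 1 "\<lambda>t. f (x + t *\<^sub>R w k) / t"])
      fix t assume t: "\<tau> k \<le> t" "t \<le> 1"
      have t0: "t > 0" using t \<tau> by simp
      have "((\<lambda>t. f (x + t *\<^sub>R w k)) has_real_derivative grad f (x + t *\<^sub>R w k) \<bullet> w k) (at t)"
        by (rule has_jet_ray(1)[OF solutionD(3)[OF f]]) (use seg[OF t] in simp)
      from DERIV_divide[OF this DERIV_ident] t0
      have "((\<lambda>t. f (x + t *\<^sub>R w k) / t) has_real_derivative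
          (grad f (x + t *\<^sub>R w k) \<bullet> w k * t - f (x + t *\<^sub>R w k) * 1) / (t * t)) (at t)" by simp
      moreover have "(grad f (x + t *\<^sub>R w k) \<bullet> w k * t - f (x + t *\<^sub>R w k) * 1) / (t * t) \<le> 0"
        using seg[OF t] t0 by (intro divide_nonpos_pos) (simp_all add: H_def mult.commute)
      ultimately show "\<exists>y. ((\<lambda>t. f (x + t *\<^sub>R w k) / t) has_real_derivative y) (at t) \<and> y \<le> 0"
        by blast
    qed (rule \<tau>(2))
    then show False using viol by simp
  qed
qed

lemma moving_spheres:
  assumes l: "0 < l" "l < norm x"
  shows "below_sphere_kelvin f x l"
proof (rule ccontr)
  assume bad: "\<not> below_sphere_kelvin f x l"
  have x: "x \<noteq> 0" using l by auto
  obtain l0 where l0: "l0 > 0" "\<And>l. 0 < l \<Longrightarrow> l \<le> l0 \<Longrightarrow> below_sphere_kelvin f x l"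
    using start_moving_spheres[OF x] by blast
  define B where "B = {m. 0 < m \<and> m < norm x \<and> \<not> below_sphere_kelvin f x m}"
  define c where "c = Inf B"
  have lB: "l \<in> B" using l bad by (simp add: B_def)
  have B_bdd: "bdd_below B" unfolding B_def by (rule bdd_belowI[of _ 0]) auto
  have "l0 \<le> m" if "m \<in> B" for m using that l0(2)[of m] unfolding B_def by force
  then have "l0 \<le> c" unfolding c_def using lB by (intro cInf_greatest) auto
  then have c: "0 < c" "c < norm x" using l0(1) cInf_lower[OF lB B_bdd] l by (auto simp: c_def)
  have before: "below_sphere_kelvin f x m" if "0 < m" "m < c" for m
    using cInf_lower[OF _ B_bdd, of m] that c by (force simp: B_def c_def)
  have "below_sphere_kelvin f x c"
    unfolding below_sphere_kelvin_def
    using below_sphere_kelvin_limit[OF c(1) before] sphere_inv_nonzero[OF c] by blast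
  from continue_moving_spheres[OF c this]
  obtain e where e: "e > 0" "\<And>m. c \<le> m \<Longrightarrow> m < c + e \<Longrightarrow> below_sphere_kelvin f x m" by blast
  obtain m where "m \<in> B" "m < c + e" using cInf_lessD[of B "c + e"] lB e(1) by (auto simp: c_def)
  moreover have "c \<le> m" using cInf_lower[OF \<open>m \<in> B\<close> B_bdd] by (simp add: c_def)
  ultimately show False using e(2) by (simp add: B_def)
qed

text \<open>
  The spheres about \<open>R e\<close> through the origin converge to the hyperplane orthogonal to \<open>e\<close>, and the Kelvin
  transforms converge to the reflection. The radius \<open>R = |x|\<close> is itself a limit of the radii \<open>l < |x|\<close>. Here
  \<open>D k\<close> is the factor \<open>|y - x|\<^sup>2/R\<^sup>2\<close> and \<open>z k\<close> the image of \<open>y\<close>.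
\<close>

lemma reflection_monotone:
  assumes e: "norm e = 1" and y: "y \<bullet> e < 0"
  shows "f y \<le> f (y - (2 * (y \<bullet> e)) *\<^sub>R e)"
proof -
  have ee: "e \<bullet> e = 1" using e by (simp flip: power2_norm_eq_inner)
  have y0: "y \<noteq> 0" using y by auto
  define D where "D = (\<lambda>k::nat. 1 - 2 * (y \<bullet> e) / real (Suc k) + (y \<bullet> y) / real (Suc k) / real (Suc k))"
  define z where "z = (\<lambda>k::nat. ((- 2 * (y \<bullet> e) + (y \<bullet> y) / real (Suc k)) / D k) *\<^sub>R e + (1 / D k) *\<^sub>R y)"
  have D1: "D k > 1" for k
  proof -
    have "2 * (y \<bullet> e) / real (Suc k) < 0" using y by (simp add: divide_neg_pos)
    moreover have "(y \<bullet> y) / real (Suc k) / real (Suc k) \<ge> 0" by simp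
    ultimately show ?thesis unfolding D_def by linarith
  qed
  have le: "f y \<le> D k * f (z k)" for k
  proof -
    define R where "R = real (Suc k)"
    define x where "x = R *\<^sub>R e"
    have R: "R > 0" by (simp add: R_def)
    have nx: "norm x = R" using e R by (simp add: x_def)
    have D: "D k = 1 - 2 * (y \<bullet> e) / R + (y \<bullet> y) / R / R" by (simp add: D_def R_def)
    have yx: "(y - x) \<bullet> (y - x) = R\<^sup>2 * D k"
      using R ee by (simp add: x_def D inner_diff_left inner_diff_right inner_commute[of e y]
          power2_eq_square field_simps)
    have "R\<^sup>2 * 1 < R\<^sup>2 * D k" using D1[of k] R by (intro mult_strict_left_mono) auto
    then have "R\<^sup>2 < (norm (y - x))\<^sup>2" by (simp add: power2_norm_eq_inner yx)
    then have dist: "R < norm (y - x)" using power2_less_imp_less by fastforce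
    have inv: "sphere_inv x R y = z k"
    proof -
      have "sphere_inv x R y = x + (1 / D k) *\<^sub>R (y - x)"
        using R by (simp add: sphere_inv_def yx)
      also have "\<dots> = (R * (1 - 1 / D k)) *\<^sub>R e + (1 / D k) *\<^sub>R y"
        by (simp add: x_def algebra_simps)
      also have "R * (1 - 1 / D k) = (R * (D k - 1)) / D k"
        using D1[of k] by (simp add: field_simps)
      also have "R * (D k - 1) = - 2 * (y \<bullet> e) + (y \<bullet> y) / R"
        using R by (simp add: D field_simps)
      finally show ?thesis by (simp add: z_def R_def)
    qed
    have "sphere_inv x R y \<noteq> 0"
    proof
      assume "sphere_inv x R y = 0"
      moreover have "y \<noteq> x" using dist R by auto
      ultimately have "sphere_inv x R 0 = y" using sphere_inv_involution[of y x R] R by simp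
      moreover have "sphere_inv x R 0 = 0" using sphere_inv_fixed[of 0 x R] nx R by simp
      ultimately show False using y0 by simp
    qed
    then have "f y \<le> sphere_kelvin x R f y"
      using moving_spheres[of _ x] nx R dist y0 by (intro below_sphere_kelvin_limit) auto
    also have "\<dots> = D k * f (z k)" using R by (simp add: sphere_kelvin_def inv yx)
    finally show ?thesis .
  qed
  define y' where "y' = y - (2 * (y \<bullet> e)) *\<^sub>R e"
  have "D \<longlonglongrightarrow> 1 - 0 + 0 * 0"
  proof -
    have "(\<lambda>k. 1 - 2 * (y \<bullet> e) / real (Suc k) + (y \<bullet> y) / real (Suc k) * (1 / real (Suc k))) \<longlonglongrightarrow> 1 - 0 + 0 * 0"
      by (intro tendsto_intros LIMSEQ_Suc[OF lim_const_over_n])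
    then show ?thesis by (simp add: D_def[abs_def])
  qed
  then have D_lim: "D \<longlonglongrightarrow> 1" by simp
  have "z \<longlonglongrightarrow> ((- 2 * (y \<bullet> e) + 0) / 1) *\<^sub>R e + (1 / 1) *\<^sub>R y"
    unfolding z_def by (intro tendsto_intros D_lim LIMSEQ_Suc[OF lim_const_over_n]) auto
  then have z_lim: "z \<longlonglongrightarrow> y'" by (simp add: y'_def)
  have "y' \<bullet> y' = y \<bullet> y"
    using ee by (simp add: y'_def inner_diff_left inner_diff_right inner_commute[of e y])
  then have "y' \<noteq> 0" using y0 by auto
  then have "(\<lambda>k. D k * f (z k)) \<longlonglongrightarrow> 1 * f y'"
    by (intro tendsto_mult D_lim isCont_tendsto_compose[OF f_cont z_lim])
  then have "f y \<le> 1 * f y'" by (rule LIMSEQ_le_const) (use le in blast)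
  then show ?thesis by (simp add: y'_def)
qed

lemma radially_symmetric:
  assumes "x \<noteq> 0" "y \<noteq> 0" and eq: "norm x = norm y"
  shows "f x = f y"
proof -
  have half: "f x \<le> f y" if x: "x \<noteq> y" "norm x = norm y" for x y
  proof -
    define e where "e = (1 / norm (y - x)) *\<^sub>R (y - x)"
    have n: "norm (y - x) > 0" using x by simp
    have e: "norm e = 1" using n by (simp add: e_def)
    have xx: "x \<bullet> x = y \<bullet> y" using x(2) by (simp add: norm_eq_sqrt_inner)
    then have xe: "2 * (x \<bullet> (y - x)) = - ((y - x) \<bullet> (y - x))"
      by (simp add: inner_diff_left inner_diff_right inner_commute[of y x])
    have nn: "(y - x) \<bullet> (y - x) = norm (y - x) * norm (y - x)"
      by (simp add: power2_eq_square flip: power2_norm_eq_inner)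
    have "2 * (x \<bullet> e) = 2 * (x \<bullet> (y - x)) / norm (y - x)" by (simp add: e_def)
    then have xe': "2 * (x \<bullet> e) = - norm (y - x)" using n unfolding xe nn by simp
    have "f x \<le> f (x - (2 * (x \<bullet> e)) *\<^sub>R e)"
      by (rule reflection_monotone[OF e]) (use xe' n in linarith)
    also have "x - (2 * (x \<bullet> e)) *\<^sub>R e = y" unfolding xe' using n by (simp add: e_def)
    finally show ?thesis .
  qed
  show ?thesis using half[of x y] half[of y x] eq by fastforce
qed

end

section \<open>Radial symmetry\<close>

theorem theorem1p2:
  fixes U :: "(real ^ 'n ^ 'n) set"
    and F :: "real ^ 'n ^ 'n \<Rightarrow> real"
    and u :: "real ^ 'n \<Rightarrow> real"
  assumes n_ge_3: "CARD('n) \<ge> 3"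
    and U_open: "openin (top_of_set sym_mats) U"
    and U_invariant: "\<And>Q :: real ^ 'n ^ 'n. orthogonal_matrix Q \<Longrightarrow>
          (\<lambda>M. matrix_inv Q ** M ** Q) ` U = U"
    and U_convex: "\<And>M N. M \<in> sym_mats \<Longrightarrow> N \<in> pos_def_mats \<Longrightarrow>
          convex (U \<inter> {M + t *\<^sub>R N | t. 0 < t})"
    and F_C1: "C1_on_sym U F"
    and F_invariant: "\<And>M Q. M \<in> U \<Longrightarrow> orthogonal_matrix Q \<Longrightarrow>
          F (matrix_inv Q ** M ** Q) = F M"
    and F_elliptic: "\<And>M. M \<in> U \<Longrightarrow> mat_gradient F M \<in> pos_def_mats"
    and u_C2: "C2_on (UNIV - {0}) u"
    and u_pos: "\<And>x. x \<noteq> 0 \<Longrightarrow> u x > 0"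
    and u_superharmonic: "\<And>x. x \<noteq> 0 \<Longrightarrow> laplacian u x \<le> 0"
    and u_in_U: "\<And>x. x \<noteq> 0 \<Longrightarrow> conf_mat u x \<in> U"
    and u_eq: "\<And>x. x \<noteq> 0 \<Longrightarrow> F (conf_mat u x) = 1"
    and u_not_extendable: "\<not> (\<exists>v r. (\<forall>x. x \<noteq> 0 \<longrightarrow> v x = u x) \<and> r > 0 \<and>
          C2_on (ball 0 r) v \<and> (\<forall>x\<in>ball 0 r. v x > 0 \<and> conf_mat v x \<in> U))"
  shows "\<forall>x y. x \<noteq> 0 \<longrightarrow> y \<noteq> 0 \<longrightarrow> norm x = norm y \<longrightarrow> u x = u y"
proof -
  define k where "k = - (2 / (real CARD('n) - 2))"
  have k: "k < 0" using n_ge_3 by (simp add: k_def)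
  define E where "E = {M \<in> U. F M = 1 \<and> trace M \<ge> 0}"
  define f where "f = (\<lambda>x. u x powr k)"
  have tr: "trace (matrix_inv Q ** M ** Q) = trace M"
    if Q: "orthogonal_matrix Q" for M Q :: "real ^ 'n ^ 'n"
  proof -
    have "trace (matrix_inv Q ** M ** Q) = trace (Q ** (matrix_inv Q ** M))"
      by (rule trace_mul_sym)
    also have "\<dots> = trace M"
      using Q by (simp add: matrix_inv_orthogonal orthogonal_matrix_def matrix_mul_assoc)
    finally show ?thesis .
  qed
  interpret elliptic_level_set E
  proof
    show "CARD('n) \<ge> 3" by (rule n_ge_3)
    show "M \<in> sym_mats" if "M \<in> E" for M
      using that openin_imp_subset[OF U_open] by (auto simp: E_def)
    show "trace M \<ge> 0" if "M \<in> E" for M using that by (simp add: E_def)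
    show "matrix_inv Q ** M ** Q \<in> E" if Q: "orthogonal_matrix Q" and M: "M \<in> E" for Q M
      using U_invariant[OF Q] F_invariant[of M Q] tr[OF Q] Q M by (auto simp: E_def)
    show "N = 0" if "M \<in> E" "M + N \<in> E" "N \<in> sym_mats" "\<And>v. v \<bullet> (N *v v) \<ge> 0" for M N
      by (rule level_set_rigid[OF U_open F_C1 F_elliptic U_convex _ _ that(3,4)])
         (use that(1,2) in \<open>auto simp: E_def\<close>)
    fix M0 assume "M0 \<in> E"
    then have "M0 \<in> U" by (simp add: E_def)
    from level_set_linearization[OF U_open F_C1 F_elliptic this]
    obtain \<epsilon> c C where *: "\<epsilon> > 0" "c > 0" and lin: "\<forall>M1\<in>U. \<forall>M2\<in>U. norm (M1 - M0) < \<epsilon> \<longrightarrow>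
        norm (M2 - M0) < \<epsilon> \<longrightarrow> F M1 = F M2 \<longrightarrow>
        (\<exists>G. norm G \<le> C \<and> (\<forall>v. v \<bullet> (G *v v) \<ge> c * (v \<bullet> v)) \<and> G \<bullet> (M1 - M2) = 0)" by blast
    have "\<forall>M1\<in>E. \<forall>M2\<in>E. norm (M1 - M0) < \<epsilon> \<longrightarrow> norm (M2 - M0) < \<epsilon> \<longrightarrow>
        (\<exists>G. norm G \<le> C \<and> (\<forall>v. v \<bullet> (G *v v) \<ge> c * (v \<bullet> v)) \<and> G \<bullet> (M1 - M2) = 0)"
      using lin by (auto simp: E_def)
    with * show "\<exists>\<epsilon>>0. \<exists>c>0. \<exists>C. \<forall>M1\<in>E. \<forall>M2\<in>E. norm (M1 - M0) < \<epsilon> \<longrightarrow> norm (M2 - M0) < \<epsilon> \<longrightarrow>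
        (\<exists>G. norm G \<le> C \<and> (\<forall>v. v \<bullet> (G *v v) \<ge> c * (v \<bullet> v)) \<and> G \<bullet> (M1 - M2) = 0)" by blast
  qed
  have open0: "open (- {0 :: real ^ 'n})" by auto
  have u_C2': "C2_on (- {0}) u" using u_C2 by (simp add: Compl_eq_Diff_UNIV)
  have sch: "schouten f x = conf_mat u x" if "x \<noteq> 0" for x
    using conf_mat_eq_schouten[OF n_ge_3 open0 u_C2' u_pos] that by (simp add: f_def k_def)
  have tr_conf: "trace (conf_mat u x) \<ge> 0" if x: "x \<noteq> 0" for x
  proof -
    let ?n = "real CARD('n)"
    define a where "a = 2 / (?n - 2) * u x powr (- ((?n + 2) / (?n - 2)))"
    define b where "b = 2 / (?n - 2)\<^sup>2 * u x powr (- (2 * ?n / (?n - 2)))"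
    have "conf_mat u x = - a *\<^sub>R hessian u x + (b * ?n) *\<^sub>R outer (grad u x) (grad u x)
        - (b * (norm (grad u x))\<^sup>2) *\<^sub>R mat 1"
      by (simp add: conf_mat_def Let_def a_def b_def mult_ac)
    then have "trace (conf_mat u x) = - a * laplacian u x"
      by (simp add: trace_add trace_sub trace_scaleR trace_outer trace_I laplacian_def
          power2_norm_eq_inner)
    moreover have "a \<ge> 0" using n_ge_3 by (simp add: a_def)
    ultimately show ?thesis using u_superharmonic[OF x] by (simp add: mult_nonneg_nonpos)
  qed
  have f_sol: "solution (- {0}) f"
    unfolding solution_def
  proof (intro conjI ballI)
    show "C2_on (- {0}) f"
      unfolding f_def
      by (rule has_jet_C2_on[OF open0 has_jet_powr[OF has_jet_grad_hessian[OF u_C2']]])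
         (use u_pos in simp)
    fix x :: "real ^ 'n" assume "x \<in> - {0}"
    then have x: "x \<noteq> 0" by simp
    show "f x > 0" using u_pos[OF x] by (simp add: f_def)
    show "schouten f x \<in> E"
      using sch[OF x] u_in_U[OF x] u_eq[OF x] tr_conf[OF x] by (simp add: E_def)
  qed (rule open0)
  \<comment> \<open>\<open>1/k = - (n - 2)/2\<close> is the exponent that leads back from \<open>f\<close> to \<open>u\<close>.\<close>
  have root: "(t powr k) powr (1 / k) = t" "(t powr (1 / k)) powr k = t" if "t > 0" for t :: real
    using k that by (simp_all add: powr_powr)
  interpret singular_entire_solution E f
  proof
    show "solution (- {0}) f" by (rule f_sol)
    show "\<not> (\<exists>h r. (\<forall>y. y \<noteq> 0 \<longrightarrow> h y = f y) \<and> r > 0 \<and> solution (ball 0 r) h)"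
    proof
      assume "\<exists>h r. (\<forall>y. y \<noteq> 0 \<longrightarrow> h y = f y) \<and> r > 0 \<and> solution (ball 0 r) h"
      then obtain h r where h: "\<And>y. y \<noteq> 0 \<Longrightarrow> h y = f y" and r: "r > 0"
        and sol: "solution (ball 0 r) h" by blast
      define v where "v = (\<lambda>x. h x powr (1 / k))"
      have vu: "v x = u x" if "x \<noteq> 0" for x
        using root(1)[OF u_pos[OF that]] h[OF that] by (simp add: v_def f_def)
      have v_C2: "C2_on (ball 0 r) v"
        unfolding v_def
        by (rule has_jet_C2_on[OF open_ball has_jet_powr[OF solutionD(3)[OF sol]]])
           (rule solutionD(4)[OF sol])
      have v_pos: "v x > 0" if "x \<in> ball 0 r" for x
        using solutionD(4)[OF sol that] by (simp add: v_def)
      have "conf_mat v x \<in> U" if x: "x \<in> ball 0 r" for x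
      proof -
        have "conf_mat v x = schouten (\<lambda>x. v x powr k) x"
          unfolding k_def by (rule conf_mat_eq_schouten[OF n_ge_3 open_ball v_C2 v_pos x])
        also have "\<dots> = schouten h x"
          by (rule C2_on_schouten_cong(2)[OF open_ball solutionD(2)[OF sol] _ x])
             (use root(2) solutionD(4)[OF sol] in \<open>simp add: v_def\<close>)
        also have "\<dots> \<in> U" using solutionD(5)[OF sol x] by (simp add: E_def)
        finally show ?thesis .
      qed
      then show False using u_not_extendable vu r v_C2 v_pos by blast
    qed
  qed
  show ?thesis
  proof (intro allI impI)
    fix x y :: "real ^ 'n" assume xy: "x \<noteq> 0" "y \<noteq> 0" "norm x = norm y"
    from radially_symmetric[OF this] have "u x powr k = u y powr k" by (simp add: f_def)
    then show "u x = u y" using root(1)[OF u_pos[OF xy(1)]] root(1)[OF u_pos[OF xy(2)]] by metis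
  qed
qed

end
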